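(* Let $G=(V,E)$ be a simple connected undirected graph that is locally finite and transient (for the simple random walk), let a local mechanism $\tau_x$ be fixed at every vertex $x\in V$, and let $a\in V$. Suppose that every tree (connected component of the underlying unoriented graph) in the wired spanning forest oriented toward infinity $\mathsf{WSF}$ of $G$ has a single end almost surely. Let $\rho$ be sampled from $\mathsf{WSF}$. Then the final rotor configuration $\sigma(\rho)$ of the rotor walk with initial location $a$, empty sink, and initial rotor configuration $\rho$ follows the law $\mathsf{WSF}$.
   Context: Local mechanisms and rotor configurations. Each vertex $x\in V$ carries a local mechanism $\tau_x$, a bijection of the neighbor set $N(x)$ having a single orbit, i.e. $\{\tau_x^i(y): i\ge 0\}=N(x)$ for every $y\in N(x)$. A rotor configuration is a function $\rho:V\to V$ with $\rho(x)\in N(x)$ for all $x$. Rotor walk (empty sink). Given $a\in V$ and a rotor configuration $\rho$, set $X_0=a$, $\rho_0=\rho$, and for $t\ge 0$: $X_{t+1}=\tau_{X_t}(\rho_t(X_t))$, $\rho_{t+1}(X_t)=\tau_{X_t}(\rho_t(X_t))$, and $\rho_{t+1}(x)=\rho_t(x)$ for $x\ne X_t$. The walk is transient if every vertex is visited finitely many times; then the final rotor configuration is $\sigma(\rho)(x):=\lim_{t\to\infty}\rho_t(x)$ for $x\in V$. For $G$ transient and $\rho\sim\mathsf{WSF}$ the rotor walk is known to be almost surely transient, so $\sigma(\rho)$ is almost surely well defined. Wired spanning forest. For $Z\subseteq V$, a $Z$-oriented spanning forest of $G$ is an oriented subgraph $F$ of $G$ in which every vertex of $Z$ has outdegree $0$,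 every vertex of $V\setminus Z$ has outdegree $1$, and there are no oriented cycles (including cycles of length 2). If $V\setminus Z$ is finite, $\mathsf{USF}(Z)$ is the uniform probability measure on the (finitely many) $Z$-oriented spanning forests. For $G$ transient, $\mathsf{WSF}$ is the unique probability measure on oriented subgraphs of $G$ such that for every finite set $B$ of oriented edges, $\mathsf{WSF}[B\subseteq F]=\lim_{R\to\infty}\mathsf{USF}(Z_R)[B\subseteq F_R]$, where $F\sim\mathsf{WSF}$, $F_R\sim\mathsf{USF}(Z_R)$, and $Z_0\supseteq Z_1\supseteq\cdots$ are subsets of $V$ with each $V\setminus Z_R$ finite and $\bigcap_R Z_R=\varnothing$; the limit exists and does not depend on the choice of $(Z_R)$. A forest $F$ in which each vertex has outdegree $1$ is identified with the rotor configuration sending $x$ to its out-neighbor in $F$. Ends. An end of a tree is an equivalence class of infinite (simple) paths, two paths being equivalent if they differ by only finitely many vertices. *)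

theory Defs
  imports "HOL-Probability.Probability"
begin

text \<open>
  A simple undirected graph whose vertices are all elements of the type \<open>'v\<close> is represented by a
  symmetric irreflexive relation \<open>E\<close>: the edge \<open>{x, y}\<close> appears as the two oriented edges
  \<open>(x, y)\<close> and \<open>(y, x)\<close>, the neighbours of \<open>x\<close> are \<open>E `` {x}\<close>, and an oriented subgraph is
  a set \<open>F \<subseteq> E\<close>.
\<close>

subsection \<open>Simple random walk\<close>

definition srw_kernel :: "'v rel \<Rightarrow> 'v \<Rightarrow> nat \<Rightarrow> (nat \<Rightarrow> 'v) \<Rightarrow> 'v measure" where
  "srw_kernel E x n \<omega> =
     measure_pmf (case n of 0 \<Rightarrow> return_pmf x | Suc k \<Rightarrow> pmf_of_set (E `` {\<omega> k}))"

interpretation srw: Ionescu_Tulcea "srw_kernel E x" "\<lambda>_. count_space UNIV" for E x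
proof (rule Ionescu_Tulcea.intro)
  fix n
  show "srw_kernel E x n \<in> measurable (PiM {0..<n} (\<lambda>_. count_space UNIV))
          (subprob_algebra (count_space UNIV))"
  proof (cases n)
    case 0
    then show ?thesis
      by (simp add: srw_kernel_def[abs_def] measure_pmf_in_subprob_algebra)
  next
    case (Suc k)
    have "(\<lambda>\<omega>. \<omega> k) \<in> measurable (PiM {0..<n} (\<lambda>_. count_space UNIV)) (count_space UNIV)"
      by (rule measurable_component_singleton) (simp add: Suc)
    then have "(\<lambda>\<omega>. measure_pmf (pmf_of_set (E `` {\<omega> k})))
        \<in> measurable (PiM {0..<n} (\<lambda>_. count_space UNIV)) (subprob_algebra (count_space UNIV))"
      by (rule measurable_compose) (simp add: measure_pmf_in_subprob_algebra)
    then show ?thesis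
      by (simp add: srw_kernel_def[abs_def] Suc)
  qed
next
  fix n \<omega>
  show "prob_space (srw_kernel E x n \<omega>)"
    unfolding srw_kernel_def by (rule prob_space_measure_pmf)
qed

text \<open>The law, on trajectories, of the simple random walk started at \<open>x\<close>.\<close>

definition srw :: "'v rel \<Rightarrow> 'v \<Rightarrow> (nat \<Rightarrow> 'v) measure" where
  "srw E x = srw.PF.lim E x"

definition transient_graph :: "'v rel \<Rightarrow> bool" where
  "transient_graph E \<longleftrightarrow> (\<forall>x. measure (srw E x) {\<omega>. \<exists>n\<ge>1. \<omega> n = x} < 1)"

subsection \<open>Rotor walk with empty sink\<close>

definition local_mechanism :: "'v rel \<Rightarrow> 'v \<Rightarrow> ('v \<Rightarrow> 'v) \<Rightarrow> bool" where
  "local_mechanism E x f \<longleftrightarrow> bij_betw f (E `` {x}) (E `` {x}) \<and>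
     (\<forall>y\<in>E `` {x}. {(f ^^ i) y | i. i \<ge> 0} = E `` {x})"

definition rotor_step :: "('v \<Rightarrow> 'v \<Rightarrow> 'v) \<Rightarrow> 'v \<times> ('v \<Rightarrow> 'v) \<Rightarrow> 'v \<times> ('v \<Rightarrow> 'v)" where
  "rotor_step \<tau> = (\<lambda>(x, \<rho>). (\<tau> x (\<rho> x), \<rho>(x := \<tau> x (\<rho> x))))"

definition walk_position :: "('v \<Rightarrow> 'v \<Rightarrow> 'v) \<Rightarrow> 'v \<Rightarrow> ('v \<Rightarrow> 'v) \<Rightarrow> nat \<Rightarrow> 'v" where
  "walk_position \<tau> a \<rho> t = fst ((rotor_step \<tau> ^^ t) (a, \<rho>))"

definition walk_rotors :: "('v \<Rightarrow> 'v \<Rightarrow> 'v) \<Rightarrow> 'v \<Rightarrow> ('v \<Rightarrow> 'v) \<Rightarrow> nat \<Rightarrow> 'v \<Rightarrow> 'v" where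
  "walk_rotors \<tau> a \<rho> t = snd ((rotor_step \<tau> ^^ t) (a, \<rho>))"

definition rotor_transient :: "('v \<Rightarrow> 'v \<Rightarrow> 'v) \<Rightarrow> 'v \<Rightarrow> ('v \<Rightarrow> 'v) \<Rightarrow> bool" where
  "rotor_transient \<tau> a \<rho> \<longleftrightarrow> (\<forall>x. finite {t. walk_position \<tau> a \<rho> t = x})"

text \<open>The limit is taken in the discrete set of vertices; where it does not exist, which can only
  happen if the walk is not transient, the value is unspecified.\<close>

definition final_rotors :: "('v \<Rightarrow> 'v \<Rightarrow> 'v) \<Rightarrow> 'v \<Rightarrow> ('v \<Rightarrow> 'v) \<Rightarrow> 'v \<Rightarrow> 'v" where
  "final_rotors \<tau> a \<rho> x = (THE y. \<forall>\<^sub>F t in sequentially. walk_rotors \<tau> a \<rho> t x = y)"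

subsection \<open>Wired spanning forest\<close>

text \<open>\<open>acyclic\<close> excludes directed closed walks of every positive length, in particular
  oriented cycles of length 2.\<close>

definition oriented_forests :: "'v rel \<Rightarrow> 'v set \<Rightarrow> 'v rel set" where
  "oriented_forests E Z = {F. F \<subseteq> E \<and> (\<forall>x\<in>Z. card (F `` {x}) = 0) \<and>
     (\<forall>x\<in>- Z. card (F `` {x}) = 1) \<and> acyclic F}"

text \<open>Only meaningful when \<open>oriented_forests E Z\<close> is finite and nonempty, as is the case when \<open>E\<close>
  is connected and locally finite, \<open>- Z\<close> is finite and \<open>Z\<close> is nonempty.\<close>

definition USF :: "'v rel \<Rightarrow> 'v set \<Rightarrow> 'v rel pmf" where
  "USF E Z = pmf_of_set (oriented_forests E Z)"

definition subgraph_space :: "'v rel \<Rightarrow> 'v rel measure" where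
  "subgraph_space E = sigma (Pow E) {{F. F \<subseteq> E \<and> e \<in> F} | e. e \<in> E}"

definition is_WSF :: "'v rel \<Rightarrow> 'v rel measure \<Rightarrow> bool" where
  "is_WSF E W \<longleftrightarrow> prob_space W \<and> sets W = sets (subgraph_space E) \<and>
     (\<forall>B Z. finite B \<and> B \<subseteq> E \<and> decseq Z \<and> (\<forall>R. finite (- Z R)) \<and> (\<Inter>R. Z R) = {} \<longrightarrow>
        (\<lambda>R. measure (USF E (Z R)) {F. B \<subseteq> F})
          \<longlonglongrightarrow> measure W {F. F \<subseteq> E \<and> B \<subseteq> F})"

text \<open>The identification of oriented subgraphs in which every vertex has outdegree 1 with rotor
  configurations; under a wired spanning forest almost every subgraph is of this kind.\<close>

definition rotor_of :: "'v rel \<Rightarrow> 'v \<Rightarrow> 'v" where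
  "rotor_of F x = (THE y. (x, y) \<in> F)"

definition rotor_space :: "('v \<Rightarrow> 'v) measure" where
  "rotor_space = PiM UNIV (\<lambda>_. count_space UNIV)"

subsection \<open>Ends\<close>

definition forest_trees :: "'v rel \<Rightarrow> 'v set set" where
  "forest_trees F = UNIV // (F \<union> F\<inverse>)\<^sup>*"

definition rays :: "'v rel \<Rightarrow> 'v set \<Rightarrow> (nat \<Rightarrow> 'v) set" where
  "rays F T = {p. inj p \<and> range p \<subseteq> T \<and> (\<forall>n. (p n, p (Suc n)) \<in> F \<union> F\<inverse>)}"

definition ends :: "'v rel \<Rightarrow> 'v set \<Rightarrow> (nat \<Rightarrow> 'v) set set" where
  "ends F T = rays F T // {(p, q). p \<in> rays F T \<and> q \<in> rays F T \<and>
     finite ((range p - range q) \<union> (range q - range p))}"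

end

theory Submission
  imports Defs
begin

text \<open>
  On a finite set \<open>D\<close> the rotor walk permutes the forests oriented out of \<open>D\<close>, because one step acts
  injectively on the unicycles obtained by collapsing all exits to \<open>a\<close>. The same injectivity bounds
  the number of forests for which the walk returns to \<open>x\<close> after a long excursion by the number of
  forests rooted at \<open>x\<close> and outside \<open>D\<close> in which the tree of \<open>x\<close> is large. Fix a path from \<open>x\<close> to a
  vertex \<open>v\<close> from which the random walk is unlikely to hit \<open>x\<close>; it exists by transience. Either the
  tree of \<open>x\<close> contains \<open>v\<close>, which is rare, or the rotors along the path can be redirected so that a
  forest without the root \<open>x\<close> arises in which a far vertex leads to the path; this is rare in the
  limit because one-ended trees have only finite sets of descendants. Hence late returns are rare
  uniformly in \<open>D\<close>, and both the transience of the walk and the invariance of the law pass to the limit.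
\<close>

subsection \<open>Rotor functions on a finite vertex set\<close>

text \<open>\<open>is_WSF\<close> controls only inclusions of finite edge sets, whereas a final
  rotor depends on the whole walk, and a return from very far away could still change it in the
  limit. Every infinite event is therefore compared with events of a finite set \<open>D\<close>,
  and the estimate for returns must not depend on \<open>D\<close>. The order of the choices makes
  this possible. The endpoint \<open>v\<close> comes first, because its loss
  \<open>hit_prob E x v / \<kappa>\<close> involves neither the path nor \<open>D\<close>. Then the
  path is fixed, which costs a product of degrees. Only afterwards is the inner radius made so large
  that the rarity of far descendants absorbs this product. The number \<kappa> is the degree of
  \<open>x\<close> times the probability of never returning to \<open>x\<close>, so transience makes
  it positive; it enters because forests with the extra root \<open>x\<close> must be compared with
  forests without it. Hitting probabilities are tied to forest counts by a maximum
  principle.\<close>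

definition rotor_graph :: "'v set \<Rightarrow> ('v \<Rightarrow> 'v) \<Rightarrow> 'v rel" where
  "rotor_graph D \<rho> = {(x, \<rho> x) | x. x \<in> D}"

lemma rotor_graph_iff: "(x, y) \<in> rotor_graph D \<rho> \<longleftrightarrow> x \<in> D \<and> y = \<rho> x"
  by (auto simp: rotor_graph_def)

lemma rotor_graph_cong: "(\<And>x. x \<in> D \<Longrightarrow> \<rho> x = \<rho>' x) \<Longrightarrow> rotor_graph D \<rho> = rotor_graph D \<rho>'"
  by (auto simp: rotor_graph_def)

lemma rotor_graph_mono: "D \<subseteq> D' \<Longrightarrow> rotor_graph D \<rho> \<subseteq> rotor_graph D' \<rho>"
  by (auto simp: rotor_graph_def)

lemma leads_mono: "D \<subseteq> D' \<Longrightarrow> (x, y) \<in> (rotor_graph D \<rho>)\<^sup>* \<Longrightarrow> (x, y) \<in> (rotor_graph D' \<rho>)\<^sup>*"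
  using rtrancl_mono[OF rotor_graph_mono] by blast

lemma leads_outside: "(x, y) \<in> (rotor_graph D \<rho>)\<^sup>* \<Longrightarrow> x \<notin> D \<Longrightarrow> y = x"
  by (erule converse_rtranclE) (auto simp: rotor_graph_iff)

text \<open>Before a path meets \<open>K\<close> it uses no rotor of \<open>K\<close>. Paths cut in
  this way survive any change of the rotors on \<open>K\<close>, which is how the redirections below
  keep old paths alive.\<close>

lemma leads_first_hit:
  assumes "(v, u) \<in> (rotor_graph D \<rho>)\<^sup>*" "u \<in> K"
  shows "\<exists>u'\<in>K. (v, u') \<in> (rotor_graph (D - K) \<rho>)\<^sup>*"
  using assms(1)
proof (induction rule: converse_rtrancl_induct)
  case base
  then show ?case using assms(2) by auto
next
  case (step y z)
  show ?case
  proof (cases "y \<in> K")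
    case False
    then have "(y, z) \<in> rotor_graph (D - K) \<rho>"
      using step(1) by (auto simp: rotor_graph_iff)
    then show ?thesis
      using step(3) by (meson converse_rtrancl_into_rtrancl)
  qed auto
qed

lemma leads_avoid:
  "(v, u) \<in> (rotor_graph D \<rho>)\<^sup>* \<Longrightarrow> (v, u) \<in> (rotor_graph (D - {u}) \<rho>)\<^sup>*"
  using leads_first_hit[of v u D \<rho> "{u}"] by auto

lemma leads_cong:
  assumes "(v, u) \<in> (rotor_graph D \<rho>)\<^sup>*" "\<And>y. y \<in> D \<Longrightarrow> \<rho>' y = \<rho> y" "D \<subseteq> D'"
  shows "(v, u) \<in> (rotor_graph D' \<rho>')\<^sup>*"
  using leads_mono[OF assms(3)] assms(1) rotor_graph_cong[of D \<rho>' \<rho>] assms(2) by metis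

text \<open>Extensionality (\<open>PiE\<close>) lets a function and its graph determine each other,
  so forests can be counted as functions. Acyclicity is replaced by an escape from \<open>D\<close>:
  equivalent for finite \<open>D\<close>, and the form in which path arguments use it.\<close>

definition forest_rotors :: "'v rel \<Rightarrow> 'v set \<Rightarrow> ('v \<Rightarrow> 'v) set" where
  "forest_rotors E D = {\<rho> \<in> PiE D (\<lambda>x. E `` {x}). \<forall>x\<in>D. \<exists>z. z \<notin> D \<and> (x, z) \<in> (rotor_graph D \<rho>)\<^sup>*}"

lemma acyclic_of_leads:
  assumes leads: "\<And>x. x \<in> D \<Longrightarrow> \<exists>z. z \<notin> D \<and> (x, z) \<in> (rotor_graph D \<rho>)\<^sup>*"
  shows "acyclic (rotor_graph D \<rho>)"
proof (rule acyclicI, rule allI, rule notI)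
  fix x assume cyc: "(x, x) \<in> (rotor_graph D \<rho>)\<^sup>+"
  then have "x \<in> D"
    by (auto dest!: tranclD simp: rotor_graph_iff)
  then obtain z where z: "z \<notin> D" "(x, z) \<in> (rotor_graph D \<rho>)\<^sup>*"
    using leads by blast
  \<comment> \<open>The rotor graph has out-degree at most one, so a path that starts on a cycle
    never leaves it: each vertex reached still leads back to \<open>x\<close>.\<close>
  have "(z, x) \<in> (rotor_graph D \<rho>)\<^sup>+"
    using z(2)
  proof (induction rule: rtrancl_induct)
    case base
    then show ?case using cyc .
  next
    case (step y w)
    from tranclD[OF step(3)] obtain w' where w': "(y, w') \<in> rotor_graph D \<rho>" "(w', x) \<in> (rotor_graph D \<rho>)\<^sup>*"
      by blast
    then have "w' = w" using step(2) by (auto simp: rotor_graph_iff)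
    then show ?case using w' cyc by (metis rtranclD)
  qed
  then show False
    using z(1) by (auto dest!: tranclD simp: rotor_graph_iff)
qed

lemma leads_of_acyclic:
  assumes "finite D" and acyc: "acyclic (rotor_graph D \<rho>)" and "x \<in> D"
  shows "\<exists>z. z \<notin> D \<and> (x, z) \<in> (rotor_graph D \<rho>)\<^sup>*"
proof -
  have "rotor_graph D \<rho> = (\<lambda>x. (x, \<rho> x)) ` D" by (auto simp: rotor_graph_def)
  then have "finite (rotor_graph D \<rho>)" using assms(1) by simp
  then have "wf ((rotor_graph D \<rho>)\<inverse>)"
    using acyc by (rule finite_acyclic_wf_converse)
  then show ?thesis
  proof (induction x rule: wf_induct_rule)
    case (less x)
    show ?case
    proof (cases "x \<in> D")
      case True
      then have e: "(x, \<rho> x) \<in> rotor_graph D \<rho>" by (simp add: rotor_graph_iff)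
      then have "\<exists>z. z \<notin> D \<and> (\<rho> x, z) \<in> (rotor_graph D \<rho>)\<^sup>*" using less by blast
      then show ?thesis using e by (meson converse_rtrancl_into_rtrancl)
    qed auto
  qed
qed

lemma forest_rotors_acyclic: "\<rho> \<in> forest_rotors E D \<Longrightarrow> acyclic (rotor_graph D \<rho>)"
  by (rule acyclic_of_leads) (auto simp: forest_rotors_def)

lemma forest_rotors_PiE: "\<rho> \<in> forest_rotors E D \<Longrightarrow> \<rho> \<in> PiE D (\<lambda>x. E `` {x})"
  by (simp add: forest_rotors_def)

lemma forest_rotors_leads:
  "\<rho> \<in> forest_rotors E D \<Longrightarrow> x \<in> D \<Longrightarrow> \<exists>z. z \<notin> D \<and> (x, z) \<in> (rotor_graph D \<rho>)\<^sup>*"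
  by (simp add: forest_rotors_def)

lemma rotor_of_rotor_graph: "x \<in> D \<Longrightarrow> rotor_of (rotor_graph D \<rho>) x = \<rho> x"
  by (simp add: rotor_of_def rotor_graph_iff)

lemma bij_betw_forest_rotors:
  assumes "finite D" and locally_finite: "\<And>x. finite (E `` {x})"
  shows "bij_betw (rotor_graph D) (forest_rotors E D) (oriented_forests E (- D))"
proof (rule bij_betwI')
  fix \<rho> \<rho>' assume "\<rho> \<in> forest_rotors E D" "\<rho>' \<in> forest_rotors E D"
  then have P: "\<rho> \<in> PiE D (\<lambda>x. E `` {x})" "\<rho>' \<in> PiE D (\<lambda>x. E `` {x})"
    by (auto simp: forest_rotors_def)
  show "(rotor_graph D \<rho> = rotor_graph D \<rho>') = (\<rho> = \<rho>')"
  proof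
    assume eq: "rotor_graph D \<rho> = rotor_graph D \<rho>'"
    show "\<rho> = \<rho>'"
      by (rule PiE_ext[OF P]) (metis eq rotor_of_rotor_graph)
  qed simp
next
  fix \<rho> assume \<rho>: "\<rho> \<in> forest_rotors E D"
  have "rotor_graph D \<rho> `` {x} = {\<rho> x}" if "x \<in> D" for x
    using that by (auto simp: rotor_graph_iff)
  moreover have "rotor_graph D \<rho> `` {x} = {}" if "x \<notin> D" for x
    using that by (auto simp: rotor_graph_iff)
  moreover have "rotor_graph D \<rho> \<subseteq> E"
    using forest_rotors_PiE[OF \<rho>] by (auto simp: rotor_graph_def PiE_def Pi_def)
  ultimately show "rotor_graph D \<rho> \<in> oriented_forests E (- D)"
    using forest_rotors_acyclic[OF \<rho>] by (auto simp: oriented_forests_def)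
next
  fix F assume F: "F \<in> oriented_forests E (- D)"
  have FE: "F \<subseteq> E" and F1: "\<And>x. x \<in> D \<Longrightarrow> card (F `` {x}) = 1" and ac: "acyclic F"
    and F0: "\<And>x. x \<notin> D \<Longrightarrow> card (F `` {x}) = 0"
    using F by (auto simp: oriented_forests_def)
  define \<rho> where "\<rho> = restrict (\<lambda>x. THE y. (x, y) \<in> F) D"
  have sing: "F `` {x} = {\<rho> x}" if x: "x \<in> D" for x
  proof -
    obtain y where "F `` {x} = {y}" using F1[OF x] by (auto simp: card_1_singleton_iff)
    then have "\<And>z. (x, z) \<in> F \<longleftrightarrow> z = y" by auto
    then show ?thesis by (auto simp: \<rho>_def x)
  qed
  \<comment> \<open>A zero \<open>card\<close> could also stand for an infinite set of out-edges;
    local finiteness excludes this.\<close>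
  have dom: "x \<in> D" if "(x, y) \<in> F" for x y
  proof (rule ccontr)
    assume "x \<notin> D"
    moreover have "finite (F `` {x})"
      using locally_finite[of x] FE by (meson Image_mono finite_subset subset_refl)
    ultimately show False using F0[of x] that by auto
  qed
  have eq: "F = rotor_graph D \<rho>"
  proof (intro set_eqI, clarify)
    fix x y
    show "(x, y) \<in> F \<longleftrightarrow> (x, y) \<in> rotor_graph D \<rho>"
      using sing[of x] dom[of x y] by (auto simp: rotor_graph_iff)
  qed
  moreover have "\<rho> \<in> forest_rotors E D"
  proof -
    have "(x, \<rho> x) \<in> E" if "x \<in> D" for x
      using sing[OF that] FE by auto
    then have "\<rho> \<in> PiE D (\<lambda>x. E `` {x})"
      by (auto simp: PiE_def Pi_def \<rho>_def)
    moreover have "acyclic (rotor_graph D \<rho>)"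
      using ac eq by simp
    ultimately show ?thesis
      using leads_of_acyclic[OF assms(1)] by (auto simp: forest_rotors_def)
  qed
  ultimately show "\<exists>\<rho>\<in>forest_rotors E D. F = rotor_graph D \<rho>"
    by blast
qed

subsection \<open>Rotor walk on a finite set with the exits collapsed to the starting point\<close>

lemma walk_position_0 [simp]: "walk_position \<tau> a \<rho> 0 = a"
  by (simp add: walk_position_def)

lemma walk_rotors_0 [simp]: "walk_rotors \<tau> a \<rho> 0 = \<rho>"
  by (simp add: walk_rotors_def)

lemma walk_position_Suc:
  "walk_position \<tau> a \<rho> (Suc t) =
    \<tau> (walk_position \<tau> a \<rho> t) (walk_rotors \<tau> a \<rho> t (walk_position \<tau> a \<rho> t))"
  by (simp add: walk_position_def walk_rotors_def rotor_step_def split: prod.split)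

lemma walk_rotors_Suc:
  "walk_rotors \<tau> a \<rho> (Suc t) = (walk_rotors \<tau> a \<rho> t)
    (walk_position \<tau> a \<rho> t := walk_position \<tau> a \<rho> (Suc t))"
  by (simp add: walk_position_def walk_rotors_def rotor_step_def split: prod.split)

text \<open>The rotor at a vertex that was left points along the last departure, so following rotors
  means following last departures, which ends at the chip. A step turns only the rotor under the
  chip, and a path to the chip can avoid using it.\<close>

lemma visited_leads:
  assumes "\<And>u. u \<le> s \<Longrightarrow> walk_position \<tau> a \<rho> u \<in> D" "t \<le> s"
  shows "(walk_position \<tau> a \<rho> t, walk_position \<tau> a \<rho> s) \<in> (rotor_graph D (walk_rotors \<tau> a \<rho> s))\<^sup>*"
  using assms
proof (induction s)
  case (Suc s)
  let ?X = "walk_position \<tau> a \<rho>" and ?r = "walk_rotors \<tau> a \<rho>"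
  show ?case
  proof (cases "t = Suc s")
    case False
    then have "(?X t, ?X s) \<in> (rotor_graph D (?r s))\<^sup>*"
      using Suc by auto
    then have "(?X t, ?X s) \<in> (rotor_graph D (?r (Suc s)))\<^sup>*"
      by (rule leads_cong[OF leads_avoid]) (auto simp: walk_rotors_Suc)
    moreover have "(?X s, ?X (Suc s)) \<in> rotor_graph D (?r (Suc s))"
      using Suc.prems(1)[of s] by (auto simp: rotor_graph_iff walk_rotors_Suc)
    ultimately show ?thesis by (rule rtrancl_into_rtrancl)
  qed auto
qed auto

definition exit_at :: "('v \<Rightarrow> 'v \<Rightarrow> 'v) \<Rightarrow> 'v \<Rightarrow> 'v set \<Rightarrow> ('v \<Rightarrow> 'v) \<Rightarrow> nat \<Rightarrow> bool" where
  "exit_at \<tau> a D \<rho> t \<longleftrightarrow> walk_position \<tau> a \<rho> t \<notin> D \<and> (\<forall>u<t. walk_position \<tau> a \<rho> u \<in> D)"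

lemma exit_at_unique: "exit_at \<tau> a D \<rho> t \<Longrightarrow> exit_at \<tau> a D \<rho> t' \<Longrightarrow> t = t'"
  by (metis exit_at_def linorder_neqE_nat)

definition collapse :: "'v \<Rightarrow> 'v set \<Rightarrow> ('v \<Rightarrow> 'v) \<Rightarrow> 'v \<Rightarrow> 'v" where
  "collapse a D \<rho> x = (if \<rho> x \<in> D then \<rho> x else a)"

lemma collapse_inside: "\<rho> x \<in> D \<Longrightarrow> collapse a D \<rho> x = \<rho> x"
  by (simp add: collapse_def)

lemma collapse_outside: "\<rho> x \<notin> D \<Longrightarrow> collapse a D \<rho> x = a"
  by (simp add: collapse_def)

text \<open>Only the chip is sent back to \<open>a\<close>. The stored rotor keeps the true exit,
  because \<tau> has to continue from it and is injective on true neighbours only.\<close>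

definition collapsed_step ::
  "('v \<Rightarrow> 'v \<Rightarrow> 'v) \<Rightarrow> 'v \<Rightarrow> 'v set \<Rightarrow> 'v \<times> ('v \<Rightarrow> 'v) \<Rightarrow> 'v \<times> ('v \<Rightarrow> 'v)" where
  "collapsed_step \<tau> a D = (\<lambda>(x, \<rho>).
     let \<rho>' = \<rho>(x := \<tau> x (\<rho> x)) in (collapse a D \<rho>' x, \<rho>'))"

text \<open>These are the recurrent states of the finite chip-and-rotor system: after collapsing all
  exits to \<open>a\<close> the rotors form a unicycle, and the chip lies on its cycle.\<close>

definition unicycles :: "'v rel \<Rightarrow> 'v \<Rightarrow> 'v set \<Rightarrow> ('v \<times> ('v \<Rightarrow> 'v)) set" where
  "unicycles E a D = {(x, \<rho>). x \<in> D \<and> \<rho> \<in> PiE D (\<lambda>x. E `` {x}) \<and>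
     (\<forall>v\<in>D. (v, x) \<in> (rotor_graph D (collapse a D \<rho>))\<^sup>*)}"

lemma funpow_cancel_inj_on:
  assumes "inj_on S U" "S ` U \<subseteq> U" "s \<in> U" "s' \<in> U"
    and "(S ^^ i) s = (S ^^ (i + k)) s'"
  shows "s = (S ^^ k) s'"
  using assms(5)
proof (induction i)
  case (Suc i)
  have mem: "(S ^^ n) u \<in> U" if "u \<in> U" for n u
    using that assms(2) by (induction n) auto
  have "S ((S ^^ i) s) = S ((S ^^ (i + k)) s')" using Suc.prems by simp
  then have "(S ^^ i) s = (S ^^ (i + k)) s'"
    using mem assms(1,3,4) by (meson inj_on_def)
  then show ?case by (rule Suc.IH)
qed simp

lemma funpow_return:
  assumes "inj_on S U" "S ` U \<subseteq> U" "finite U" "s \<in> U"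
  shows "\<exists>n\<ge>1. (S ^^ n) s = s"
proof -
  have mem: "(S ^^ n) s \<in> U" for n
    using assms(2,4) by (induction n) auto
  have "\<not> inj (\<lambda>n. (S ^^ n) s)"
    using finite_imageD[of "\<lambda>n. (S ^^ n) s" UNIV] mem assms(3)
    by (metis finite_subset image_subsetI infinite_UNIV_nat)
  then obtain i j where "i < j" "(S ^^ i) s = (S ^^ j) s"
    unfolding inj_def by (metis linorder_neqE_nat)
  then have "s = (S ^^ (j - i)) s"
    using funpow_cancel_inj_on[OF assms(1,2) assms(4) assms(4), of i "j - i"] by simp
  then show ?thesis
    using \<open>i < j\<close> by (metis Suc_leI zero_less_diff One_nat_def)
qed

locale rotor_system =
  fixes E :: "'v rel" and \<tau> :: "'v \<Rightarrow> 'v \<Rightarrow> 'v" and a :: 'v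
  assumes sym_E: "sym E"
    and connected: "\<And>x y. (x, y) \<in> E\<^sup>*"
    and locally_finite: "\<And>x. finite (E `` {x})"
    and infinite_V: "infinite (UNIV :: 'v set)"
    and \<tau>_maps: "\<And>x y. (x, y) \<in> E \<Longrightarrow> (x, \<tau> x y) \<in> E"
    and \<tau>_inj: "\<And>x. inj_on (\<tau> x) (E `` {x})"
begin

abbreviation "X \<equiv> walk_position \<tau> a"
abbreviation "Rot \<equiv> walk_rotors \<tau> a"
abbreviation "Conf D \<equiv> PiE D (\<lambda>x. E `` {x})"
abbreviation "Fo \<equiv> forest_rotors E"

lemma finite_Conf: "finite D \<Longrightarrow> finite (Conf D)"
  by (intro finite_PiE locally_finite)

lemma finite_forest_rotors: "finite D \<Longrightarrow> finite (Fo D)"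
  by (rule finite_subset[OF _ finite_Conf]) (auto simp: forest_rotors_def)

lemma Conf_edge: "\<rho> \<in> Conf D \<Longrightarrow> x \<in> D \<Longrightarrow> (x, \<rho> x) \<in> E"
  by auto

end

locale finite_rotor_system = rotor_system E \<tau> a
  for E :: "'v rel" and \<tau> :: "'v \<Rightarrow> 'v \<Rightarrow> 'v" and a :: 'v +
  fixes D :: "'v set"
  assumes finite_D: "finite D" and a_in_D: "a \<in> D"
begin

abbreviation "St \<equiv> collapsed_step \<tau> a D"
abbreviation "UC \<equiv> unicycles E a D"

lemma Conf_upd: "\<rho> \<in> Conf D \<Longrightarrow> x \<in> D \<Longrightarrow> \<rho>(x := \<tau> x (\<rho> x)) \<in> Conf D"
  using Conf_edge[of \<rho> D x] \<tau>_maps[of x "\<rho> x"] by (auto simp: PiE_def extensional_def)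

text \<open>Paths to the chip need not use the rotor under it, so turning that rotor breaks none of
  them; the turned rotor then prolongs them to the new position.\<close>

lemma St_unicycles:
  assumes "s \<in> UC" shows "St s \<in> UC"
proof -
  obtain x \<rho> where s: "s = (x, \<rho>)" by fastforce
  define \<rho>' where "\<rho>' = \<rho>(x := \<tau> x (\<rho> x))"
  have x: "x \<in> D" and \<rho>: "\<rho> \<in> Conf D"
    and l: "\<And>v. v \<in> D \<Longrightarrow> (v, x) \<in> (rotor_graph D (collapse a D \<rho>))\<^sup>*"
    using assms by (auto simp: s unicycles_def)
  let ?x' = "collapse a D \<rho>' x"
  have "(v, ?x') \<in> (rotor_graph D (collapse a D \<rho>'))\<^sup>*" if "v \<in> D" for v
  proof -
    have "(v, x) \<in> (rotor_graph D (collapse a D \<rho>'))\<^sup>*"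
      by (rule leads_cong[OF leads_avoid[OF l[OF that]]]) (auto simp: collapse_def \<rho>'_def)
    then show ?thesis
      by (rule rtrancl_into_rtrancl) (simp add: rotor_graph_iff x)
  qed
  moreover have "?x' \<in> D" using a_in_D by (simp add: collapse_def)
  moreover have "\<rho>' \<in> Conf D" using Conf_upd[OF \<rho> x] by (simp add: \<rho>'_def)
  ultimately show ?thesis
    by (simp add: s collapsed_step_def Let_def unicycles_def flip: \<rho>'_def)
qed

lemma finite_unicycles: "finite UC"
  by (rule finite_subset[of _ "D \<times> Conf D"]) (auto simp: unicycles_def finite_D finite_Conf)

text \<open>In a functional graph a vertex on a cycle has exactly one predecessor on that cycle.
  This identifies where the chip came from and makes the step reversible.\<close>

lemma cycle_predecessor_unique:
  assumes "x \<in> D" "y \<in> D" "g x = z" "g y = z"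
    and zx: "(z, x) \<in> (rotor_graph D g)\<^sup>*" and zy: "(z, y) \<in> (rotor_graph D g)\<^sup>*"
  shows "x = y"
proof (rule ccontr)
  assume "x \<noteq> y"
  let ?R = "(rotor_graph (D - {x, y}) g)\<^sup>*"
  \<comment> \<open>Let \<open>u\<close> be whichever of \<open>x\<close> and \<open>y\<close> the
    orbit of \<open>z\<close> meets first. From \<open>u\<close> the orbit returns to
    \<open>z\<close>, so it cycles without ever meeting the other vertex \<open>v\<close>.\<close>
  have contra: False
    if uv: "u \<noteq> v" "{u, v} = {x, y}" "g u = z" "(z, u) \<in> ?R" "(z, v) \<in> (rotor_graph D g)\<^sup>*" for u v
  proof -
    have "(v, u) \<in> ?R"
      using uv(5)
    proof (induction rule: rtrancl_induct)
      case base
      show ?case by (rule uv(4))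
    next
      case (step w w')
      then have w': "w' = g w" by (simp add: rotor_graph_iff)
      show ?case
      proof (cases "w = u")
        case True
        then show ?thesis using w' uv by simp
      next
        case False
        then obtain w'' where "(w, w'') \<in> rotor_graph (D - {x, y}) g" "(w'', u) \<in> ?R"
          using step(3) by (metis converse_rtranclE)
        then show ?thesis using w' by (simp add: rotor_graph_iff)
      qed
    qed
    moreover have "v \<notin> D - {x, y}" using uv(2) by auto
    ultimately show False using leads_outside[of v u] uv(1) by blast
  qed
  obtain u where "u \<in> {x, y}" "(z, u) \<in> ?R"
    using leads_first_hit[OF zx, of "{x, y}"] by auto
  then show False
    using contra[of x y] contra[of y x] \<open>x \<noteq> y\<close> assms by auto
qed

text \<open>The previous position of the chip is the predecessor of its present position on the
  cycle. Once it is known, injectivity of \<tau> at that vertex undoes the turn.\<close>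

lemma St_inj: "inj_on St UC"
proof (rule inj_onI)
  fix s1 s2 assume s12: "s1 \<in> UC" "s2 \<in> UC" "St s1 = St s2"
  obtain x \<rho> where s1: "s1 = (x, \<rho>)" by fastforce
  obtain y \<eta> where s2: "s2 = (y, \<eta>)" by fastforce
  define \<rho>' where "\<rho>' = \<rho>(x := \<tau> x (\<rho> x))"
  have eq: "\<rho>' = \<eta>(y := \<tau> y (\<eta> y))"
    and z: "collapse a D \<rho>' x = collapse a D \<rho>' y"
    using s12(3) by (auto simp: s1 s2 collapsed_step_def Let_def \<rho>'_def)
  have x: "x \<in> D" "\<rho> \<in> Conf D" and y: "y \<in> D" "\<eta> \<in> Conf D"
    and lx: "\<And>v. v \<in> D \<Longrightarrow> (v, x) \<in> (rotor_graph D (collapse a D \<rho>))\<^sup>*"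
    and ly: "\<And>v. v \<in> D \<Longrightarrow> (v, y) \<in> (rotor_graph D (collapse a D \<eta>))\<^sup>*"
    using s12 by (auto simp: s1 s2 unicycles_def)
  have lx': "(v, x) \<in> (rotor_graph D (collapse a D \<rho>'))\<^sup>*" if "v \<in> D" for v
    by (rule leads_cong[OF leads_avoid[OF lx[OF that]]]) (auto simp: collapse_def \<rho>'_def)
  have ly': "(v, y) \<in> (rotor_graph D (collapse a D \<rho>'))\<^sup>*" if "v \<in> D" for v
    by (rule leads_cong[OF leads_avoid[OF ly[OF that]]]) (auto simp: collapse_def eq)
  have "collapse a D \<rho>' x \<in> D" using a_in_D by (simp add: collapse_def)
  then have xy: "x = y"
    using cycle_predecessor_unique[of x y "collapse a D \<rho>'" "collapse a D \<rho>' x"] x y z lx' ly' by metis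
  have "\<rho>' x = \<tau> x (\<eta> x)"
    by (simp add: eq xy)
  then have "\<tau> x (\<rho> x) = \<tau> x (\<eta> x)"
    by (simp add: \<rho>'_def)
  then have "\<rho> x = \<eta> x"
    using \<tau>_inj[of x] Conf_edge[of \<rho> D x] Conf_edge[of \<eta> D x] x y xy by (auto simp: inj_on_def)
  moreover have "\<rho> v = \<eta> v" if "v \<noteq> x" for v
    using fun_cong[OF eq, of v] that by (simp add: \<rho>'_def xy)
  ultimately have "\<rho> = \<eta>" by (metis ext)
  then show "s1 = s2" by (simp add: s1 s2 xy)
qed

text \<open>A path can meet the complement of \<open>D\<close> only at its end, so collapsing
  affects nothing but the endpoint.\<close>

lemma leads_collapse:
  assumes "(v, u) \<in> (rotor_graph D \<rho>)\<^sup>*" "v \<in> D"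
  shows "(v, if u \<in> D then u else a) \<in> (rotor_graph D (collapse a D \<rho>))\<^sup>*"
  using assms
proof (induction rule: converse_rtrancl_induct)
  case (step y z)
  have e: "(y, collapse a D \<rho> y) \<in> rotor_graph D (collapse a D \<rho>)"
    using step by (simp add: rotor_graph_iff)
  have z: "z = \<rho> y" using step by (simp add: rotor_graph_iff)
  show ?case
  proof (cases "z \<in> D")
    case True
    then show ?thesis
      using converse_rtrancl_into_rtrancl[OF e] z step(3) by (simp add: collapse_inside)
  next
    case False
    then have "u = z" using leads_outside step(2) by metis
    then show ?thesis using False e z by (auto simp: collapse_outside)
  qed
qed auto

lemma forest_unicycle:
  assumes "\<rho> \<in> Fo D" shows "(a, \<rho>) \<in> UC"
proof -
  have "(v, a) \<in> (rotor_graph D (collapse a D \<rho>))\<^sup>*" if v: "v \<in> D" for v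
  proof -
    obtain z where "z \<notin> D" "(v, z) \<in> (rotor_graph D \<rho>)\<^sup>*"
      using forest_rotors_leads[OF assms v] by blast
    then show ?thesis using leads_collapse[of v z \<rho>] v by simp
  qed
  then show ?thesis
    using a_in_D forest_rotors_PiE[OF assms] by (simp add: unicycles_def)
qed

text \<open>A forest state is entered only through an exit: otherwise the edge \<open>x \<rightarrow> a\<close> just traversed
  would lie on a cycle.\<close>

lemma exit_before_forest:
  assumes "(x, \<rho>) \<in> UC" "St (x, \<rho>) = (a, \<rho>')" "\<rho>' \<in> Fo D"
  shows "\<tau> x (\<rho> x) \<notin> D"
proof
  assume inD: "\<tau> x (\<rho> x) \<in> D"
  have \<rho>': "\<rho>' = \<rho>(x := \<tau> x (\<rho> x))" and "collapse a D \<rho>' x = a"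
    using assms(2) by (auto simp: collapsed_step_def Let_def)
  then have xa: "\<rho>' x = a" using inD by (auto simp: collapse_def)
  have x: "x \<in> D" and l: "(a, x) \<in> (rotor_graph D (collapse a D \<rho>))\<^sup>*"
    using assms(1) a_in_D by (auto simp: unicycles_def)
  have "(a, x) \<in> (rotor_graph D (collapse a D \<rho>'))\<^sup>*"
    by (rule leads_cong[OF leads_avoid[OF l]]) (auto simp: collapse_def \<rho>')
  then have "x \<in> D \<and> (a, x) \<in> (rotor_graph D \<rho>')\<^sup>*"
  proof (induction rule: rtrancl_induct)
    case base
    then show ?case using a_in_D by auto
  next
    case (step w w')
    then have "w' = collapse a D \<rho>' w" "w \<in> D" by (auto simp: rotor_graph_iff)
    then show ?case
      using step(3) a_in_D
      by (auto simp: collapse_def rotor_graph_iff intro: rtrancl_into_rtrancl)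
  qed
  then have "(a, a) \<in> (rotor_graph D \<rho>')\<^sup>+"
    using xa x by (metis rotor_graph_iff rtrancl_into_trancl1)
  then show False
    using forest_rotors_acyclic[OF assms(3)] by (simp add: acyclic_def)
qed

text \<open>Under the collapsed rotors every vertex led to \<open>x\<close>, and after the turn
  \<open>x\<close> itself exits. A path that the collapse had diverted to \<open>a\<close> exits
  even earlier.\<close>

lemma forest_after_exit:
  assumes "(x, \<rho>) \<in> UC" "\<tau> x (\<rho> x) \<notin> D"
  shows "\<rho>(x := \<tau> x (\<rho> x)) \<in> Fo D"
proof -
  let ?\<rho>' = "\<rho>(x := \<tau> x (\<rho> x))"
  have x: "x \<in> D" "\<rho> \<in> Conf D"
    and l: "\<And>v. v \<in> D \<Longrightarrow> (v, x) \<in> (rotor_graph D (collapse a D \<rho>))\<^sup>*"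
    using assms(1) by (auto simp: unicycles_def)
  have ex: "(x, \<tau> x (\<rho> x)) \<in> (rotor_graph D ?\<rho>')\<^sup>*"
    using x by (intro r_into_rtrancl) (simp add: rotor_graph_iff)
  have "\<exists>z. z \<notin> D \<and> (v, z) \<in> (rotor_graph D ?\<rho>')\<^sup>*" if "v \<in> D" for v
    using l[OF that]
  proof (induction rule: converse_rtrancl_induct)
    case base
    then show ?case using ex assms(2) by blast
  next
    case (step y z)
    show ?case
    proof (cases "y = x")
      case True
      then show ?thesis using ex assms(2) by blast
    next
      case False
      then have e: "(y, \<rho> y) \<in> rotor_graph D ?\<rho>'" and z: "z = collapse a D \<rho> y"
        using step by (auto simp: rotor_graph_iff)
      show ?thesis
      proof (cases "\<rho> y \<in> D")
        case True
        then show ?thesis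
          using step(3) z converse_rtrancl_into_rtrancl[OF e] by (auto simp: collapse_inside simp del: fun_upd_apply)
      next
        case False
        then show ?thesis using e by blast
      qed
    qed
  qed
  then show ?thesis
    using Conf_upd[OF x(2,1)] by (simp add: forest_rotors_def)
qed

section \<open>Orbits of the collapsed step and the walk up to its first exit\<close>

lemma funpow_unicycles: "s \<in> UC \<Longrightarrow> (St ^^ n) s \<in> UC"
  by (induction n) (auto intro: St_unicycles)

lemma St_funpow:
  assumes "\<And>u. u \<le> t \<Longrightarrow> X \<rho> u \<in> D"
  shows "(St ^^ t) (a, \<rho>) = (X \<rho> t, Rot \<rho> t)"
  using assms
proof (induction t)
  case (Suc t)
  then have "(St ^^ t) (a, \<rho>) = (X \<rho> t, Rot \<rho> t)" by simp
  moreover have "X \<rho> (Suc t) \<in> D" using Suc by blast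
  ultimately show ?case
    by (simp add: collapsed_step_def Let_def collapse_inside walk_rotors_Suc walk_position_Suc fun_upd_def)
qed simp

lemma St_funpow_exit:
  assumes "exit_at \<tau> a D \<rho> t"
  shows "\<exists>t'. t = Suc t' \<and> (\<forall>u\<le>t'. X \<rho> u \<in> D) \<and> (St ^^ t) (a, \<rho>) = (a, Rot \<rho> t)"
proof -
  have "t \<noteq> 0" using assms a_in_D by (auto simp: exit_at_def intro!: Nat.gr0I)
  then obtain t' where t: "t = Suc t'" by (metis not0_implies_Suc)
  have in_D: "\<And>u. u \<le> t' \<Longrightarrow> X \<rho> u \<in> D" and out: "X \<rho> (Suc t') \<notin> D"
    using assms by (auto simp: exit_at_def t)
  have "(St ^^ t') (a, \<rho>) = (X \<rho> t', Rot \<rho> t')"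
    using in_D by (rule St_funpow)
  then have "(St ^^ t) (a, \<rho>) = (a, Rot \<rho> t)"
    using out by (simp add: t collapsed_step_def Let_def collapse_outside walk_rotors_Suc walk_position_Suc fun_upd_def)
  then show ?thesis using t in_D by blast
qed

text \<open>A walk confined to \<open>D\<close> would follow the collapsed step forever, and an
  injective self-map of a finite set returns to its start \<open>(a, \<rho>)\<close>. But a forest
  state is entered only through an exit.\<close>

lemma exit_exists:
  assumes "\<rho> \<in> Fo D" shows "\<exists>t. exit_at \<tau> a D \<rho> t"
proof (rule ccontr)
  assume no: "\<nexists>t. exit_at \<tau> a D \<rho> t"
  have in_D: "X \<rho> t \<in> D" for t
  proof (induction t rule: less_induct)
    case (less t)
    then show ?case using no by (auto simp: exit_at_def)
  qed
  have "St ` UC \<subseteq> UC" using St_unicycles by auto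
  then obtain n where n: "n \<ge> 1" "(St ^^ n) (a, \<rho>) = (a, \<rho>)"
    using funpow_return[OF St_inj _ finite_unicycles forest_unicycle[OF assms]] by blast
  then obtain m where m: "n = Suc m" by (metis Suc_le_D One_nat_def)
  have eq: "(St ^^ m) (a, \<rho>) = (X \<rho> m, Rot \<rho> m)" using in_D by (intro St_funpow)
  then have "(X \<rho> m, Rot \<rho> m) \<in> UC"
    using funpow_unicycles[OF forest_unicycle[OF assms]] by metis
  moreover have "St (X \<rho> m, Rot \<rho> m) = (a, \<rho>)" using n eq m by simp
  ultimately have "X \<rho> (Suc m) \<notin> D"
    using exit_before_forest assms by (simp add: walk_position_Suc)
  then show False using in_D by blast
qed

text \<open>Undoing \<open>i\<close> steps of both histories makes \<open>(a, \<rho>)\<close> the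
  state of the second one at time \<open>j - i\<close>. If this time were positive, a forest state
  would have been entered without an exit.\<close>

lemma history_unique:
  assumes "\<rho> \<in> Fo D" "\<rho>' \<in> Fo D"
    and "\<And>u. u \<le> j \<Longrightarrow> X \<rho>' u \<in> D"
    and "(St ^^ i) (a, \<rho>) = (St ^^ j) (a, \<rho>')" "i \<le> j"
  shows "\<rho> = \<rho>'"
proof -
  have "St ` UC \<subseteq> UC" using St_unicycles by auto
  then have eq: "(a, \<rho>) = (St ^^ (j - i)) (a, \<rho>')"
    using funpow_cancel_inj_on[OF St_inj _ forest_unicycle[OF assms(1)] forest_unicycle[OF assms(2)],
        of i "j - i"] assms(4,5) by simp
  show ?thesis
  proof (cases "j - i")
    case 0
    then show ?thesis using eq by simp
  next
    case (Suc m)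
    have eqm: "(St ^^ m) (a, \<rho>') = (X \<rho>' m, Rot \<rho>' m)"
      using assms(3) Suc by (intro St_funpow) auto
    then have "(X \<rho>' m, Rot \<rho>' m) \<in> UC"
      using funpow_unicycles[OF forest_unicycle[OF assms(2)]] by metis
    moreover have "St (X \<rho>' m, Rot \<rho>' m) = (a, \<rho>)" using eq eqm Suc by simp
    ultimately have "X \<rho>' (Suc m) \<notin> D"
      using exit_before_forest assms(1) by (simp add: walk_position_Suc)
    then show ?thesis using assms(3)[of "Suc m"] Suc by simp
  qed
qed

lemma history_unique':
  assumes "\<rho> \<in> Fo D" "\<rho>' \<in> Fo D"
    and "\<And>u. u \<le> i \<Longrightarrow> X \<rho> u \<in> D" "\<And>u. u \<le> j \<Longrightarrow> X \<rho>' u \<in> D"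
    and "(St ^^ i) (a, \<rho>) = (St ^^ j) (a, \<rho>')"
  shows "\<rho> = \<rho>'"
  using history_unique[of \<rho> \<rho>' j i] history_unique[of \<rho>' \<rho> i j] assms
  by (metis nle_le)

definition exit_rotors :: "('v \<Rightarrow> 'v) \<Rightarrow> 'v \<Rightarrow> 'v" where
  "exit_rotors \<rho> = Rot \<rho> (THE t. exit_at \<tau> a D \<rho> t)"

lemma exit_rotors_eq: "exit_at \<tau> a D \<rho> t \<Longrightarrow> exit_rotors \<rho> = Rot \<rho> t"
  unfolding exit_rotors_def by (metis exit_at_unique theI)

text \<open>The last step before the exit produces a forest, by \<open>forest_after_exit\<close>.
  Since \<open>Fo D\<close> is finite, it then suffices to recover the initial forest from the
  rotors at the exit.\<close>

lemma bij_exit_rotors: "bij_betw exit_rotors (Fo D) (Fo D)"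
proof -
  have "exit_rotors \<rho> \<in> Fo D" if \<rho>: "\<rho> \<in> Fo D" for \<rho>
  proof -
    obtain t where t: "exit_at \<tau> a D \<rho> t" using exit_exists[OF \<rho>] ..
    obtain t' where t': "t = Suc t'" "\<And>u. u \<le> t' \<Longrightarrow> X \<rho> u \<in> D"
      using St_funpow_exit[OF t] by blast
    have "(X \<rho> t', Rot \<rho> t') \<in> UC"
      using funpow_unicycles[OF forest_unicycle[OF \<rho>], of t'] St_funpow[of t', OF t'(2)] by simp
    then have "Rot \<rho> t \<in> Fo D"
      using forest_after_exit t t' by (auto simp: exit_at_def walk_position_Suc walk_rotors_Suc)
    then show ?thesis using exit_rotors_eq[OF t] by simp
  qed
  moreover have "inj_on exit_rotors (Fo D)"
  proof (rule inj_onI)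
    fix \<rho> \<rho>' assume \<rho>: "\<rho> \<in> Fo D" "\<rho>' \<in> Fo D" and eq: "exit_rotors \<rho> = exit_rotors \<rho>'"
    obtain t where t: "exit_at \<tau> a D \<rho> t" using exit_exists[OF \<rho>(1)] ..
    obtain s where s: "exit_at \<tau> a D \<rho>' s" using exit_exists[OF \<rho>(2)] ..
    obtain t' where t': "t = Suc t'" "\<And>u. u \<le> t' \<Longrightarrow> X \<rho> u \<in> D" "(St ^^ t) (a, \<rho>) = (a, Rot \<rho> t)"
      using St_funpow_exit[OF t] by blast
    obtain s' where s': "s = Suc s'" "\<And>u. u \<le> s' \<Longrightarrow> X \<rho>' u \<in> D" "(St ^^ s) (a, \<rho>') = (a, Rot \<rho>' s)"
      using St_funpow_exit[OF s] by blast
    \<comment> \<open>Histories are comparable only while both walks are inside \<open>D\<close>, so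
      the exit step itself is cancelled first.\<close>
    have "St ((St ^^ t') (a, \<rho>)) = St ((St ^^ s') (a, \<rho>'))"
      using t' s' eq exit_rotors_eq[OF t] exit_rotors_eq[OF s] by simp
    then have "(St ^^ t') (a, \<rho>) = (St ^^ s') (a, \<rho>')"
      using St_inj funpow_unicycles forest_unicycle \<rho> by (meson inj_onD)
    then show "\<rho> = \<rho>'" using history_unique' \<rho> t'(2) s'(2) by blast
  qed
  ultimately show ?thesis
    using endo_inj_surj[OF finite_forest_rotors[OF finite_D]]
    by (metis bij_betw_def image_subsetI)
qed

text \<open>This is the invariance of the law on a finite set, in counting form: at the first exit
  the rotors are again uniform on \<open>Fo D\<close>.\<close>

lemma card_exit_event:
  "card {\<rho> \<in> Fo D. \<exists>t. exit_at \<tau> a D \<rho> t \<and> Q (Rot \<rho> t)} = card {\<rho> \<in> Fo D. Q \<rho>}"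
proof -
  have "{\<rho> \<in> Fo D. \<exists>t. exit_at \<tau> a D \<rho> t \<and> Q (Rot \<rho> t)} = {\<rho> \<in> Fo D. Q (exit_rotors \<rho>)}"
  proof (rule Collect_cong, rule conj_cong)
    fix \<rho> assume "\<rho> \<in> Fo D"
    then obtain t where t: "exit_at \<tau> a D \<rho> t" using exit_exists by blast
    show "(\<exists>t. exit_at \<tau> a D \<rho> t \<and> Q (Rot \<rho> t)) = Q (exit_rotors \<rho>)"
      by (metis t exit_at_unique exit_rotors_eq)
  qed simp
  moreover have "bij_betw exit_rotors {\<rho> \<in> Fo D. Q (exit_rotors \<rho>)} {\<rho> \<in> Fo D. Q \<rho>}"
    by (rule bij_betw_Collect[OF bij_exit_rotors]) simp
  ultimately show ?thesis
    by (simp add: bij_betw_same_card)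
qed

text \<open>A visit to \<open>x\<close> after an excursion to \<open>y\<close> leaves rotors leading from \<open>y\<close> to \<open>x\<close>, and the
  walk can be run backwards from its state at that visit.\<close>

lemma card_revisit_le:
  assumes "x \<in> D"
  shows "card {\<rho> \<in> Fo D. \<exists>t s. t < s \<and> X \<rho> t \<notin> D' \<and> X \<rho> s = x \<and> (\<forall>u\<le>s. X \<rho> u \<in> D)}
    \<le> card (E `` {x}) * card {\<phi> \<in> Fo (D - {x}). \<exists>y\<in>D - D'. (y, x) \<in> (rotor_graph (D - {x}) \<phi>)\<^sup>*}"
    (is "card ?A \<le> _ * card ?B")
proof -
  define P where "P \<rho> s \<longleftrightarrow> (\<exists>t<s. X \<rho> t \<notin> D') \<and> X \<rho> s = x \<and> (\<forall>u\<le>s. X \<rho> u \<in> D)" for \<rho> s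
  define s where "s \<rho> = (SOME s. P \<rho> s)" for \<rho>
  have s: "P \<rho> (s \<rho>)" if "\<rho> \<in> ?A" for \<rho>
    unfolding s_def by (rule someI_ex) (use that in \<open>auto simp: P_def\<close>)
  \<comment> \<open>As the chip is known to be at \<open>x\<close>, this pair is the whole state at
    the chosen visit. Its first entry ranges over the neighbours of \<open>x\<close>, whence the
    degree in the bound.\<close>
  define m where "m \<rho> = (Rot \<rho> (s \<rho>) x, restrict (Rot \<rho> (s \<rho>)) (D - {x}))" for \<rho>
  have St_eq: "(St ^^ s \<rho>) (a, \<rho>) = (x, Rot \<rho> (s \<rho>))" and in_Un: "(x, Rot \<rho> (s \<rho>)) \<in> UC" if "\<rho> \<in> ?A" for \<rho>
  proof -
    show eq: "(St ^^ s \<rho>) (a, \<rho>) = (x, Rot \<rho> (s \<rho>))"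
      using St_funpow[of "s \<rho>" \<rho>] s[OF that] by (auto simp: P_def)
    have "(St ^^ s \<rho>) (a, \<rho>) \<in> UC"
      using that by (intro funpow_unicycles forest_unicycle) auto
    then show "(x, Rot \<rho> (s \<rho>)) \<in> UC" by (simp add: eq)
  qed
  have "m ` ?A \<subseteq> E `` {x} \<times> ?B"
  proof (rule image_subsetI)
    fix \<rho> assume \<rho>: "\<rho> \<in> ?A"
    define \<eta> where "\<eta> = Rot \<rho> (s \<rho>)"
    define \<phi> where "\<phi> = restrict \<eta> (D - {x})"
    have gr: "rotor_graph (D - {x}) \<phi> = rotor_graph (D - {x}) \<eta>"
      by (rule rotor_graph_cong) (simp add: \<phi>_def)
    have \<eta>: "\<eta> \<in> Conf D" and l: "\<And>v. v \<in> D \<Longrightarrow> (v, x) \<in> (rotor_graph D (collapse a D \<eta>))\<^sup>*"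
      using in_Un[OF \<rho>] by (auto simp: unicycles_def \<eta>_def)
    \<comment> \<open>Without the rotor at \<open>x\<close>, a path leads either to
      \<open>x\<close>, now a root, or to an exit that the collapse had replaced by
      \<open>a\<close>.\<close>
    have "\<exists>z. z \<notin> D - {x} \<and> (v, z) \<in> (rotor_graph (D - {x}) \<phi>)\<^sup>*" if "v \<in> D" for v
      using l[OF that, THEN leads_avoid]
    proof (induction rule: converse_rtrancl_induct)
      case base
      then show ?case by auto
    next
      case (step y z)
      then have y: "(y, \<eta> y) \<in> rotor_graph (D - {x}) \<phi>" and z: "z = collapse a D \<eta> y"
        unfolding gr by (auto simp: rotor_graph_iff)
      then show ?case
        using step(3) converse_rtrancl_into_rtrancl[OF y]
        by (cases "\<eta> y \<in> D") (auto simp: collapse_inside)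
    qed
    then have "\<phi> \<in> Fo (D - {x})"
      using \<eta> by (auto simp: forest_rotors_def \<phi>_def)
    moreover obtain t where t: "t < s \<rho>" "X \<rho> t \<notin> D'" "X \<rho> t \<in> D"
      using s[OF \<rho>] by (auto simp: P_def)
    moreover have "(X \<rho> t, x) \<in> (rotor_graph D \<eta>)\<^sup>*"
      using visited_leads[of "s \<rho>" \<tau> a \<rho> D t] s[OF \<rho>] t by (auto simp: P_def \<eta>_def)
    then have "(X \<rho> t, x) \<in> (rotor_graph (D - {x}) \<phi>)\<^sup>*"
      unfolding gr by (rule leads_avoid)
    ultimately show "m \<rho> \<in> E `` {x} \<times> ?B"
      using Conf_edge[OF \<eta> assms] by (auto simp: m_def \<phi>_def \<eta>_def)
  qed
  moreover have "inj_on m ?A"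
  proof (rule inj_onI)
    fix \<rho> \<rho>' assume \<rho>: "\<rho> \<in> ?A" "\<rho>' \<in> ?A" and eq: "m \<rho> = m \<rho>'"
    have C: "Rot \<rho> (s \<rho>) \<in> Conf D" "Rot \<rho>' (s \<rho>') \<in> Conf D"
      using in_Un \<rho> by (auto simp: unicycles_def)
    have "Rot \<rho> (s \<rho>) = Rot \<rho>' (s \<rho>')"
    proof (rule PiE_ext[OF C])
      fix v assume "v \<in> D"
      then show "Rot \<rho> (s \<rho>) v = Rot \<rho>' (s \<rho>') v"
        using eq unfolding m_def by (cases "v = x") (auto dest: fun_cong[of _ _ v])
    qed
    then show "\<rho> = \<rho>'"
      using history_unique'[of \<rho> \<rho>' "s \<rho>" "s \<rho>'"] St_eq \<rho> s[OF \<rho>(1)] s[OF \<rho>(2)] by (auto simp: P_def)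
  qed
  moreover have "finite (E `` {x} \<times> ?B)"
    using finite_D by (simp add: locally_finite finite_forest_rotors)
  ultimately have "card ?A \<le> card (E `` {x} \<times> ?B)"
    by (rule_tac card_inj_on_le)
  then show ?thesis by (simp add: card_cartesian_product)
qed

end

subsection \<open>Counting forests\<close>

context rotor_system
begin

lemma exists_boundary_edge:
  assumes "finite D" "x \<in> D"
  shows "\<exists>u\<in>D. \<exists>z. z \<notin> D \<and> (u, z) \<in> E"
proof -
  obtain y where "y \<notin> D" using assms(1) infinite_V ex_new_if_finite by blast
  have "(x, y) \<in> E\<^sup>*" by (rule connected)
  then show ?thesis
    using \<open>y \<notin> D\<close> assms(2)
  proof (induction rule: converse_rtrancl_induct)
    case (step v w)
    then show ?case by (cases "w \<in> D") auto
  qed auto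
qed

text \<open>Induction by removing a vertex \<open>u\<close> that has an edge out of
  \<open>D\<close>. In a forest on the rest, paths end outside \<open>D\<close> or at
  \<open>u\<close>, and a rotor at \<open>u\<close> pointing along that edge completes the
  latter.\<close>

lemma forest_rotors_nonempty:
  assumes "finite D" shows "Fo D \<noteq> {}"
  using assms
proof (induction "card D" arbitrary: D)
  case 0
  then have "(\<lambda>x. undefined) \<in> Fo D" by (auto simp: forest_rotors_def)
  then show ?case by blast
next
  case (Suc n)
  then obtain x where "x \<in> D" by fastforce
  then obtain u z where uz: "u \<in> D" "z \<notin> D" "(u, z) \<in> E"
    using exists_boundary_edge Suc.prems by blast
  have "card (D - {u}) = n" using Suc uz by simp
  then obtain \<phi> where \<phi>: "\<phi> \<in> Fo (D - {u})"
    using Suc by blast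
  let ?\<psi> = "\<phi>(u := z)"
  have "?\<psi> \<in> Conf D"
    using forest_rotors_PiE[OF \<phi>] uz by (auto simp: PiE_def extensional_def Pi_def)
  moreover have "\<exists>z. z \<notin> D \<and> (x, z) \<in> (rotor_graph D ?\<psi>)\<^sup>*" if "x \<in> D" for x
  proof -
    have u: "(u, z) \<in> (rotor_graph D ?\<psi>)\<^sup>*" using uz by (auto simp: rotor_graph_iff)
    show ?thesis
    proof (cases "x = u")
      case False
      then obtain z' where z': "z' \<notin> D - {u}" "(x, z') \<in> (rotor_graph (D - {u}) \<phi>)\<^sup>*"
        using forest_rotors_leads[OF \<phi>] that by blast
      have "(x, z') \<in> (rotor_graph D ?\<psi>)\<^sup>*"
        by (rule leads_cong[OF z'(2)]) auto
      then show ?thesis using z'(1) u uz by (cases "z' = u") (auto intro: rtrancl_trans)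
    qed (use u uz in blast)
  qed
  ultimately have "?\<psi> \<in> Fo D" by (simp add: forest_rotors_def)
  then show ?case by blast
qed

lemma card_forest_rotors_pos: "finite D \<Longrightarrow> card (Fo D) > 0"
  using forest_rotors_nonempty finite_forest_rotors by (simp add: card_gt_0_iff)

text \<open>Redirecting \<open>v\<close> to \<open>y\<close> closes no cycle because
  \<open>y\<close> does not lead to \<open>v\<close>. The second conclusion is the same condition
  for the old rotor in the new forest, so the switch can be undone by another switch.\<close>

lemma forest_switch:
  assumes \<phi>: "\<phi> \<in> Fo D" and v: "v \<in> D" and y: "(v, y) \<in> E"
    and nl: "(y, v) \<notin> (rotor_graph D \<phi>)\<^sup>*"
  defines "\<psi> \<equiv> \<phi>(v := y)"
  shows "\<psi> \<in> Fo D" "(\<phi> v, v) \<notin> (rotor_graph D \<psi>)\<^sup>*"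
    and "x \<noteq> v \<Longrightarrow> (v, x) \<in> (rotor_graph D \<psi>)\<^sup>* \<longleftrightarrow> (y, x) \<in> (rotor_graph D \<phi>)\<^sup>*"
proof -
  have other: "\<phi> u = \<psi> u" if "u \<in> D - {v}" for u
    using that by (simp add: \<psi>_def)
  have vy: "(v, y) \<in> rotor_graph D \<psi>" using v by (simp add: rotor_graph_iff \<psi>_def)
  have y_path: "(y, z) \<in> (rotor_graph D \<psi>)\<^sup>*" if "(y, z) \<in> (rotor_graph D \<phi>)\<^sup>*" for z
    using that
  proof (induction rule: rtrancl_induct)
    case (step w w')
    then have "w \<noteq> v" using nl by blast
    then have "(w, w') \<in> rotor_graph D \<psi>" using step by (auto simp: rotor_graph_iff \<psi>_def)
    then show ?case using step by simp
  qed simp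
  have v_out: "\<exists>z. z \<notin> D \<and> (v, z) \<in> (rotor_graph D \<psi>)\<^sup>*"
  proof (cases "y \<in> D")
    case True
    then obtain z where "z \<notin> D" "(y, z) \<in> (rotor_graph D \<phi>)\<^sup>*"
      using forest_rotors_leads[OF \<phi>] by blast
    then show ?thesis using y_path vy by (meson converse_rtrancl_into_rtrancl)
  qed (use vy in blast)
  have "\<exists>z. z \<notin> D \<and> (u, z) \<in> (rotor_graph D \<psi>)\<^sup>*" if u: "u \<in> D" for u
  proof -
    obtain z where z: "z \<notin> D" "(u, z) \<in> (rotor_graph D \<phi>)\<^sup>*"
      using forest_rotors_leads[OF \<phi> u] by blast
    then obtain z' where z': "z' \<in> {v, z}" "(u, z') \<in> (rotor_graph (D - {v, z}) \<phi>)\<^sup>*"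
      using leads_first_hit[OF z(2), of "{v, z}"] by blast
    have "(u, z') \<in> (rotor_graph D \<psi>)\<^sup>*"
      by (rule leads_cong[OF z'(2)]) (auto simp: \<psi>_def)
    then show ?thesis using z' z v_out by (metis insertE rtrancl_trans singletonD)
  qed
  moreover have "\<psi> \<in> Conf D"
    using forest_rotors_PiE[OF \<phi>] v y by (auto simp: \<psi>_def PiE_def extensional_def Pi_def)
  ultimately show \<psi>: "\<psi> \<in> Fo D" by (simp add: forest_rotors_def)
  show "(\<phi> v, v) \<notin> (rotor_graph D \<psi>)\<^sup>*"
  proof
    assume "(\<phi> v, v) \<in> (rotor_graph D \<psi>)\<^sup>*"
    then have "(\<phi> v, v) \<in> (rotor_graph D \<phi>)\<^sup>*"
      by (rule leads_cong[OF leads_avoid]) (auto simp: \<psi>_def)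
    moreover have "(v, \<phi> v) \<in> rotor_graph D \<phi>" using v by (simp add: rotor_graph_iff)
    ultimately have "(v, v) \<in> (rotor_graph D \<phi>)\<^sup>+" by simp
    then show False using forest_rotors_acyclic[OF \<phi>] by (simp add: acyclic_def)
  qed
  show "(v, x) \<in> (rotor_graph D \<psi>)\<^sup>* \<longleftrightarrow> (y, x) \<in> (rotor_graph D \<phi>)\<^sup>*" if xv: "x \<noteq> v"
  proof
    assume "(v, x) \<in> (rotor_graph D \<psi>)\<^sup>*"
    then obtain w where "(v, w) \<in> rotor_graph D \<psi>" "(w, x) \<in> (rotor_graph D \<psi>)\<^sup>*"
      using xv by (rule_tac converse_rtranclE[of v x]) auto
    then have yx: "(y, x) \<in> (rotor_graph D \<psi>)\<^sup>*" by (simp add: rotor_graph_iff \<psi>_def)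
    have "w \<noteq> v" if "(y, w) \<in> (rotor_graph D \<psi>)\<^sup>*" for w
    proof
      assume "w = v"
      then have "(v, v) \<in> (rotor_graph D \<psi>)\<^sup>+" using that vy by simp
      then show False using forest_rotors_acyclic[OF \<psi>] by (simp add: acyclic_def)
    qed
    note avoid = this
    show "(y, x) \<in> (rotor_graph D \<phi>)\<^sup>*"
      using yx
    proof (induction rule: rtrancl_induct)
      case (step w w')
      then have "w \<noteq> v" using avoid by blast
      then have "(w, w') \<in> rotor_graph D \<phi>" using step by (auto simp: rotor_graph_iff \<psi>_def)
      then show ?case using step by simp
    qed simp
  next
    assume "(y, x) \<in> (rotor_graph D \<phi>)\<^sup>*"
    then show "(v, x) \<in> (rotor_graph D \<psi>)\<^sup>*"
      using y_path vy by (meson converse_rtrancl_into_rtrancl)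
  qed
qed

text \<open>For finite \<open>D\<close> and \<open>x\<close> outside it, division by
  \<open>card (Fo D)\<close> turns this into the probability that simple random walk from
  \<open>v\<close> first leaves \<open>D\<close> at \<open>x\<close>.\<close>

definition connected_count :: "'v set \<Rightarrow> 'v \<Rightarrow> 'v \<Rightarrow> nat" where
  "connected_count D x v = card {\<phi> \<in> Fo D. (v, x) \<in> (rotor_graph D \<phi>)\<^sup>*}"

text \<open>Exchanging the rotor at \<open>v\<close> with a neighbour \<open>y\<close> that does not lead to \<open>v\<close> swaps the roles of \<open>v\<close> and
  \<open>y\<close>; this gives the harmonicity that Wilson's algorithm would provide.\<close>

lemma connected_count_harmonic:
  assumes "finite D" "v \<in> D" "x \<notin> D"
  shows "card (E `` {v}) * connected_count D x v = (\<Sum>y\<in>E `` {v}. connected_count D x y)"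
proof -
  define L where "L \<phi> y \<longleftrightarrow> (y, x) \<in> (rotor_graph D \<phi>)\<^sup>*" for \<phi> y
  define B where "B = E `` {v} \<times> Fo D"
  define A1 where "A1 = {p \<in> B. L (snd p) v}"
  define A2 where "A2 = {p \<in> B. L (snd p) (fst p)}"
  \<comment> \<open>An involution on pairs of a neighbour of \<open>v\<close> and a forest. It
    exchanges the pairs whose neighbour leads to \<open>x\<close> with those whose forest joins
    \<open>v\<close> to \<open>x\<close>.\<close>
  define m where "m = (\<lambda>(y, \<phi>). if (y, v) \<in> (rotor_graph D \<phi>)\<^sup>* then (y, \<phi>) else (\<phi> v, \<phi>(v := y)))"
  have xv: "x \<noteq> v" using assms by auto
  have good: "m (m p) = p \<and> m p \<in> B \<and> (L (snd p) (fst p) \<longleftrightarrow> L (snd (m p)) v)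
      \<and> (L (snd p) v \<longleftrightarrow> L (snd (m p)) (fst (m p)))" if "p \<in> B" for p
  proof -
    obtain y \<phi> where p: "p = (y, \<phi>)" by fastforce
    have y: "(v, y) \<in> E" and \<phi>: "\<phi> \<in> Fo D" using that by (auto simp: p B_def)
    have \<phi>v: "(v, \<phi> v) \<in> E" using forest_rotors_PiE[OF \<phi>] assms(2) by auto
    have L_step: "L \<psi> v \<longleftrightarrow> L \<psi> (\<psi> v)" for \<psi>
      using xv assms(2) unfolding L_def
      by (metis converse_rtranclE converse_rtrancl_into_rtrancl rotor_graph_iff)
    show ?thesis
    proof (cases "(y, v) \<in> (rotor_graph D \<phi>)\<^sup>*")
      case True
      \<comment> \<open>The path from \<open>y\<close> runs through \<open>v\<close>, so both lie in
        the same tree and the pair may stay fixed.\<close>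
      have "L \<phi> y \<longleftrightarrow> L \<phi> v"
      proof
        assume "L \<phi> v"
        then show "L \<phi> y" using True by (auto simp: L_def intro: rtrancl_trans)
      next
        assume "L \<phi> y"
        then show "L \<phi> v"
          using True single_valued_confluent[of "rotor_graph D \<phi>" y v x] leads_outside[of x v D \<phi>] xv assms(3)
          by (auto simp: L_def single_valued_def rotor_graph_iff)
      qed
      then show ?thesis using True that by (simp add: p m_def)
    next
      case False
      let ?\<psi> = "\<phi>(v := y)"
      note sw = forest_switch[OF \<phi> assms(2) y False]
      have mp: "m p = (\<phi> v, ?\<psi>)" using False by (simp add: p m_def)
      have "m (m p) = p" using sw(2) by (simp add: mp) (simp add: m_def p)
      moreover have "m p \<in> B" using sw(1) \<phi>v by (simp add: mp B_def)
      moreover have "L (snd p) (fst p) \<longleftrightarrow> L (snd (m p)) v"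
        using sw(3)[OF xv] unfolding mp by (simp add: p L_def)
      moreover have "L \<phi> v \<longleftrightarrow> L ?\<psi> (\<phi> v)"
        using forest_switch(3)[OF sw(1) assms(2) \<phi>v sw(2) xv] by (simp add: L_def)
      then have "L (snd p) v \<longleftrightarrow> L (snd (m p)) (fst (m p))" unfolding mp by (simp add: p)
      ultimately show ?thesis by blast
    qed
  qed
  have "bij_betw m A2 A1"
  proof (rule bij_betw_byWitness[where f' = m])
    show "\<forall>p\<in>A2. m (m p) = p" "\<forall>p\<in>A1. m (m p) = p"
      using good unfolding A1_def A2_def by blast+
    show "m ` A2 \<subseteq> A1" "m ` A1 \<subseteq> A2"
      using good unfolding A1_def A2_def by blast+
  qed
  then have "card A2 = card A1" by (rule bij_betw_same_card)
  moreover have "A1 = E `` {v} \<times> {\<phi> \<in> Fo D. L \<phi> v}"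
    by (auto simp: A1_def B_def)
  then have "card A1 = card (E `` {v}) * connected_count D x v"
    by (simp add: card_cartesian_product connected_count_def L_def)
  moreover have "A2 = (SIGMA y:E `` {v}. {\<phi> \<in> Fo D. L \<phi> y})"
    by (auto simp: A2_def B_def)
  then have "card A2 = (\<Sum>y\<in>E `` {v}. connected_count D x y)"
    using locally_finite finite_forest_rotors[OF assms(1)]
    by (simp add: connected_count_def L_def card_SigmaI)
  ultimately show ?thesis by simp
qed

lemma connected_count_outside:
  assumes "v \<notin> D" "v \<noteq> x" shows "connected_count D x v = 0"
proof -
  have "{\<phi> \<in> Fo D. (v, x) \<in> (rotor_graph D \<phi>)\<^sup>*} = {}"
    using leads_outside[of v x D] assms by auto
  then show ?thesis by (simp only: connected_count_def card.empty)
qed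

lemma degree_pos: "card (E `` {v}) > 0"
proof -
  have "E `` {v} \<noteq> {}"
  proof
    assume "E `` {v} = {}"
    then have "y = v" for y using connected[of v y] by (auto elim: converse_rtranclE)
    then have "(UNIV :: 'v set) = {v}" by auto
    then show False using infinite_V by (metis finite.emptyI finite_insert)
  qed
  then show ?thesis using locally_finite by (simp add: card_gt_0_iff)
qed

text \<open>Maximum principle: the difference of the two sides is subharmonic in \<open>D\<close>
  and nonpositive outside. A positive maximum would spread to all neighbours and so along edges to
  \<open>x\<close>, where the difference vanishes.\<close>

lemma connected_count_le:
  fixes f :: "'v \<Rightarrow> real"
  assumes D: "finite D" "x \<notin> D"
    and f: "\<And>v. f v \<ge> 0" "f x = 1"
    and super: "\<And>v. v \<noteq> x \<Longrightarrow> (\<Sum>y\<in>E `` {v}. f y) \<le> card (E `` {v}) * f v"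
  shows "connected_count D x v \<le> f v * card (Fo D)"
proof -
  define h where "h v = connected_count D x v - f v * card (Fo D)" for v
  have hx: "h x = 0" by (simp add: h_def connected_count_def f)
  have hout: "h v \<le> 0" if "v \<notin> D" for v
    using that hx f by (cases "v = x") (auto simp: h_def connected_count_outside)
  have sub: "card (E `` {v}) * h v \<le> (\<Sum>y\<in>E `` {v}. h y)" if "v \<in> D" for v
  proof -
    have "v \<noteq> x" using that D by auto
    have "(\<Sum>y\<in>E `` {v}. h y) = real (\<Sum>y\<in>E `` {v}. connected_count D x y) - (\<Sum>y\<in>E `` {v}. f y) * card (Fo D)"
      by (simp add: h_def sum_subtractf sum_distrib_right)
    also have "\<dots> \<ge> real (card (E `` {v}) * connected_count D x v) - card (E `` {v}) * f v * card (Fo D)"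
      using super[OF \<open>v \<noteq> x\<close>] connected_count_harmonic[OF D(1) that D(2)] by (simp add: mult_right_mono)
    finally show ?thesis by (simp add: h_def algebra_simps)
  qed
  have "h v \<le> 0"
  proof (rule ccontr)
    assume pos: "\<not> h v \<le> 0"
    define M where "M = Max (h ` D)"
    have "v \<in> D" using hout pos by blast
    then have M: "h y \<le> M" if "y \<in> D" for y using D(1) that by (simp add: M_def)
    have M0: "M > 0" using M[OF \<open>v \<in> D\<close>] pos by linarith
    have M': "h y \<le> M" for y using M hout M0 by (cases "y \<in> D") (auto intro: order_trans[of "h y" 0 M])
    have "M \<in> h ` D" unfolding M_def using D(1) \<open>v \<in> D\<close> by (intro Max_in) auto
    then obtain u where u: "u \<in> D" "h u = M" by auto
    have step: "h z = M" if "h y = M" "(y, z) \<in> E" for y z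
    proof (rule ccontr)
      assume "h z \<noteq> M"
      then have "h z < M" using M' by (simp add: order.not_eq_order_implies_strict)
      have "y \<in> D" using hout[of y] that M0 by force
      have "(\<Sum>y\<in>E `` {y}. h y) < (\<Sum>y\<in>E `` {y}. M)"
        using locally_finite \<open>h z < M\<close> that M' by (intro sum_strict_mono_ex1) auto
      then show False using sub[OF \<open>y \<in> D\<close>] that by simp
    qed
    have "h x = M"
      using connected[of u x] by (induction rule: rtrancl_induct) (use u step in auto)
    then show False using hx M0 by simp
  qed
  then show ?thesis by (simp add: h_def)
qed

text \<open>A forest with the extra root \<open>x\<close> becomes a forest on \<open>D\<close> when
  \<open>x\<close> is pointed to a neighbour that does not lead to it. Combined with an upper bound
  on the counts, this limits how many forests can have the extra root.\<close>

lemma card_forest_ge: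
  assumes "finite D" "x \<in> D"
  shows "(\<Sum>y\<in>E `` {x}. card (Fo (D - {x})) - real (connected_count (D - {x}) x y)) \<le> card (Fo D)"
proof -
  let ?D = "D - {x}"
  define B where "B y = {\<phi> \<in> Fo ?D. (y, x) \<notin> (rotor_graph ?D \<phi>)\<^sup>*}" for y
  have B: "real (card (B y)) = card (Fo ?D) - real (connected_count ?D x y)" for y
  proof -
    have "B y = Fo ?D - {\<phi> \<in> Fo ?D. (y, x) \<in> (rotor_graph ?D \<phi>)\<^sup>*}" by (auto simp: B_def)
    then show ?thesis
      using finite_forest_rotors[of ?D] assms(1)
      by (simp add: connected_count_def card_Diff_subset of_nat_diff card_mono)
  qed
  have "card (SIGMA y:E `` {x}. B y) \<le> card (Fo D)"
  proof (rule card_inj_on_le)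
    show "finite (Fo D)" using assms finite_forest_rotors by blast
    show "inj_on (\<lambda>(y, \<phi>). \<phi>(x := y)) (SIGMA y:E `` {x}. B y)"
    proof (rule inj_onI, clarify)
      fix y \<phi> y' \<phi>' assume *: "\<phi> \<in> B y" "\<phi>' \<in> B y'" and eq: "\<phi>(x := y) = \<phi>'(x := y')"
      \<comment> \<open>Both values are \<open>undefined\<close>, because \<open>x\<close> lies
        outside the domain \<open>D - {x}\<close>.\<close>
      have "\<phi> x = \<phi>' x"
        using * by (auto simp: B_def forest_rotors_def PiE_def extensional_def)
      then have "\<phi> = \<phi>'" using eq by (metis fun_upd_idem_iff fun_upd_triv fun_upd_upd)
      then show "y = y' \<and> \<phi> = \<phi>'" using fun_cong[OF eq, of x] by simp
    qed
    show "(\<lambda>(y, \<phi>). \<phi>(x := y)) ` (SIGMA y:E `` {x}. B y) \<subseteq> Fo D"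
    proof clarify
      fix y \<phi> assume y: "(x, y) \<in> E" and "\<phi> \<in> B y"
      then have \<phi>: "\<phi> \<in> Fo ?D" and nl: "(y, x) \<notin> (rotor_graph ?D \<phi>)\<^sup>*" by (auto simp: B_def)
      let ?\<psi> = "\<phi>(x := y)"
      have up: "(u, z) \<in> (rotor_graph D ?\<psi>)\<^sup>*" if "(u, z) \<in> (rotor_graph ?D \<phi>)\<^sup>*" for u z
        by (rule leads_cong[OF that]) auto
      have out: "\<exists>z. z \<notin> ?D \<and> (u, z) \<in> (rotor_graph ?D \<phi>)\<^sup>*" for u
        using forest_rotors_leads[OF \<phi>, of u] by blast
      obtain z where z: "z \<notin> ?D" "(y, z) \<in> (rotor_graph ?D \<phi>)\<^sup>*" using out by blast
      then have zD: "z \<notin> D" using nl by auto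
      have "(x, y) \<in> rotor_graph D ?\<psi>" using assms by (simp add: rotor_graph_iff)
      then have xz: "(x, z) \<in> (rotor_graph D ?\<psi>)\<^sup>*" using up[OF z(2)] by simp
      have "\<exists>z. z \<notin> D \<and> (u, z) \<in> (rotor_graph D ?\<psi>)\<^sup>*" for u
      proof -
        obtain w where w: "w \<notin> ?D" "(u, w) \<in> (rotor_graph ?D \<phi>)\<^sup>*" using out by blast
        then show ?thesis using up[OF w(2)] xz zD by (cases "w = x") (auto intro: rtrancl_trans)
      qed
      moreover have "?\<psi> \<in> Conf D"
        using forest_rotors_PiE[OF \<phi>] assms y by (auto simp: PiE_def extensional_def Pi_def)
      ultimately show "?\<psi> \<in> Fo D" by (simp add: forest_rotors_def)
    qed
  qed
  moreover have "card (SIGMA y:E `` {x}. B y) = (\<Sum>y\<in>E `` {x}. card (B y))"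
    using locally_finite finite_forest_rotors[of ?D] assms by (intro card_SigmaI) (auto simp: B_def)
  ultimately have "real (\<Sum>y\<in>E `` {x}. card (B y)) \<le> card (Fo D)"
    by (metis of_nat_le_iff)
  then show ?thesis by (simp add: B)
qed

text \<open>If the path \<open>w\<close> from \<open>x\<close> leaves the tree of \<open>x\<close>, redirecting the rotors along \<open>w\<close> up to that
  point removes the root \<open>x\<close> at the price of forgetting boundedly many rotors.\<close>

lemma redirect_forest:
  assumes D: "w ` {..n} \<subseteq> D" and w: "\<And>i. i < n \<Longrightarrow> (w i, w (Suc i)) \<in> E" "w 0 = x"
    and \<phi>: "\<phi> \<in> Fo (D - {x})" and out: "\<exists>i\<le>n. (w i, x) \<notin> (rotor_graph (D - {x}) \<phi>)\<^sup>*"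
  shows "\<exists>\<psi>\<in>Fo D. (\<forall>u. u \<notin> w ` {..n} \<longrightarrow> \<psi> u = \<phi> u) \<and>
    (\<forall>y. (y, x) \<in> (rotor_graph (D - {x}) \<phi>)\<^sup>* \<longrightarrow> (\<exists>u\<in>w ` {..n}. (y, u) \<in> (rotor_graph D \<psi>)\<^sup>*))"
proof -
  let ?D = "D - {x}"
  define T where "T y \<longleftrightarrow> (y, x) \<in> (rotor_graph ?D \<phi>)\<^sup>*" for y
  define j where "j = (LEAST i. \<not> T (w i))"
  obtain i where "i \<le> n" "\<not> T (w i)" using out by (auto simp: T_def)
  then have j: "\<not> T (w j)" "j \<le> n" and jT: "\<And>i. i < j \<Longrightarrow> T (w i)"
    unfolding j_def by (metis LeastI, metis Least_le order_trans, metis not_less_Least)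
  have j0: "0 < j" using j w(2) by (auto simp: T_def intro!: Nat.gr0I)
  define J where "J = w ` {..<j}"
  \<comment> \<open>The path may revisit vertices, so each vertex is given its last departure before
    time \<open>j\<close>. Following the new rotors then strictly increases this time, hence cannot
    cycle before reaching \<open>w j\<close>.\<close>
  define last where "last u = Max {i. i < j \<and> w i = u}" for u
  have last: "last u < j" "w (last u) = u" if "u \<in> J" for u
  proof -
    have "last u \<in> {i. i < j \<and> w i = u}"
      unfolding last_def by (rule Max_in) (use that in \<open>auto simp: J_def\<close>)
    then show "last u < j" "w (last u) = u" by auto
  qed
  have last_ge: "i \<le> last (w i)" if "i < j" for i
    unfolding last_def using that by (intro Max_ge) auto
  define \<psi> where "\<psi> u = (if u \<in> J then w (Suc (last u)) else \<phi> u)" for u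
  have JK: "J \<subseteq> w ` {..n}" using j(2) by (auto simp: J_def)
  then have JD: "J \<subseteq> D" using D by blast
  have xJ: "x \<in> J" using j0 w(2) by (auto simp: J_def)
  have J_leads: "(w i, w j) \<in> (rotor_graph D \<psi>)\<^sup>*" if "i \<le> j" for i
    using that
  proof (induction "j - i" arbitrary: i rule: less_induct)
    case less
    show ?case
    proof (cases "i = j")
      case False
      then have i: "i < j" "w i \<in> J" using less by (auto simp: J_def)
      have "(w (Suc (last (w i))), w j) \<in> (rotor_graph D \<psi>)\<^sup>*"
        using last_ge[OF i(1)] last(1)[OF i(2)] by (intro less(1)) auto
      moreover have "(w i, w (Suc (last (w i)))) \<in> rotor_graph D \<psi>"
        using i JD by (auto simp: rotor_graph_iff \<psi>_def)
      ultimately show ?thesis by simp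
    qed simp
  qed
  \<comment> \<open>All of \<open>J\<close> lies in the tree of \<open>x\<close>, so a path from a
    vertex outside that tree never meets a redirected rotor.\<close>
  have out_T: "\<exists>z. z \<notin> D \<and> (v, z) \<in> (rotor_graph D \<psi>)\<^sup>*" if "\<not> T v" for v
  proof -
    obtain z where z: "z \<notin> ?D" "(v, z) \<in> (rotor_graph ?D \<phi>)\<^sup>*"
      using forest_rotors_leads[OF \<phi>, of v] by blast
    from z(2) show ?thesis
      using that
    proof (induction rule: converse_rtrancl_induct)
      case base
      then have "z \<noteq> x" by (auto simp: T_def)
      then show ?case using z(1) by blast
    next
      case (step v v')
      then have "\<not> T v'" unfolding T_def by (meson converse_rtrancl_into_rtrancl)
      moreover have "v \<notin> J" using step(4) jT by (auto simp: J_def)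
      then have "(v, v') \<in> rotor_graph D \<psi>" using step(1) by (auto simp: rotor_graph_iff \<psi>_def)
      ultimately show ?case using step(3) by (meson converse_rtrancl_into_rtrancl)
    qed
  qed
  have out_J: "\<exists>z. z \<notin> D \<and> (v, z) \<in> (rotor_graph D \<psi>)\<^sup>*" if "v \<in> J" for v
    using out_T[OF j(1)] that J_leads by (auto simp: J_def) (meson less_imp_le rtrancl_trans)
  have "\<exists>z. z \<notin> D \<and> (v, z) \<in> (rotor_graph D \<psi>)\<^sup>*" for v
  proof (cases "T v")
    case True
    then obtain u where u: "u \<in> J" "(v, u) \<in> (rotor_graph (?D - J) \<phi>)\<^sup>*"
      using leads_first_hit[of v x ?D \<phi> J] xJ by (auto simp: T_def)
    have "(v, u) \<in> (rotor_graph D \<psi>)\<^sup>*"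
      by (rule leads_cong[OF u(2)]) (auto simp: \<psi>_def)
    then show ?thesis using out_J[OF u(1)] by (meson rtrancl_trans)
  qed (rule out_T)
  moreover have "\<psi> \<in> Conf D"
  proof -
    have "(u, \<psi> u) \<in> E" if u: "u \<in> D" for u
    proof (cases "u \<in> J")
      case True
      then show ?thesis using w(1)[of "last u"] last[OF True] j(2) by (simp add: \<psi>_def)
    next
      case False
      then have "u \<noteq> x" using xJ by blast
      then show ?thesis using Conf_edge[OF forest_rotors_PiE[OF \<phi>], of u] u False by (simp add: \<psi>_def)
    qed
    moreover have "\<psi> u = undefined" if "u \<notin> D" for u
      using that JD forest_rotors_PiE[OF \<phi>] by (auto simp: \<psi>_def PiE_def extensional_def)
    ultimately show ?thesis by (auto simp: PiE_def extensional_def)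
  qed
  ultimately have "\<psi> \<in> Fo D" by (simp add: forest_rotors_def)
  moreover have "\<psi> u = \<phi> u" if "u \<notin> w ` {..n}" for u
    using that JK by (auto simp: \<psi>_def)
  moreover have "\<exists>u\<in>w ` {..n}. (y, u) \<in> (rotor_graph D \<psi>)\<^sup>*" if Ty: "T y" for y
  proof -
    obtain u where u: "u \<in> J" "(y, u) \<in> (rotor_graph (?D - J) \<phi>)\<^sup>*"
      using leads_first_hit[OF Ty[unfolded T_def] xJ] by blast
    have "(y, u) \<in> (rotor_graph D \<psi>)\<^sup>*"
      by (rule leads_cong[OF u(2)]) (auto simp: \<psi>_def)
    then show ?thesis using u(1) JK by blast
  qed
  ultimately show ?thesis by (auto simp: T_def)
qed

text \<open>Forests with \<open>w n\<close> in the tree of \<open>x\<close> are counted by the last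
  term. In the others the path leaves the tree and can be redirected; the old forest is recovered
  from the new one and its own rotors on \<open>K - {x}\<close>, which accounts for the product of
  degrees.\<close>

lemma card_far_tree_le:
  assumes fin: "finite D" and D: "w ` {..n} \<subseteq> D"
    and w: "\<And>i. i < n \<Longrightarrow> (w i, w (Suc i)) \<in> E" "w 0 = x"
  defines "K \<equiv> w ` {..n}"
  shows "card {\<phi> \<in> Fo (D - {x}). \<exists>y\<in>D - D'. (y, x) \<in> (rotor_graph (D - {x}) \<phi>)\<^sup>*}
    \<le> (\<Prod>u\<in>K - {x}. card (E `` {u})) *
        card {\<psi> \<in> Fo D. \<exists>y\<in>D - D'. \<exists>u\<in>K. (y, u) \<in> (rotor_graph D \<psi>)\<^sup>*}
      + connected_count (D - {x}) x (w n)"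
    (is "card ?A \<le> _ * card ?B + _")
proof -
  let ?D = "D - {x}"
  define A1 where "A1 = {\<phi> \<in> ?A. (w n, x) \<notin> (rotor_graph ?D \<phi>)\<^sup>*}"
  define P where "P \<phi> \<psi> \<longleftrightarrow> \<psi> \<in> Fo D \<and> (\<forall>u. u \<notin> K \<longrightarrow> \<psi> u = \<phi> u) \<and>
    (\<forall>y. (y, x) \<in> (rotor_graph ?D \<phi>)\<^sup>* \<longrightarrow> (\<exists>u\<in>K. (y, u) \<in> (rotor_graph D \<psi>)\<^sup>*))" for \<phi> \<psi>
  define r where "r \<phi> = (SOME \<psi>. P \<phi> \<psi>)" for \<phi>
  have r: "P \<phi> (r \<phi>)" if "\<phi> \<in> A1" for \<phi>
    unfolding r_def
  proof (rule someI_ex[of "P \<phi>"])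
    have "\<phi> \<in> Fo ?D" "\<exists>i\<le>n. (w i, x) \<notin> (rotor_graph ?D \<phi>)\<^sup>*" using that by (auto simp: A1_def)
    then show "\<exists>\<psi>. P \<phi> \<psi>"
      using redirect_forest[of w n D x \<phi>, OF D w] by (auto simp: P_def K_def)
  qed
  define m where "m \<phi> = (restrict \<phi> (K - {x}), r \<phi>)" for \<phi>
  have KD: "K \<subseteq> D" using D by (simp add: K_def)
  have "card A1 \<le> card (Conf (K - {x}) \<times> ?B)"
  proof (rule card_inj_on_le)
    have "finite (K - {x})" by (simp add: K_def)
    then show "finite (Conf (K - {x}) \<times> ?B)"
      using finite_forest_rotors[OF fin] by (simp add: finite_Conf)
    show "m ` A1 \<subseteq> Conf (K - {x}) \<times> ?B"
    proof (rule image_subsetI)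
      fix \<phi> assume \<phi>: "\<phi> \<in> A1"
      then have "\<phi> \<in> Conf ?D" using forest_rotors_PiE[of \<phi> E ?D] unfolding A1_def by simp
      then have "restrict \<phi> (K - {x}) \<in> Conf (K - {x})" using KD by auto
      moreover have "r \<phi> \<in> ?B" using r[OF \<phi>] \<phi> unfolding P_def A1_def by fast
      ultimately show "m \<phi> \<in> Conf (K - {x}) \<times> ?B" by (simp add: m_def)
    qed
    show "inj_on m A1"
    proof (rule inj_onI)
      fix \<phi> \<phi>' assume *: "\<phi> \<in> A1" "\<phi>' \<in> A1" and eq: "m \<phi> = m \<phi>'"
      have C: "\<phi> \<in> Conf ?D" "\<phi>' \<in> Conf ?D"
        using * forest_rotors_PiE[of _ E ?D] unfolding A1_def by simp_all
      show "\<phi> = \<phi>'"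
      proof (rule PiE_ext[OF C])
        fix u assume u: "u \<in> ?D"
        show "\<phi> u = \<phi>' u"
        proof (cases "u \<in> K")
          case True
          then have "restrict \<phi> (K - {x}) u = restrict \<phi>' (K - {x}) u"
            using eq by (simp add: m_def)
          then show ?thesis using True u by simp
        next
          case False
          then have "r \<phi> u = \<phi> u" "r \<phi>' u = \<phi>' u" using r * by (auto simp: P_def)
          then show ?thesis using eq by (simp add: m_def)
        qed
      qed
    qed
  qed
  moreover have "card (Conf (K - {x})) = (\<Prod>u\<in>K - {x}. card (E `` {u}))"
    by (rule card_PiE) (simp add: K_def)
  ultimately have "card A1 \<le> (\<Prod>u\<in>K - {x}. card (E `` {u})) * card ?B"
    by (simp add: card_cartesian_product)
  moreover have "card ?A \<le> card A1 + connected_count ?D x (w n)"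
  proof -
    have "?A \<subseteq> A1 \<union> {\<phi> \<in> Fo ?D. (w n, x) \<in> (rotor_graph ?D \<phi>)\<^sup>*}" by (auto simp: A1_def)
    then have "card ?A \<le> card (A1 \<union> {\<phi> \<in> Fo ?D. (w n, x) \<in> (rotor_graph ?D \<phi>)\<^sup>*})"
      using finite_forest_rotors[of ?D] fin by (intro card_mono) (auto simp: A1_def)
    also have "\<dots> \<le> card A1 + connected_count ?D x (w n)"
      unfolding connected_count_def by (rule card_Un_le)
    finally show ?thesis .
  qed
  ultimately show ?thesis by linarith
qed

end

subsection \<open>Hitting probabilities of the simple random walk\<close>

text \<open>The probability of hitting \<open>x\<close> within \<open>n\<close> steps, set up by
  one-step recursion so that harmonicity and minimality of the limit are algebraic. The trajectory
  measure enters only in the comparison with the return probability.\<close>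

primrec hit :: "'v rel \<Rightarrow> 'v \<Rightarrow> nat \<Rightarrow> 'v \<Rightarrow> real" where
  "hit E x 0 y = (if y = x then 1 else 0)"
| "hit E x (Suc n) y = (if y = x then 1 else (\<Sum>z\<in>E `` {y}. hit E x n z) / card (E `` {y}))"

lemma hit_self [simp]: "hit E x n x = 1"
  by (cases n) auto

lemma avg_le_1:
  fixes f :: "'v \<Rightarrow> real"
  shows "(\<And>z. z \<in> A \<Longrightarrow> f z \<le> 1) \<Longrightarrow> (\<Sum>z\<in>A. f z) / card A \<le> 1"
  using sum_bounded_above[of A f 1] by (cases "card A = 0") (auto simp: field_simps)

lemma hit_bounds: "0 \<le> hit E x n y" "hit E x n y \<le> 1"
proof (induction n arbitrary: y)
  case (Suc n)
  { case 1 then show ?case using Suc by (auto intro!: divide_nonneg_nonneg sum_nonneg) }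
  { case 2 then show ?case using Suc by (auto intro!: avg_le_1) }
qed auto

lemma hit_mono_Suc: "hit E x n y \<le> hit E x (Suc n) y"
proof (induction n arbitrary: y)
  case 0
  then show ?case using hit_bounds(1)[of E x] by (auto intro!: divide_nonneg_nonneg sum_nonneg)
next
  case (Suc n)
  then show ?case by (auto intro!: divide_right_mono sum_mono simp del: hit.simps(2) simp: hit.simps(2)[of E x "Suc n"] hit.simps(2)[of E x n])
qed

definition hit_prob :: "'v rel \<Rightarrow> 'v \<Rightarrow> 'v \<Rightarrow> real" where
  "hit_prob E x y = (SUP n. hit E x n y)"

lemma hit_LIMSEQ: "(\<lambda>n. hit E x n y) \<longlonglongrightarrow> hit_prob E x y"
  unfolding hit_prob_def
  by (rule LIMSEQ_incseq_SUP)
     (auto intro!: bdd_aboveI2[where M = 1] hit_bounds incseq_SucI hit_mono_Suc)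

lemma hit_prob_bounds: "0 \<le> hit_prob E x y" "hit_prob E x y \<le> 1"
  by (rule LIMSEQ_le_const[OF hit_LIMSEQ], simp add: hit_bounds)
     (rule LIMSEQ_le_const2[OF hit_LIMSEQ], simp add: hit_bounds)

lemma hit_prob_self [simp]: "hit_prob E x x = 1"
  by (simp add: hit_prob_def)

lemma avg_hit_LIMSEQ:
  "(\<lambda>n. (\<Sum>z\<in>E `` {y}. hit E x n z) / card (E `` {y}))
    \<longlonglongrightarrow> (\<Sum>z\<in>E `` {y}. hit_prob E x z) / card (E `` {y})"
  by (cases "card (E `` {y}) = 0") (auto intro!: tendsto_divide tendsto_sum hit_LIMSEQ)

lemma hit_prob_harmonic:
  assumes "y \<noteq> x"
  shows "hit_prob E x y = (\<Sum>z\<in>E `` {y}. hit_prob E x z) / card (E `` {y})"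
proof -
  have "(\<lambda>n. hit E x (Suc n) y) \<longlonglongrightarrow> (\<Sum>z\<in>E `` {y}. hit_prob E x z) / card (E `` {y})"
    using avg_hit_LIMSEQ assms by simp
  then show ?thesis
    by (rule LIMSEQ_unique[OF LIMSEQ_Suc[OF hit_LIMSEQ]])
qed

lemma hit_prob_minimal:
  fixes g :: "'v \<Rightarrow> real"
  assumes "\<And>y. 0 \<le> g y" "1 \<le> g x"
    and super: "\<And>y. y \<noteq> x \<Longrightarrow> (\<Sum>z\<in>E `` {y}. g z) / card (E `` {y}) \<le> g y"
  shows "hit_prob E x y \<le> g y"
proof -
  have "hit E x n y \<le> g y" for n
  proof (induction n arbitrary: y)
    case 0
    then show ?case using assms by auto
  next
    case (Suc n)
    show ?case
    proof (cases "y = x")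
      case False
      have "(\<Sum>z\<in>E `` {y}. hit E x n z) / card (E `` {y}) \<le> (\<Sum>z\<in>E `` {y}. g z) / card (E `` {y})"
        by (intro divide_right_mono sum_mono Suc) simp
      then show ?thesis using super[OF False] False by simp
    qed (use assms in simp)
  qed
  then show ?thesis by (intro LIMSEQ_le_const2[OF hit_LIMSEQ]) simp
qed

text \<open>Doob's martingale of the event that the walk visits \<open>x\<close> at some time in \<open>{1..k + m}\<close>.\<close>

definition return_martingale :: "'v rel \<Rightarrow> 'v \<Rightarrow> nat \<Rightarrow> nat \<Rightarrow> (nat \<Rightarrow> 'v) \<Rightarrow> real" where
  "return_martingale E x k m \<omega> =
    (if \<exists>i\<in>{1..k}. \<omega> i = x then 1 else hit E x m (\<omega> k))"

context
  fixes E :: "'v rel" and x :: 'v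
  assumes finite_nbrs: "\<And>y. finite (E `` {y})" and nbrs_nonempty: "\<And>y. E `` {y} \<noteq> {}"
begin

abbreviation "PC n \<equiv> PiM {0..<n} (\<lambda>_. count_space (UNIV :: 'v set))"
text \<open>This measure lives on the times \<open>0, ..., n - 1\<close>, so a statement about time
  \<open>k\<close> needs \<open>law (Suc k)\<close>; hence the shifts below.\<close>

abbreviation "law n \<equiv> srw.C E x 0 n (\<lambda>_. undefined)"

lemma undefined_in_PC: "(\<lambda>_. undefined) \<in> space (PC 0)"
  by (simp add: space_PiM PiE_def extensional_def)

lemma measurable_return_martingale:
  "(\<lambda>\<omega>. ennreal (return_martingale E x k m \<omega>)) \<in> borel_measurable (PC (Suc k))"
proof -
  have coord: "(\<lambda>\<omega>. \<omega> i) \<in> measurable (PC (Suc k)) (count_space UNIV)" if "i \<le> k" for i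
    by (rule measurable_component_singleton) (use that in auto)
  have "(\<lambda>\<omega>. hit E x m (\<omega> k)) \<in> borel_measurable (PC (Suc k))"
    by (rule measurable_compose[OF coord]) auto
  moreover have "Measurable.pred (PC (Suc k)) (\<lambda>\<omega>. \<exists>i\<in>{1..k}. \<omega> i = x)"
  proof (rule pred_intros_finite)
    fix i assume "i \<in> {1..k}"
    then have "i \<le> k" by simp
    show "Measurable.pred (PC (Suc k)) (\<lambda>\<omega>. \<omega> i = x)"
      by (rule measurable_compose[OF coord[OF \<open>i \<le> k\<close>]]) simp
  qed simp
  ultimately show ?thesis
    unfolding return_martingale_def by measurable
qed

lemma nn_integral_pmf_of_nbrs:
  assumes "\<And>z. 0 \<le> f z"
  shows "(\<integral>\<^sup>+z. ennreal (f z) \<partial>measure_pmf (pmf_of_set (E `` {y})))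
    = ennreal ((\<Sum>z\<in>E `` {y}. f z) / card (E `` {y}))"
proof -
  have "card (E `` {y}) > 0"
    using finite_nbrs nbrs_nonempty by (simp add: card_gt_0_iff)
  then show ?thesis
    using assms finite_nbrs nbrs_nonempty
    by (simp add: nn_integral_pmf_of_set sum_ennreal divide_ennreal ennreal_of_nat_eq_real_of_nat sum_nonneg)
qed

text \<open>Time 0 has to be excluded: there the walk sits at \<open>x\<close> and
  \<open>hit\<close> is already 1, although no return has happened yet.\<close>

lemma return_martingale_step:
  assumes "k \<ge> 1"
  shows "(\<integral>\<^sup>+z. ennreal (return_martingale E x (Suc k) m (fun_upd \<omega> (Suc k) z)) \<partial>srw_kernel E x (Suc k) \<omega>)
    = ennreal (return_martingale E x k (Suc m) \<omega>)"
proof (cases "\<exists>i\<in>{1..k}. \<omega> i = x")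
  case True
  then obtain i where "i \<in> {1..k}" "\<omega> i = x" by blast
  then have "return_martingale E x (Suc k) m (fun_upd \<omega> (Suc k) z) = 1" for z
    unfolding return_martingale_def by (auto intro!: bexI[of _ i])
  then show ?thesis
    using True by (simp add: return_martingale_def srw_kernel_def measure_pmf.emeasure_space_1)
next
  case False
  have "return_martingale E x (Suc k) m (fun_upd \<omega> (Suc k) z) = hit E x m z" for z
    using False by (auto simp: return_martingale_def atLeastAtMostSuc_conv)
  moreover have "\<omega> k \<noteq> x" using False assms by auto
  ultimately show ?thesis
    using False hit_bounds(1)[of E x m]
    by (simp add: return_martingale_def srw_kernel_def nn_integral_pmf_of_nbrs)
qed

lemma nn_integral_law_Suc:
  assumes "f \<in> borel_measurable (PC (Suc n))"
  shows "(\<integral>\<^sup>+\<omega>. f \<omega> \<partial>law (Suc n)) = (\<integral>\<^sup>+\<omega>. (\<integral>\<^sup>+z. f (fun_upd \<omega> n z) \<partial>srw_kernel E x n \<omega>) \<partial>law n)"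
proof -
  have "(\<integral>\<^sup>+\<omega>. f \<omega> \<partial>law (Suc n)) = (\<integral>\<^sup>+\<omega>. (\<integral>\<^sup>+\<omega>'. f \<omega>' \<partial>srw.eP E x n \<omega>) \<partial>law n)"
    using assms undefined_in_PC
    by (simp add: nn_integral_bind[where B = "PC (Suc n)"] srw.measurable_eP srw.sets_C cong: measurable_cong_sets)
  also have "\<dots> = (\<integral>\<^sup>+\<omega>. (\<integral>\<^sup>+z. f (fun_upd \<omega> n z) \<partial>srw_kernel E x n \<omega>) \<partial>law n)"
    using undefined_in_PC assms
    by (intro nn_integral_cong srw.nn_integral_eP) (auto simp: srw.space_C)
  finally show ?thesis .
qed

text \<open>The martingale property leads down to time 1. The first step starts at \<open>x\<close>
  and is integrated directly, which produces the average over the neighbours of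
  \<open>x\<close>.\<close>

lemma law_return_martingale:
  "(\<integral>\<^sup>+\<omega>. ennreal (return_martingale E x (Suc k) m \<omega>) \<partial>law (Suc (Suc k)))
    = ennreal ((\<Sum>z\<in>E `` {x}. hit E x (k + m) z) / card (E `` {x}))"
proof (induction k arbitrary: m)
  case 0
  have "(\<integral>\<^sup>+\<omega>. ennreal (return_martingale E x (Suc 0) m \<omega>) \<partial>law (Suc (Suc 0)))
     = (\<integral>\<^sup>+\<omega>. (\<integral>\<^sup>+z. ennreal (hit E x m z) \<partial>measure_pmf (pmf_of_set (E `` {\<omega> 0}))) \<partial>law (Suc 0))"
    by (subst nn_integral_law_Suc[OF measurable_return_martingale])
       (auto simp: return_martingale_def srw_kernel_def intro!: nn_integral_cong)
  also have "\<dots> = (\<integral>\<^sup>+\<omega>. ennreal ((\<Sum>z\<in>E `` {\<omega> 0}. hit E x m z) / card (E `` {\<omega> 0})) \<partial>law (Suc 0))"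
    by (simp add: nn_integral_pmf_of_nbrs hit_bounds)
  also have "\<dots> = (\<integral>\<^sup>+\<omega>. (\<integral>\<^sup>+y. ennreal ((\<Sum>z\<in>E `` {y}. hit E x m z) / card (E `` {y})) \<partial>srw_kernel E x 0 \<omega>) \<partial>law 0)"
  proof (subst nn_integral_law_Suc)
    have "(\<lambda>\<omega>. \<omega> 0) \<in> measurable (PC (Suc 0)) (count_space UNIV)"
      by (rule measurable_component_singleton) simp
    then show "(\<lambda>\<omega>. ennreal ((\<Sum>z\<in>E `` {\<omega> 0}. hit E x m z) / card (E `` {\<omega> 0}))) \<in> borel_measurable (PC (Suc 0))"
      by (rule measurable_compose) simp
  qed simp
  also have "\<dots> = ennreal ((\<Sum>z\<in>E `` {x}. hit E x m z) / card (E `` {x}))"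
    using srw.prob_space_C[OF undefined_in_PC, of E x 0, THEN prob_space.emeasure_space_1]
    by (simp add: srw_kernel_def nn_integral_return)
  finally show ?case by simp
next
  case (Suc k)
  have "(\<integral>\<^sup>+\<omega>. ennreal (return_martingale E x (Suc (Suc k)) m \<omega>) \<partial>law (Suc (Suc (Suc k))))
     = (\<integral>\<^sup>+\<omega>. ennreal (return_martingale E x (Suc k) (Suc m) \<omega>) \<partial>law (Suc (Suc k)))"
    by (subst nn_integral_law_Suc[OF measurable_return_martingale]) (simp add: return_martingale_step)
  then show ?case using Suc[of "Suc m"] by simp
qed

lemma srw_return_ge:
  "(\<Sum>z\<in>E `` {x}. hit E x k z) / card (E `` {x}) \<le> measure (srw E x) {\<omega>. \<exists>n\<ge>1. \<omega> n = x}"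
proof -
  let ?N = "Suc (Suc k)"
  let ?M = "\<lambda>_::nat. count_space (UNIV :: 'v set)"
  define A where "A = {\<omega> \<in> space (PC ?N). \<exists>i\<in>{1..Suc k}. \<omega> i = x}"
  have coord: "(\<lambda>\<omega>. \<omega> i) \<in> measurable (PiM I ?M) (count_space UNIV)" if "i \<in> I" for i I
    by (rule measurable_component_singleton[OF that])
  have pred: "Measurable.pred (PiM I ?M) (\<lambda>\<omega>. \<omega> i = x)" if "i \<in> I" for i I
    by (rule measurable_compose[OF coord[OF that]]) simp
  have A: "A \<in> sets (PC ?N)"
    unfolding A_def
    by (intro predE pred_intros_finite pred) auto
  have sets_srw: "sets (srw E x) = sets (PiM UNIV ?M)" unfolding srw_def by simp
  \<comment> \<open>The limit measure has the same total mass as its projection onto the empty set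
    of coordinates, and that projection is a probability measure.\<close>
  have PS: "prob_space (srw E x)"
  proof (rule prob_space_distrD)
    show "(\<lambda>\<omega>. restrict \<omega> {}) \<in> measurable (srw E x) (PiM {} ?M)"
      unfolding measurable_cong_sets[OF sets_srw refl] by (rule measurable_restrict_subset) simp
    show "prob_space (distr (srw E x) (PiM {} ?M) (\<lambda>\<omega>. restrict \<omega> {}))"
      unfolding srw_def using srw.distr_lim[of "{}" E x] srw.PF.prob_space_P[of "{}" E x] by simp
  qed
  have space_srw: "space (srw E x) = UNIV"
    using sets_eq_imp_space_eq[OF sets_srw] by (simp add: space_PiM)
  have full: "{\<omega>. \<exists>n\<ge>1. \<omega> n = x} \<in> sets (srw E x)"
  proof -
    have "Measurable.pred (PiM UNIV ?M) (\<lambda>\<omega>. \<exists>n\<ge>1. \<omega> n = x)"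
      by (intro pred_intros_countable pred_intros_logic pred) auto
    then show ?thesis
      unfolding sets_srw by (simp add: pred_def space_PiM)
  qed
  have "ennreal ((\<Sum>z\<in>E `` {x}. hit E x k z) / card (E `` {x}))
      = (\<integral>\<^sup>+\<omega>. ennreal (return_martingale E x (Suc k) 0 \<omega>) \<partial>law ?N)"
    by (subst law_return_martingale) simp
  \<comment> \<open>With no steps left, \<open>hit\<close> only tests whether the walk is at
    \<open>x\<close> now, so the martingale is the indicator of a return by time
    \<open>Suc k\<close>.\<close>
  also have "\<dots> = (\<integral>\<^sup>+\<omega>. indicator A \<omega> \<partial>law ?N)"
  proof (rule nn_integral_cong)
    fix \<omega> assume "\<omega> \<in> space (law ?N)"
    then have "\<omega> \<in> space (PC ?N)" using srw.space_C[OF undefined_in_PC, of E x ?N] by simp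
    then show "ennreal (return_martingale E x (Suc k) 0 \<omega>) = indicator A \<omega>"
      by (auto simp: return_martingale_def A_def indicator_def)
  qed
  also have "\<dots> = emeasure (law ?N) A"
    using A srw.sets_C[OF undefined_in_PC, of E x ?N] by simp
  also have "\<dots> = emeasure (law ?N) (prod_emb {0..<?N} ?M {0..<?N} A)"
    using sets.sets_into_space[OF A] by (subst prod_emb_id) (auto simp: space_PiM)
  also have "\<dots> = emeasure (srw.CI E x {0..<?N}) A"
    by (rule srw.emeasure_CI[symmetric]) (use A in auto)
  also have "\<dots> = emeasure (srw E x) (prod_emb UNIV ?M {0..<?N} A)"
    unfolding srw_def by (rule srw.lim[symmetric]) (use A in auto)
  also have "\<dots> \<le> emeasure (srw E x) {\<omega>. \<exists>n\<ge>1. \<omega> n = x}"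
    by (rule emeasure_mono[OF _ full]) (auto simp: prod_emb_def A_def)
  finally show ?thesis
    using prob_space.finite_measure[OF PS]
    by (simp add: finite_measure.emeasure_eq_measure)
qed

lemma avg_hit_prob_le_return:
  "(\<Sum>z\<in>E `` {x}. hit_prob E x z) / card (E `` {x}) \<le> measure (srw E x) {\<omega>. \<exists>n\<ge>1. \<omega> n = x}"
  by (rule LIMSEQ_le_const2[OF avg_hit_LIMSEQ]) (use srw_return_ge in auto)

end

text \<open>If \<open>hit_prob\<close> were bounded below by \<open>c > 0\<close>, then \<open>(hit_prob - c) / (1 - c)\<close> would
  contradict its minimality.\<close>

lemma hit_prob_arbitrarily_small:
  assumes fin: "\<And>y. finite (E `` {y})" and ne: "\<And>y. E `` {y} \<noteq> {}"
    and esc: "(\<Sum>z\<in>E `` {x}. hit_prob E x z) / card (E `` {x}) < 1" and "c > 0"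
  shows "\<exists>v. hit_prob E x v < c"
proof (rule ccontr)
  assume "\<nexists>v. hit_prob E x v < c"
  then have ge: "c \<le> hit_prob E x v" for v by (simp add: not_less)
  have deg: "card (E `` {y}) > 0" for y using fin ne by (simp add: card_gt_0_iff)
  \<comment> \<open>If all values were 1, the average in \<open>esc\<close> would be 1 too. A value
    below 1 also forces \<open>c\<close> below 1, so that the rescaling makes sense.\<close>
  have "\<exists>z. hit_prob E x z < 1"
  proof (rule ccontr)
    assume "\<nexists>z. hit_prob E x z < 1"
    then have "hit_prob E x z = 1" for z using hit_prob_bounds(2)[of E x z] by (simp add: not_less order_antisym)
    then show False using esc deg[of x] by simp
  qed
  then obtain z0 where z0: "hit_prob E x z0 < 1" by blast
  then have c1: "c < 1" using ge[of z0] by simp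
  define g where "g v = (hit_prob E x v - c) / (1 - c)" for v
  have "hit_prob E x z0 \<le> g z0"
  proof (rule hit_prob_minimal)
    show "0 \<le> g y" for y using ge[of y] c1 by (simp add: g_def)
    show "1 \<le> g x" using c1 by (simp add: g_def)
    show "(\<Sum>z\<in>E `` {y}. g z) / card (E `` {y}) \<le> g y" if "y \<noteq> x" for y
    proof -
      have "(\<Sum>z\<in>E `` {y}. g z) = ((\<Sum>z\<in>E `` {y}. hit_prob E x z) - card (E `` {y}) * c) / (1 - c)"
        by (simp add: g_def sum_subtractf flip: sum_divide_distrib)
      then have "(\<Sum>z\<in>E `` {y}. g z) / card (E `` {y})
          = ((\<Sum>z\<in>E `` {y}. hit_prob E x z) / card (E `` {y}) - c) / (1 - c)"
        using deg[of y] c1 by (simp add: diff_divide_distrib)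
      then show ?thesis using hit_prob_harmonic[OF that, of E] by (simp add: g_def)
    qed
  qed
  then have "hit_prob E x z0 * (1 - c) \<le> hit_prob E x z0 - c"
    using c1 by (simp add: g_def pos_le_divide_eq)
  then have "c * (1 - hit_prob E x z0) \<le> 0" by (simp add: algebra_simps)
  then show False using \<open>c > 0\<close> z0 by (simp add: mult_le_0_iff)
qed

subsection \<open>Transfer from finite forests to the wired spanning forest\<close>

context rotor_system
begin

section \<open>Graph balls as a finite exhaustion of the vertex set\<close>

definition gball :: "nat \<Rightarrow> 'v set" where
  "gball r = (\<Union>k\<le>r. (E ^^ k) `` {a})"

lemma finite_gball: "finite (gball r)"
proof -
  have "finite ((E ^^ k) `` {a})" for k
  proof (induction k)
    case (Suc k)
    have "(E ^^ Suc k) `` {a} = (\<Union>y\<in>(E ^^ k) `` {a}. E `` {y})" by auto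
    then show ?case using Suc locally_finite by (metis finite_UN_I)
  qed simp
  then show ?thesis by (simp add: gball_def)
qed

lemma gball_mono: "r \<le> r' \<Longrightarrow> gball r \<subseteq> gball r'"
  unfolding gball_def by (intro UN_mono) auto

lemma a_in_gball: "a \<in> gball r"
  unfolding gball_def by (rule UN_I[of 0]) auto

lemma gball_Suc: "x \<in> gball r \<Longrightarrow> (x, y) \<in> E \<Longrightarrow> y \<in> gball (Suc r)"
  unfolding gball_def by (auto intro!: bexI[of _ "Suc _"])

lemma in_some_gball: "\<exists>r. x \<in> gball r"
proof -
  obtain n where "(a, x) \<in> E ^^ n" using connected[of a x] rtrancl_imp_relpow by blast
  then show ?thesis unfolding gball_def by auto
qed

lemma finite_subset_gball:
  assumes "finite S" shows "\<exists>r. \<forall>r'\<ge>r. S \<subseteq> gball r'"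
  using assms
proof (induction S)
  case (insert x S)
  then obtain r where "\<forall>r'\<ge>r. S \<subseteq> gball r'" by blast
  moreover obtain r0 where "x \<in> gball r0" using in_some_gball by blast
  ultimately have "insert x S \<subseteq> gball r'" if "r' \<ge> max r r0" for r'
    using gball_mono[of r0 r'] that by auto
  then show ?case by blast
qed auto

lemma countable_V: "countable (UNIV :: 'v set)"
proof -
  have "UNIV = (\<Union>r. gball r)" using in_some_gball by auto
  moreover have "countable (\<Union>r. gball r)"
    using finite_gball by (intro countable_UN) (auto intro: countable_finite)
  ultimately show ?thesis by simp
qed

section \<open>Frequencies of events under the uniform finite forest\<close>

definition freq :: "'v set \<Rightarrow> (('v \<Rightarrow> 'v) \<Rightarrow> bool) \<Rightarrow> real" where
  "freq D Q = card {\<rho> \<in> Fo D. Q \<rho>} / card (Fo D)"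

lemma measure_USF:
  assumes "finite D"
  shows "measure (USF E (- D)) {F. P F} = freq D (\<lambda>\<rho>. P (rotor_graph D \<rho>))"
proof -
  note bij = bij_betw_forest_rotors[OF assms locally_finite]
  have im: "oriented_forests E (- D) = rotor_graph D ` Fo D"
    using bij by (simp add: bij_betw_def)
  have "bij_betw (rotor_graph D) {\<rho> \<in> Fo D. P (rotor_graph D \<rho>)} {F \<in> oriented_forests E (- D). P F}"
    by (rule bij_betw_Collect[OF bij]) simp
  then have "card {F \<in> oriented_forests E (- D). P F} = card {\<rho> \<in> Fo D. P (rotor_graph D \<rho>)}"
    by (simp add: bij_betw_same_card)
  moreover have "card (oriented_forests E (- D)) = card (Fo D)"
    using bij by (simp add: bij_betw_same_card)
  moreover have "oriented_forests E (- D) \<noteq> {}" "finite (oriented_forests E (- D))"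
    using im forest_rotors_nonempty[OF assms] finite_forest_rotors[OF assms] by auto
  moreover have "oriented_forests E (- D) \<inter> {F. P F} = {F \<in> oriented_forests E (- D). P F}" by auto
  ultimately show ?thesis
    by (simp add: USF_def measure_pmf_of_set freq_def)
qed

lemma freq_mono:
  assumes "finite D" "\<And>\<rho>. \<rho> \<in> Fo D \<Longrightarrow> Q \<rho> \<Longrightarrow> Q' \<rho>"
  shows "freq D Q \<le> freq D Q'"
  unfolding freq_def using finite_forest_rotors[OF assms(1)] assms(2)
  by (intro divide_right_mono) (auto intro!: card_mono)

lemma freq_cong:
  assumes "\<And>\<rho>. \<rho> \<in> Fo D \<Longrightarrow> Q \<rho> \<longleftrightarrow> Q' \<rho>"
  shows "freq D Q = freq D Q'"
proof -
  have "{\<rho> \<in> Fo D. Q \<rho>} = {\<rho> \<in> Fo D. Q' \<rho>}" using assms by blast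
  then show ?thesis by (simp add: freq_def)
qed

lemma freq_eq_0:
  assumes "\<And>\<rho>. \<rho> \<in> Fo D \<Longrightarrow> \<not> Q \<rho>"
  shows "freq D Q = 0"
proof -
  have "{\<rho> \<in> Fo D. Q \<rho>} = {}" using assms by blast
  then show ?thesis unfolding freq_def by (simp only: card.empty of_nat_0 div_0)
qed

lemma freq_finite_union:
  assumes "finite D" "finite I" "\<And>i j \<rho>. i \<in> I \<Longrightarrow> j \<in> I \<Longrightarrow> Q i \<rho> \<Longrightarrow> Q j \<rho> \<Longrightarrow> i = j"
  shows "freq D (\<lambda>\<rho>. \<exists>i\<in>I. Q i \<rho>) = (\<Sum>i\<in>I. freq D (Q i))"
proof -
  have "{\<rho> \<in> Fo D. \<exists>i\<in>I. Q i \<rho>} = (\<Union>i\<in>I. {\<rho> \<in> Fo D. Q i \<rho>})" by auto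
  moreover have "card (\<Union>i\<in>I. {\<rho> \<in> Fo D. Q i \<rho>}) = (\<Sum>i\<in>I. card {\<rho> \<in> Fo D. Q i \<rho>})"
    using assms finite_forest_rotors[OF assms(1)] by (intro card_UN_disjoint) auto
  ultimately show ?thesis by (simp add: freq_def sum_divide_distrib)
qed

lemma freq_union_le:
  assumes "finite D" "finite I"
  shows "freq D (\<lambda>\<rho>. \<exists>i\<in>I. Q i \<rho>) \<le> (\<Sum>i\<in>I. freq D (Q i))"
proof -
  have "{\<rho> \<in> Fo D. \<exists>i\<in>I. Q i \<rho>} = (\<Union>i\<in>I. {\<rho> \<in> Fo D. Q i \<rho>})" by auto
  then have "card {\<rho> \<in> Fo D. \<exists>i\<in>I. Q i \<rho>} \<le> (\<Sum>i\<in>I. card {\<rho> \<in> Fo D. Q i \<rho>})"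
    using card_UN_le[OF assms(2), of "\<lambda>i. {\<rho> \<in> Fo D. Q i \<rho>}"] by simp
  then have "real (card {\<rho> \<in> Fo D. \<exists>i\<in>I. Q i \<rho>}) \<le> (\<Sum>i\<in>I. real (card {\<rho> \<in> Fo D. Q i \<rho>}))"
    unfolding of_nat_sum[symmetric] by (simp only: of_nat_le_iff)
  then show ?thesis by (simp add: freq_def divide_right_mono flip: sum_divide_distrib)
qed

lemma freq_diff_le:
  assumes "finite D" "\<And>\<rho>. \<rho> \<in> Fo D \<Longrightarrow> Q \<rho> \<noteq> Q' \<rho> \<Longrightarrow> P \<rho>"
  shows "\<bar>freq D Q - freq D Q'\<bar> \<le> freq D P"
proof -
  have fin: "finite {\<rho> \<in> Fo D. R \<rho>}" for R using finite_forest_rotors[OF assms(1)] by simp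
  have "card {\<rho> \<in> Fo D. Q1 \<rho>} \<le> card {\<rho> \<in> Fo D. Q2 \<rho>} + card {\<rho> \<in> Fo D. P \<rho>}"
    if "\<And>\<rho>. \<rho> \<in> Fo D \<Longrightarrow> Q1 \<rho> \<noteq> Q2 \<rho> \<Longrightarrow> P \<rho>" for Q1 Q2
  proof -
    have "{\<rho> \<in> Fo D. Q1 \<rho>} \<subseteq> {\<rho> \<in> Fo D. Q2 \<rho>} \<union> {\<rho> \<in> Fo D. P \<rho>}" using that by blast
    then have "card {\<rho> \<in> Fo D. Q1 \<rho>} \<le> card ({\<rho> \<in> Fo D. Q2 \<rho>} \<union> {\<rho> \<in> Fo D. P \<rho>})"
      by (rule card_mono[rotated]) (simp add: fin)
    then show ?thesis
      using card_Un_le order_trans by blast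
  qed
  from this[of Q Q'] this[of Q' Q] assms(2)
  have "real (card {\<rho> \<in> Fo D. Q \<rho>}) \<le> real (card {\<rho> \<in> Fo D. Q' \<rho>}) + real (card {\<rho> \<in> Fo D. P \<rho>})"
    "real (card {\<rho> \<in> Fo D. Q' \<rho>}) \<le> real (card {\<rho> \<in> Fo D. Q \<rho>}) + real (card {\<rho> \<in> Fo D. P \<rho>})"
    unfolding of_nat_add[symmetric] of_nat_le_iff by blast+
  then have "\<bar>real (card {\<rho> \<in> Fo D. Q \<rho>}) - real (card {\<rho> \<in> Fo D. Q' \<rho>})\<bar> \<le> card {\<rho> \<in> Fo D. P \<rho>}"
    by (simp add: abs_le_iff)
  then have "\<bar>real (card {\<rho> \<in> Fo D. Q \<rho>}) - real (card {\<rho> \<in> Fo D. Q' \<rho>})\<bar> / card (Fo D) \<le> card {\<rho> \<in> Fo D. P \<rho>} / card (Fo D)"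
    by (rule divide_right_mono) simp
  moreover have "freq D Q - freq D Q' = (real (card {\<rho> \<in> Fo D. Q \<rho>}) - real (card {\<rho> \<in> Fo D. Q' \<rho>})) / card (Fo D)"
    by (simp add: freq_def diff_divide_distrib)
  ultimately show ?thesis by (simp add: freq_def)
qed

end

section \<open>Events determined by finitely many rotors, and their measurability\<close>

definition depends_on :: "'v set \<Rightarrow> (('v \<Rightarrow> 'v) \<Rightarrow> bool) \<Rightarrow> bool" where
  "depends_on S Q \<longleftrightarrow> (\<forall>\<rho> \<rho>'. (\<forall>x\<in>S. \<rho> x = \<rho>' x) \<longrightarrow> Q \<rho> = Q \<rho>')"

lemma measurable_rotor_component [measurable]:
  "(\<lambda>\<rho>. \<rho> x) \<in> measurable rotor_space (count_space UNIV)"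
  unfolding rotor_space_def by (rule measurable_component_singleton) simp

lemma space_rotor_space [simp]: "space rotor_space = UNIV"
  by (simp add: rotor_space_def space_PiM)

lemma pred_component_eq: "Measurable.pred rotor_space (\<lambda>\<rho>. \<rho> x = y)"
  by (rule measurable_compose[OF measurable_rotor_component[of x]]) simp

lemma pred_countable_Bex:
  assumes "countable C" "\<And>c. c \<in> C \<Longrightarrow> Measurable.pred M (P c)"
  shows "Measurable.pred M (\<lambda>x. \<exists>c\<in>C. P c x)"
  using sets.sets_Collect_countable_Ex'[of C M "\<lambda>c x. P c x"] assms by (simp add: pred_def)

lemma measurable_countable_values:
  assumes cV: "countable (UNIV :: 'v set)" and "\<And>y :: 'v. Measurable.pred M (\<lambda>x. f x = y)"
  shows "f \<in> measurable M (count_space UNIV)"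
proof (rule measurableI)
  fix A :: "'v set"
  have "countable A" using cV by (rule countable_subset[rotated]) simp
  then have "Measurable.pred M (\<lambda>x. \<exists>y\<in>A. f x = y)"
    using assms(2) by (rule pred_countable_Bex)
  moreover have "f -` A \<inter> space M = {x \<in> space M. \<exists>y\<in>A. f x = y}" by auto
  ultimately show "f -` A \<inter> space M \<in> sets M" by (simp add: pred_def)
qed simp

text \<open>Points of \<open>rotor_space\<close> need not follow edges, so the patterns on
  \<open>S\<close> are handled by countability of the vertex set instead of finiteness of
  neighbourhoods.\<close>

lemma pred_depends_on:
  assumes cV: "countable (UNIV :: 'v set)" and "finite (S :: 'v set)" "depends_on S Q"
  shows "Measurable.pred rotor_space Q"
proof -
  define C where "C = {c \<in> PiE S (\<lambda>_. UNIV). Q c}"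
  have "countable (PiE S (\<lambda>_. UNIV :: 'v set))"
    by (rule countable_PiE[OF assms(2)]) (rule cV)
  then have "countable C" unfolding C_def by (rule countable_subset[rotated]) auto
  have Qeq: "Q = (\<lambda>\<rho>. \<exists>c\<in>C. \<forall>x\<in>S. \<rho> x = c x)"
  proof
    fix \<rho>
    show "Q \<rho> \<longleftrightarrow> (\<exists>c\<in>C. \<forall>x\<in>S. \<rho> x = c x)"
    proof
      assume "Q \<rho>"
      moreover have "Q (restrict \<rho> S) = Q \<rho>"
        using assms(3) unfolding depends_on_def by (metis restrict_apply')
      ultimately show "\<exists>c\<in>C. \<forall>x\<in>S. \<rho> x = c x"
        by (intro bexI[of _ "restrict \<rho> S"]) (auto simp: C_def)
    next
      assume "\<exists>c\<in>C. \<forall>x\<in>S. \<rho> x = c x"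
      then show "Q \<rho>" using assms(3) unfolding depends_on_def C_def by blast
    qed
  qed
  show ?thesis
    unfolding Qeq
    by (intro pred_countable_Bex \<open>countable C\<close> pred_intros_finite(3) assms(2) pred_component_eq)
qed

section \<open>Cylinder limits and almost sure structure of the wired forest\<close>

locale wired_forest = rotor_system E \<tau> a
  for E :: "'v rel" and \<tau> :: "'v \<Rightarrow> 'v \<Rightarrow> 'v" and a :: 'v +
  fixes W :: "'v rel measure"
  assumes WSF: "is_WSF E W"

sublocale wired_forest \<subseteq> prob_space W
  using WSF by (simp add: is_WSF_def)

context wired_forest
begin

lemma sets_W: "sets W = sigma_sets (Pow E) {{F. F \<subseteq> E \<and> e \<in> F} | e. e \<in> E}"
proof -
  have "sets W = sets (subgraph_space E)" using WSF by (simp add: is_WSF_def)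
  then show ?thesis
    unfolding subgraph_space_def by (subst (asm) sets_measure_of) auto
qed

lemma space_W: "space W = Pow E"
proof -
  have "sets W = sets (subgraph_space E)" using WSF by (simp add: is_WSF_def)
  then have "space W = space (subgraph_space E)" by (rule sets_eq_imp_space_eq)
  then show ?thesis by (simp add: subgraph_space_def space_measure_of_conv)
qed

lemma pred_edge [measurable]: "Measurable.pred W (\<lambda>F. e \<in> F)"
proof (cases "e \<in> E")
  case True
  have "{F \<in> space W. e \<in> F} = {F. F \<subseteq> E \<and> e \<in> F}" by (auto simp: space_W)
  also have "\<dots> \<in> sets W" unfolding sets_W by (rule sigma_sets.Basic) (use True in blast)
  finally show ?thesis by (simp add: pred_def)
next
  case False
  then have "{F \<in> space W. e \<in> F} = {}" by (auto simp: space_W)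
  then show ?thesis by (metis pred_def sets.empty_sets)
qed

lemma pred_edges: "finite B \<Longrightarrow> Measurable.pred W (\<lambda>F. B \<subseteq> F)"
  unfolding subset_iff Ball_def[symmetric] by (intro pred_intros_finite(3) pred_edge)

lemma cylinder_LIMSEQ:
  assumes "finite B" "B \<subseteq> E"
  shows "(\<lambda>R. freq (gball R) (\<lambda>\<rho>. B \<subseteq> rotor_graph (gball R) \<rho>)) \<longlonglongrightarrow> prob {F \<in> space W. B \<subseteq> F}"
proof -
  have "decseq (\<lambda>R. - gball R)" using gball_mono by (auto simp: decseq_def)
  moreover have "(\<Inter>R. - gball R) = {}" using in_some_gball by auto
  moreover have "{F \<in> space W. B \<subseteq> F} = {F. F \<subseteq> E \<and> B \<subseteq> F}" by (auto simp: space_W)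
  ultimately have "(\<lambda>R. measure (USF E (- gball R)) {F. B \<subseteq> F}) \<longlonglongrightarrow> prob {F \<in> space W. B \<subseteq> F}"
    using WSF assms finite_gball unfolding is_WSF_def by auto
  then show ?thesis by (simp add: measure_USF finite_gball)
qed

lemma rotor_graph_subset_iff:
  "S \<subseteq> D \<Longrightarrow> rotor_graph S c \<subseteq> rotor_graph D \<rho> \<longleftrightarrow> (\<forall>x\<in>S. \<rho> x = c x)"
  by (auto simp: rotor_graph_def)

lemma AE_out_unique: "AE F in W. \<forall>y z. (x, y) \<in> F \<longrightarrow> (x, z) \<in> F \<longrightarrow> y = z"
proof -
  have "AE F in W. (x, y) \<in> F \<longrightarrow> (x, z) \<in> F \<longrightarrow> y = z" if yz: "y \<in> E `` {x}" "z \<in> E `` {x}" for y z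
  proof (cases "y = z")
    case False
    have "freq (gball R) (\<lambda>\<rho>. {(x, y), (x, z)} \<subseteq> rotor_graph (gball R) \<rho>) = 0" for R
      by (rule freq_eq_0) (use False in \<open>auto simp: rotor_graph_iff\<close>)
    then have "prob {F \<in> space W. {(x, y), (x, z)} \<subseteq> F} = 0"
      using cylinder_LIMSEQ[of "{(x, y), (x, z)}"] yz by (auto intro: LIMSEQ_unique)
    moreover have "{F \<in> space W. {(x, y), (x, z)} \<subseteq> F} \<in> events"
      by (rule predE) (rule pred_edges, simp)
    ultimately have "AE F in W. \<not> {(x, y), (x, z)} \<subseteq> F"
      using prob_Collect_eq_0 by blast
    then show ?thesis by (auto elim!: eventually_mono)
  qed auto
  then have "AE F in W. \<forall>y\<in>E `` {x}. \<forall>z\<in>E `` {x}. (x, y) \<in> F \<longrightarrow> (x, z) \<in> F \<longrightarrow> y = z"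
    unfolding AE_finite_all[OF locally_finite] by blast
  then show ?thesis
    using AE_space by eventually_elim (auto simp: space_W)
qed

lemma AE_disjoint_union:
  assumes "finite I" "\<And>i. i \<in> I \<Longrightarrow> A i \<in> events"
    and "\<And>i j. i \<in> I \<Longrightarrow> j \<in> I \<Longrightarrow> i \<noteq> j \<Longrightarrow> AE F in W. F \<notin> A i \<or> F \<notin> A j"
  shows "prob (\<Union>i\<in>I. A i) = (\<Sum>i\<in>I. prob (A i))"
  using assms by (intro measure_UNION_AE) (auto simp: pairwise_def fmeasurable_eq_sets)

text \<open>In a finite forest on a ball containing \<open>x\<close>, the probabilities of the edges
  leaving \<open>x\<close> sum to 1. By local finiteness the sum is finite, so no mass is lost in
  the limit.\<close>

lemma AE_out_exists: "AE F in W. \<exists>y. (x, y) \<in> F"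
proof -
  define A where "A y = {F \<in> space W. {(x, y)} \<subseteq> F}" for y
  have A: "A y \<in> events" for y
    unfolding A_def by (rule predE) (rule pred_edges, simp)
  have "prob (\<Union>y\<in>E `` {x}. A y) = (\<Sum>y\<in>E `` {x}. prob (A y))"
  proof (rule AE_disjoint_union[OF locally_finite A])
    fix y z :: 'v assume "y \<noteq> z"
    then show "AE F in W. F \<notin> A y \<or> F \<notin> A z"
      using AE_out_unique[of x] by (auto simp: A_def elim!: eventually_mono)
  qed
  moreover have "(\<lambda>R. \<Sum>y\<in>E `` {x}. freq (gball R) (\<lambda>\<rho>. {(x, y)} \<subseteq> rotor_graph (gball R) \<rho>))
      \<longlonglongrightarrow> (\<Sum>y\<in>E `` {x}. prob (A y))"
    unfolding A_def by (intro tendsto_sum cylinder_LIMSEQ) auto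
  moreover have "(\<lambda>R. \<Sum>y\<in>E `` {x}. freq (gball R) (\<lambda>\<rho>. {(x, y)} \<subseteq> rotor_graph (gball R) \<rho>)) \<longlonglongrightarrow> 1"
  proof (rule tendsto_eventually)
    obtain r where r: "\<And>R. R \<ge> r \<Longrightarrow> x \<in> gball R" using in_some_gball[of x] gball_mono by blast
    have "(\<Sum>y\<in>E `` {x}. freq (gball R) (\<lambda>\<rho>. {(x, y)} \<subseteq> rotor_graph (gball R) \<rho>)) = 1" if "R \<ge> r" for R
    proof -
      let ?D = "gball R"
      have x: "x \<in> ?D" using r that by blast
      have "(\<Sum>y\<in>E `` {x}. freq ?D (\<lambda>\<rho>. {(x, y)} \<subseteq> rotor_graph ?D \<rho>))
          = freq ?D (\<lambda>\<rho>. \<exists>y\<in>E `` {x}. {(x, y)} \<subseteq> rotor_graph ?D \<rho>)"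
        by (rule freq_finite_union[symmetric]) (auto simp: finite_gball locally_finite rotor_graph_iff)
      also have "\<dots> = freq ?D (\<lambda>\<rho>. True)"
      proof (rule freq_cong)
        fix \<rho> assume "\<rho> \<in> Fo ?D"
        then show "(\<exists>y\<in>E `` {x}. {(x, y)} \<subseteq> rotor_graph ?D \<rho>) \<longleftrightarrow> True"
          using Conf_edge[OF forest_rotors_PiE x] x by (auto simp: rotor_graph_iff)
      qed
      also have "\<dots> = 1" using card_forest_rotors_pos[OF finite_gball, of R] by (simp add: freq_def)
      finally show ?thesis .
    qed
    then show "\<forall>\<^sub>F R in sequentially. (\<Sum>y\<in>E `` {x}. freq (gball R) (\<lambda>\<rho>. {(x, y)} \<subseteq> rotor_graph (gball R) \<rho>)) = 1"
      using eventually_sequentially by blast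
  qed
  ultimately have "prob (\<Union>y\<in>E `` {x}. A y) = 1"
    by (simp add: LIMSEQ_unique)
  then have "AE F in W. F \<in> (\<Union>y\<in>E `` {x}. A y)"
    using locally_finite A by (subst (asm) prob_eq_1) (auto intro!: sets.finite_UN)
  then show ?thesis by (auto simp: A_def elim!: eventually_mono)
qed

lemma AE_rotor_graph: "AE F in W. F = rotor_graph UNIV (rotor_of F) \<and> F \<subseteq> E"
proof -
  have "AE F in W. \<forall>x\<in>UNIV. (\<forall>y z. (x, y) \<in> F \<longrightarrow> (x, z) \<in> F \<longrightarrow> y = z) \<and> (\<exists>y. (x, y) \<in> F)"
    using AE_out_unique AE_out_exists by (subst AE_ball_countable[OF countable_V]) auto
  then show ?thesis
    using AE_space
  proof eventually_elim
    case (elim F)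
    have "(x, y) \<in> F \<longleftrightarrow> y = rotor_of F x" for x y
      unfolding rotor_of_def using elim(1) by (metis UNIV_I theI)
    then show ?case using elim(2) by (auto simp: rotor_graph_iff space_W)
  qed
qed

lemma measurable_rotor_of [measurable]: "rotor_of \<in> measurable W rotor_space"
proof -
  have "(\<lambda>F. rotor_of F x) \<in> measurable W (count_space UNIV)" for x
  proof (rule measurable_countable_values[OF countable_V])
    fix y
    \<comment> \<open>Measurability concerns every \<open>F\<close>, so the list also covers
      out-sets that are not singletons, for which \<open>rotor_of\<close> takes whatever value
      \<open>THE\<close> gives.\<close>
    define \<S> where "\<S> = {S \<in> Pow (E `` {x}). (THE y. y \<in> S) = y}"
    have "{F \<in> space W. rotor_of F x = y}
        = {F \<in> space W. \<exists>S\<in>\<S>. \<forall>z\<in>E `` {x}. (x, z) \<in> F \<longleftrightarrow> z \<in> S}" (is "?l = ?r")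
    proof (intro set_eqI iffI)
      fix F assume "F \<in> ?l"
      then have "F `` {x} \<in> \<S>" "F \<in> space W" by (auto simp: \<S>_def rotor_of_def space_W)
      then show "F \<in> ?r" by (auto intro!: bexI[of _ "F `` {x}"])
    next
      fix F assume "F \<in> ?r"
      then obtain S where S: "S \<subseteq> E `` {x}" "(THE y. y \<in> S) = y" "F \<subseteq> E"
        "\<And>z. z \<in> E `` {x} \<Longrightarrow> (x, z) \<in> F \<longleftrightarrow> z \<in> S" by (auto simp: \<S>_def space_W)
      then have "(x, z) \<in> F \<longleftrightarrow> z \<in> S" for z by (cases "z \<in> E `` {x}") auto
      then show "F \<in> ?l" using S by (simp add: rotor_of_def space_W)
    qed
    also have "\<dots> \<in> sets W"
      using locally_finite
      by (intro predE pred_intros_finite pred_intros_logic) (auto simp: \<S>_def)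
    finally show "Measurable.pred W (\<lambda>F. rotor_of F x = y)" by (simp add: pred_def)
  qed
  then show ?thesis
    unfolding rotor_space_def by (intro measurable_PiM_single') (auto simp: PiE_def)
qed

lemma event_rotor_of: "Measurable.pred rotor_space Q \<Longrightarrow> {F \<in> space W. Q (rotor_of F)} \<in> events"
  by (rule predE) (rule measurable_compose[OF measurable_rotor_of])

text \<open>Along edges only finitely many patterns on \<open>S\<close> are possible, so the event
  splits into finitely many cylinders. They are disjoint in finite forests and almost surely
  disjoint under \<open>W\<close>, hence their limits add up.\<close>

lemma transfer_LIMSEQ:
  assumes S: "finite S" and Q: "depends_on S Q"
  shows "(\<lambda>R. freq (gball R) Q) \<longlonglongrightarrow> prob {F \<in> space W. Q (rotor_of F)}"
proof -
  define C where "C = {c \<in> Conf S. Q c}"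
  have finC: "finite C" unfolding C_def using finite_Conf[OF S] by simp
  define A where "A c = {F \<in> space W. rotor_graph S c \<subseteq> F}" for c
  have finS: "finite (rotor_graph S c)" for c
    using S by (simp add: rotor_graph_def)
  have A: "A c \<in> events" for c
    unfolding A_def by (rule predE) (rule pred_edges[OF finS])
  have inC: "(\<exists>c\<in>C. \<forall>x\<in>S. \<rho> x = c x) \<longleftrightarrow> Q \<rho>" if "\<And>x. x \<in> S \<Longrightarrow> (x, \<rho> x) \<in> E" for \<rho>
  proof
    assume "Q \<rho>"
    moreover have "Q (restrict \<rho> S) = Q \<rho>"
      using Q unfolding depends_on_def by (metis restrict_apply')
    ultimately show "\<exists>c\<in>C. \<forall>x\<in>S. \<rho> x = c x"
      using that by (intro bexI[of _ "restrict \<rho> S"]) (auto simp: C_def)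
  next
    assume "\<exists>c\<in>C. \<forall>x\<in>S. \<rho> x = c x"
    then show "Q \<rho>" using Q unfolding depends_on_def C_def by blast
  qed
  have uniq: "c = c'" if "c \<in> C" "c' \<in> C" "\<forall>x\<in>S. \<rho> x = c x" "\<forall>x\<in>S. \<rho> x = c' x" for c c' \<rho>
    using that unfolding C_def by (metis (mono_tags, lifting) PiE_ext mem_Collect_eq)
  have "(\<lambda>R. \<Sum>c\<in>C. freq (gball R) (\<lambda>\<rho>. rotor_graph S c \<subseteq> rotor_graph (gball R) \<rho>)) \<longlonglongrightarrow> (\<Sum>c\<in>C. prob (A c))"
    unfolding A_def
  proof (intro tendsto_sum cylinder_LIMSEQ finS)
    fix c assume "c \<in> C"
    then show "rotor_graph S c \<subseteq> E" by (auto simp: C_def rotor_graph_def)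
  qed
  moreover have "\<forall>\<^sub>F R in sequentially.
      (\<Sum>c\<in>C. freq (gball R) (\<lambda>\<rho>. rotor_graph S c \<subseteq> rotor_graph (gball R) \<rho>)) = freq (gball R) Q"
  proof -
    obtain r where r: "\<And>R. R \<ge> r \<Longrightarrow> S \<subseteq> gball R" using finite_subset_gball[OF S] by blast
    have "(\<Sum>c\<in>C. freq (gball R) (\<lambda>\<rho>. rotor_graph S c \<subseteq> rotor_graph (gball R) \<rho>)) = freq (gball R) Q"
      if "R \<ge> r" for R
    proof -
      let ?D = "gball R"
      have SD: "S \<subseteq> ?D" using r that by blast
      have "(\<Sum>c\<in>C. freq ?D (\<lambda>\<rho>. rotor_graph S c \<subseteq> rotor_graph ?D \<rho>))
          = freq ?D (\<lambda>\<rho>. \<exists>c\<in>C. \<forall>x\<in>S. \<rho> x = c x)"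
        unfolding rotor_graph_subset_iff[OF SD]
        by (rule freq_finite_union[symmetric, OF finite_gball finC uniq])
      also have "\<dots> = freq ?D Q"
      proof (rule freq_cong)
        fix \<rho> assume "\<rho> \<in> Fo ?D"
        then have "(x, \<rho> x) \<in> E" if "x \<in> S" for x
          using Conf_edge[OF forest_rotors_PiE] that SD by blast
        then show "(\<exists>c\<in>C. \<forall>x\<in>S. \<rho> x = c x) \<longleftrightarrow> Q \<rho>" by (rule inC)
      qed
      finally show ?thesis .
    qed
    then show ?thesis using eventually_sequentially by blast
  qed
  moreover have "(\<Sum>c\<in>C. prob (A c)) = prob {F \<in> space W. Q (rotor_of F)}"
  proof -
    have AE_A: "AE F in W. (\<forall>c. F \<in> A c \<longleftrightarrow> (\<forall>x\<in>S. rotor_of F x = c x)) \<and> (\<forall>x. (x, rotor_of F x) \<in> E)"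
      using AE_rotor_graph AE_space
    proof eventually_elim
      case (elim F)
      then have "(x, rotor_of F x) \<in> E" for x by (metis UNIV_I rotor_graph_iff subsetD)
      moreover have "F \<in> A c \<longleftrightarrow> (\<forall>x\<in>S. rotor_of F x = c x)" for c
        using elim rotor_graph_subset_iff[of S UNIV c "rotor_of F"] by (simp add: A_def)
      ultimately show ?case by blast
    qed
    have "prob (\<Union>c\<in>C. A c) = (\<Sum>c\<in>C. prob (A c))"
    proof (rule AE_disjoint_union[OF finC A])
      fix c c' assume cc: "c \<in> C" "c' \<in> C" "c \<noteq> c'"
      show "AE F in W. F \<notin> A c \<or> F \<notin> A c'"
        using AE_A by eventually_elim (use uniq cc in blast)
    qed
    moreover have "prob (\<Union>c\<in>C. A c) = prob {F \<in> space W. Q (rotor_of F)}"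
    proof (rule finite_measure_eq_AE)
      show "AE F in W. F \<in> (\<Union>c\<in>C. A c) \<longleftrightarrow> F \<in> {F \<in> space W. Q (rotor_of F)}"
        using AE_A AE_space
      proof eventually_elim
        case (elim F)
        then show ?case using inC[of "rotor_of F"] by auto
      qed
      show "(\<Union>c\<in>C. A c) \<in> events" using finC A by blast
      show "{F \<in> space W. Q (rotor_of F)} \<in> events"
        by (rule event_rotor_of[OF pred_depends_on[OF countable_V S Q]])
    qed
    ultimately show ?thesis by simp
  qed
  ultimately show ?thesis
    by (simp add: tendsto_cong)
qed

end

subsection \<open>One end means finitely many descendants\<close>

lemma leads_funpow: "(u, y) \<in> (rotor_graph UNIV \<rho>)\<^sup>* \<longleftrightarrow> (\<exists>n. y = (\<rho> ^^ n) u)"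
proof
  show "(u, y) \<in> (rotor_graph UNIV \<rho>)\<^sup>* \<Longrightarrow> \<exists>n. y = (\<rho> ^^ n) u"
  proof (induction rule: rtrancl_induct)
    case base
    show ?case by (rule exI[of _ 0]) simp
  next
    case (step y z)
    then obtain n where "y = (\<rho> ^^ n) u" by blast
    then show ?case using step by (intro exI[of _ "Suc n"]) (simp add: rotor_graph_iff)
  qed
next
  assume "\<exists>n. y = (\<rho> ^^ n) u"
  then obtain n where "y = (\<rho> ^^ n) u" by blast
  moreover have "(u, (\<rho> ^^ n) u) \<in> (rotor_graph UNIV \<rho>)\<^sup>*"
    by (induction n) (auto simp: rotor_graph_iff intro: rtrancl_into_rtrancl)
  ultimately show "(u, y) \<in> (rotor_graph UNIV \<rho>)\<^sup>*" by simp
qed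

text \<open>Koenig's lemma run backwards: among finitely many predecessors of a vertex with
  infinitely many descendants, one again has infinitely many.\<close>

lemma backward_ray:
  assumes fin: "\<And>x. finite {y. (y, x) \<in> F}" and inf: "infinite {y. (y, u) \<in> F\<^sup>*}"
  shows "\<exists>p. p 0 = u \<and> (\<forall>n. (p (Suc n), p n) \<in> F)"
proof -
  define P where "P x \<longleftrightarrow> infinite {y. (y, x) \<in> F\<^sup>*}" for x
  have "\<exists>z. (z, x) \<in> F \<and> P z" if "P x" for x
  proof (rule ccontr)
    assume no: "\<nexists>z. (z, x) \<in> F \<and> P z"
    have "{y. (y, x) \<in> F\<^sup>*} \<subseteq> insert x (\<Union>z\<in>{z. (z, x) \<in> F}. {y. (y, z) \<in> F\<^sup>*})"
      by (auto elim: rtranclE)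
    moreover have "finite (insert x (\<Union>z\<in>{z. (z, x) \<in> F}. {y. (y, z) \<in> F\<^sup>*}))"
      using fin no by (auto simp: P_def)
    ultimately show False using that finite_subset unfolding P_def by blast
  qed
  then obtain p where "\<forall>n. P (p n)" "p 0 = u" "\<forall>n. (p (Suc n), p n) \<in> F"
    using dependent_nat_choice[of "\<lambda>n x. P x \<and> (n = 0 \<longrightarrow> x = u)" "\<lambda>n x y. (y, x) \<in> F"] inf
    by (metis P_def nat.distinct(1))
  then show ?thesis by blast
qed

text \<open>Otherwise one ray runs backwards from \<open>u\<close>, while the rotors give another
  running forwards. By acyclicity they share only \<open>u\<close>, so they are inequivalent and the
  tree has two ends.\<close>

lemma finite_descendants_of_one_end:
  assumes acyc: "acyclic (rotor_graph UNIV \<rho>)"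
    and fin: "\<And>x. finite {y. (y, x) \<in> rotor_graph UNIV \<rho>}"
    and one: "\<forall>T\<in>forest_trees (rotor_graph UNIV \<rho>). card (ends (rotor_graph UNIV \<rho>) T) = 1"
  shows "finite {y. (y, u) \<in> (rotor_graph UNIV \<rho>)\<^sup>*}"
proof (rule ccontr)
  let ?F = "rotor_graph UNIV \<rho>"
  assume "infinite {y. (y, u) \<in> ?F\<^sup>*}"
  then obtain p where p: "p 0 = u" "\<And>n. (p (Suc n), p n) \<in> ?F"
    using backward_ray[OF fin] by metis
  define q where "q n = (\<rho> ^^ n) u" for n
  have q: "(q n, q (Suc n)) \<in> ?F" for n by (simp add: q_def rotor_graph_iff)
  have no_cyc: "(x, x) \<notin> ?F\<^sup>+" for x using acyc by (simp add: acyclic_def)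
  have p_tr: "(p (i + Suc k), p i) \<in> ?F\<^sup>+" for i k
    by (induction k) (use p(2) in \<open>auto intro: trancl_into_trancl2\<close>)
  have q_tr: "(q i, q (i + Suc k)) \<in> ?F\<^sup>+" for i k
    by (induction k) (use q in \<open>auto intro: trancl_into_trancl\<close>)
  have inj_p: "inj p"
  proof (rule injI, rule ccontr)
    fix i j assume "p i = p j" "i \<noteq> j"
    then show False
      using p_tr[of i "j - Suc i"] p_tr[of j "i - Suc j"] no_cyc by (cases "i < j") auto
  qed
  have inj_q: "inj q"
  proof (rule injI, rule ccontr)
    fix i j assume "q i = q j" "i \<noteq> j"
    then show False
      using q_tr[of i "j - Suc i"] q_tr[of j "i - Suc j"] no_cyc by (cases "i < j") auto
  qed
  have p_u: "(p i, u) \<in> ?F\<^sup>*" for i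
    using p_tr[of 0 "i - 1"] p(1) by (cases i) (auto dest: trancl_into_rtrancl)
  have u_q: "(u, q i) \<in> ?F\<^sup>*" for i
    unfolding q_def leads_funpow by blast
  have disj: "p (Suc i) \<noteq> q j" for i j
  proof
    assume "p (Suc i) = q j"
    then have "(u, p (Suc i)) \<in> ?F\<^sup>*" using u_q[of j] by simp
    moreover have "(p (Suc i), u) \<in> ?F\<^sup>+" using p_tr[of 0 i] p(1) by simp
    ultimately show False using no_cyc by (meson rtrancl_trancl_trancl)
  qed
  define T where "T = (?F \<union> ?F\<inverse>)\<^sup>* `` {u}"
  have T: "T \<in> forest_trees ?F" by (simp add: T_def forest_trees_def quotientI)
  have "p i \<in> T" for i
  proof -
    have "(u, p i) \<in> (?F\<inverse>)\<^sup>*" using p_u by (simp add: rtrancl_converse)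
    then have "(u, p i) \<in> (?F \<union> ?F\<inverse>)\<^sup>*" using rtrancl_mono[of "?F\<inverse>" "?F \<union> ?F\<inverse>"] by blast
    then show ?thesis by (simp add: T_def)
  qed
  then have p_ray: "p \<in> rays ?F T" using inj_p p(2) by (auto simp: rays_def)
  have "q i \<in> T" for i
    using u_q[of i] rtrancl_mono[of ?F "?F \<union> ?F\<inverse>"] by (auto simp: T_def)
  then have q_ray: "q \<in> rays ?F T" using inj_q q by (auto simp: rays_def)
  define r where "r = {(p, q). p \<in> rays ?F T \<and> q \<in> rays ?F T \<and>
     finite ((range p - range q) \<union> (range q - range p))}"
  have ends_eq: "ends ?F T = rays ?F T // r" by (simp add: ends_def r_def)
  obtain e where "ends ?F T = {e}" using one T by (meson card_1_singletonE)
  then have "r `` {p} = r `` {q}"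
    using p_ray q_ray unfolding ends_eq by (metis quotientI singletonD)
  moreover have "q \<in> r `` {q}" using q_ray by (simp add: r_def)
  ultimately have "(p, q) \<in> r" by blast
  then have "finite (range p - range q)" by (simp add: r_def)
  moreover have "range (\<lambda>i. p (Suc i)) \<subseteq> range p - range q" using disj by auto
  ultimately have "finite (range (\<lambda>i. p (Suc i)))" by (rule finite_subset[rotated])
  moreover have "inj (\<lambda>i. p (Suc i))" using inj_p by (metis injD injI nat.inject)
  ultimately show False using range_inj_infinite by blast
qed

text \<open>Cut the path at its last entrance into \<open>D'\<close>: the vertex just before lies
  outside \<open>D'\<close> and points into it. A far descendant is thus witnessed inside a fixed
  set \<open>S\<close>, however large \<open>D\<close> is.\<close>

lemma leads_outside_truncate:
  assumes "(y, u) \<in> (rotor_graph D \<psi>)\<^sup>*" "y \<notin> D'" "u \<in> D'"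
    and S: "D' \<subseteq> S" "\<And>z. z \<in> D - D' \<Longrightarrow> \<psi> z \<in> D' \<Longrightarrow> z \<in> S"
  shows "\<exists>y'\<in>S - D'. (y', u) \<in> (rotor_graph S \<psi>)\<^sup>*"
proof -
  have "(y, u) \<in> (rotor_graph D' \<psi>)\<^sup>* \<or> (\<exists>y'\<in>S - D'. (y', u) \<in> (rotor_graph S \<psi>)\<^sup>*)"
    using assms(1)
  proof (induction rule: converse_rtrancl_induct)
    case (step y z)
    then have z: "y \<in> D" "z = \<psi> y" by (auto simp: rotor_graph_iff)
    show ?case
    proof (cases "(z, u) \<in> (rotor_graph D' \<psi>)\<^sup>*")
      case True
      show ?thesis
      proof (cases "y \<in> D'")
        case True
        then have "(y, z) \<in> rotor_graph D' \<psi>" using z by (simp add: rotor_graph_iff)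
        then show ?thesis
          using \<open>(z, u) \<in> (rotor_graph D' \<psi>)\<^sup>*\<close> by (blast intro: converse_rtrancl_into_rtrancl)
      next
        case False
        have "z \<in> D'" using leads_outside[OF True] assms(3) by blast
        then have "y \<in> S" using S(2) z False by blast
        then have "(y, u) \<in> (rotor_graph S \<psi>)\<^sup>*"
          using z leads_mono[OF S(1) True] by (auto simp: rotor_graph_iff intro: converse_rtrancl_into_rtrancl)
        then show ?thesis using \<open>y \<in> S\<close> False by blast
      qed
    qed (use step in blast)
  qed auto
  then show ?thesis using leads_outside[of y u D' \<psi>] assms(2,3) by metis
qed

locale one_ended_forest = wired_forest E \<tau> a W
  for E :: "'v rel" and \<tau> :: "'v \<Rightarrow> 'v \<Rightarrow> 'v" and a :: 'v and W :: "'v rel measure" +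
  assumes one_end: "AE F in W. \<forall>T\<in>forest_trees F. card (ends F T) = 1"
    and transient: "transient_graph E"

context wired_forest
begin

lemma depends_on_leads: "depends_on S (\<lambda>\<rho>. P (rotor_graph S \<rho>))"
  unfolding depends_on_def by (metis rotor_graph_cong)

lemma leads_in_gball:
  assumes "(x, y) \<in> (rotor_graph UNIV \<rho>)\<^sup>*" shows "\<exists>k. (x, y) \<in> (rotor_graph (gball k) \<rho>)\<^sup>*"
  using assms
proof (induction rule: rtrancl_induct)
  case (step y z)
  then obtain k where k: "(x, y) \<in> (rotor_graph (gball k) \<rho>)\<^sup>*" by blast
  obtain l where l: "y \<in> gball l" using in_some_gball by blast
  have sub: "gball k \<subseteq> gball (max k l)" "gball l \<subseteq> gball (max k l)" by (simp_all add: gball_mono)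
  have "(x, y) \<in> (rotor_graph (gball (max k l)) \<rho>)\<^sup>*" by (rule leads_mono[OF sub(1) k])
  moreover have "(y, z) \<in> rotor_graph (gball (max k l)) \<rho>"
    using sub(2) l step(2) by (auto simp: rotor_graph_iff)
  ultimately
  show ?case by (meson rtrancl_into_rtrancl)
qed auto

text \<open>A cycle fits into some ball, and a finite forest on a larger ball has no cycle there. So
  each ball is cyclic with limiting frequency 0.\<close>

lemma AE_acyclic: "AE F in W. acyclic F"
proof -
  have "AE F in W. acyclic (rotor_graph (gball k) (rotor_of F))" for k
  proof -
    define Q where "Q \<rho> \<longleftrightarrow> \<not> acyclic (rotor_graph (gball k) \<rho>)" for \<rho> :: "'v \<Rightarrow> 'v"
    have Q: "depends_on (gball k) Q"
      unfolding Q_def by (rule depends_on_leads)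
    have "freq (gball R) Q = 0" if "R \<ge> k" for R
    proof (rule freq_eq_0)
      fix \<rho> assume "\<rho> \<in> Fo (gball R)"
      then have "acyclic (rotor_graph (gball R) \<rho>)" by (rule forest_rotors_acyclic)
      then show "\<not> Q \<rho>"
        unfolding Q_def using acyclic_subset rotor_graph_mono[OF gball_mono[OF that]] by blast
    qed
    then have "(\<lambda>R. freq (gball R) Q) \<longlonglongrightarrow> 0"
      by (intro tendsto_eventually) (auto simp: eventually_sequentially)
    then have "prob {F \<in> space W. Q (rotor_of F)} = 0"
      using transfer_LIMSEQ[OF finite_gball Q] LIMSEQ_unique by blast
    then show ?thesis
      using prob_Collect_eq_0[OF event_rotor_of[OF pred_depends_on[OF countable_V finite_gball Q]]]
      by (simp add: Q_def)
  qed
  then have "AE F in W. \<forall>k. acyclic (rotor_graph (gball k) (rotor_of F))"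
    by (simp add: AE_all_countable)
  then show ?thesis
    using AE_rotor_graph
  proof eventually_elim
    case (elim F)
    let ?\<rho> = "rotor_of F"
    have "acyclic (rotor_graph UNIV ?\<rho>)"
    proof (rule acyclicI, rule allI, rule notI)
      fix x assume "(x, x) \<in> (rotor_graph UNIV ?\<rho>)\<^sup>+"
      then have "(?\<rho> x, x) \<in> (rotor_graph UNIV ?\<rho>)\<^sup>*"
        by (auto dest!: tranclD simp: rotor_graph_iff)
      then obtain k where k: "(?\<rho> x, x) \<in> (rotor_graph (gball k) ?\<rho>)\<^sup>*" using leads_in_gball by blast
      obtain l where l: "x \<in> gball l" using in_some_gball by blast
      have sub: "gball k \<subseteq> gball (max k l)" "gball l \<subseteq> gball (max k l)" by (simp_all add: gball_mono)
      have "(?\<rho> x, x) \<in> (rotor_graph (gball (max k l)) ?\<rho>)\<^sup>*" by (rule leads_mono[OF sub(1) k])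
      moreover have "(x, ?\<rho> x) \<in> rotor_graph (gball (max k l)) ?\<rho>"
        using sub(2) l by (auto simp: rotor_graph_iff)
      ultimately have "(x, x) \<in> (rotor_graph (gball (max k l)) ?\<rho>)\<^sup>+" by simp
      then show False using elim(1) by (simp add: acyclic_def)
    qed
    then show ?case using elim(2) by metis
  qed
qed

lemma restrict_forest:
  assumes "acyclic F" "F = rotor_graph UNIV (rotor_of F)" "F \<subseteq> E" "finite D"
  shows "restrict (rotor_of F) D \<in> Fo D"
proof -
  have eq: "rotor_graph D (restrict (rotor_of F) D) = rotor_graph D (rotor_of F)"
    by (rule rotor_graph_cong) simp
  have "rotor_graph D (rotor_of F) \<subseteq> F"
    using assms(2) rotor_graph_mono[of D UNIV "rotor_of F"] by simp
  then have "acyclic (rotor_graph D (restrict (rotor_of F) D))"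
    using assms(1) eq by (metis acyclic_subset)
  moreover have "(x, rotor_of F x) \<in> E" for x
    using assms(2,3) by (metis UNIV_I rotor_graph_iff subsetD)
  ultimately show ?thesis
    using leads_of_acyclic[OF assms(4)] by (auto simp: forest_rotors_def)
qed

definition far_event :: "'v set \<Rightarrow> nat \<Rightarrow> 'v rel \<Rightarrow> bool" where
  "far_event K r F \<longleftrightarrow> (\<exists>y\<in>- gball r. \<exists>u\<in>K. (y, u) \<in> F\<^sup>*)"

lemma pred_rtrancl: "Measurable.pred W (\<lambda>F. (y, u) \<in> F\<^sup>*)"
proof -
  have "Measurable.pred W (\<lambda>F. (y, u) \<in> F ^^ n)" for n
  proof (induction n arbitrary: u)
    case (Suc n)
    have "Measurable.pred W (\<lambda>F. \<exists>z\<in>UNIV. (y, z) \<in> F ^^ n \<and> (z, u) \<in> F)"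
      by (intro pred_countable_Bex countable_V pred_intros_logic Suc pred_edge)
    then show ?case by (simp add: relcomp_unfold)
  qed simp
  then have "Measurable.pred W (\<lambda>F. \<exists>n. (y, u) \<in> F ^^ n)" by measurable
  then show ?thesis by (simp add: rtrancl_power)
qed

lemma pred_far_event: "finite K \<Longrightarrow> Measurable.pred W (far_event K r)"
  unfolding far_event_def[abs_def]
  by (intro pred_countable_Bex countable_subset[OF _ countable_V] pred_intros_finite(4) pred_rtrancl) auto

end

context one_ended_forest
begin

lemma AE_finite_descendants: "AE F in W. \<forall>u. finite {y. (y, u) \<in> F\<^sup>*}"
  using AE_rotor_graph AE_acyclic one_end
proof eventually_elim
  case (elim F)
  have fin: "finite {y. (y, x) \<in> rotor_graph UNIV (rotor_of F)}" for x
  proof (rule finite_subset[OF _ locally_finite[of x]])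
    show "{y. (y, x) \<in> rotor_graph UNIV (rotor_of F)} \<subseteq> E `` {x}"
      using elim(1) sym_E by (auto dest: symD)
  qed
  show ?case
    using finite_descendants_of_one_end[of "rotor_of F", OF _ fin] elim by metis
qed

text \<open>The events decrease in \<open>r\<close>, and almost surely the finitely many vertices
  leading to \<open>K\<close> all lie in one ball; continuity from above gives the limit.\<close>

lemma far_event_LIMSEQ:
  assumes "finite K"
  shows "(\<lambda>r. prob {F \<in> space W. far_event K r F}) \<longlonglongrightarrow> 0"
proof -
  define A where "A r = {F \<in> space W. far_event K r F}" for r
  have A: "A r \<in> events" for r unfolding A_def by (rule predE[OF pred_far_event[OF assms]])
  have "decseq A"
  proof (rule decseq_SucI)
    fix r show "A (Suc r) \<subseteq> A r"
      using gball_mono[of r "Suc r"] unfolding A_def far_event_def by auto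
  qed
  then have "(\<lambda>r. prob (A r)) \<longlonglongrightarrow> prob (\<Inter>r. A r)"
    using A by (intro finite_Lim_measure_decseq) auto
  moreover have "AE F in W. F \<notin> (\<Inter>r. A r)"
    using AE_finite_descendants
  proof eventually_elim
    case (elim F)
    then have fin: "finite (\<Union>u\<in>K. {y. (y, u) \<in> F\<^sup>*})" using assms by blast
    obtain r where r: "(\<Union>u\<in>K. {y. (y, u) \<in> F\<^sup>*}) \<subseteq> gball r"
      using finite_subset_gball[OF fin] by blast
    then have "F \<notin> A r" unfolding A_def far_event_def by blast
    then show ?case by blast
  qed
  then have "prob (\<Inter>r. A r) = 0"
    using A by (subst prob_eq_0) auto
  ultimately show ?thesis by (simp add: A_def)
qed

end

subsection \<open>Late returns are rare\<close>

text \<open>Up to time \<open>t\<close> the walk consults only rotors at positions visited before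
  \<open>t\<close>. The position at time \<open>t\<close> may itself lie outside \<open>D\<close>,
  as happens at an exit.\<close>

lemma walk_local:
  assumes "\<And>x. x \<in> D \<Longrightarrow> \<rho> x = \<rho>' x"
    and "\<And>u. u < t \<Longrightarrow> walk_position \<tau> a \<rho> u \<in> D"
  shows "walk_position \<tau> a \<rho>' t = walk_position \<tau> a \<rho> t \<and>
    (\<forall>x\<in>D. walk_rotors \<tau> a \<rho>' t x = walk_rotors \<tau> a \<rho> t x)"
  using assms(2)
proof (induction t)
  case 0
  then show ?case using assms(1) by simp
next
  case (Suc t)
  then have "walk_position \<tau> a \<rho> t \<in> D" by blast
  moreover have "walk_position \<tau> a \<rho>' t = walk_position \<tau> a \<rho> t \<and>
    (\<forall>x\<in>D. walk_rotors \<tau> a \<rho>' t x = walk_rotors \<tau> a \<rho> t x)"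
    using Suc by simp
  ultimately show ?case by (simp add: walk_position_Suc walk_rotors_Suc)
qed

lemma exit_at_local:
  assumes "\<And>x. x \<in> D \<Longrightarrow> \<rho> x = \<rho>' x" and ex: "exit_at \<tau> a D \<rho> t"
  shows "exit_at \<tau> a D \<rho>' t" "\<And>x. x \<in> D \<Longrightarrow> walk_rotors \<tau> a \<rho>' t x = walk_rotors \<tau> a \<rho> t x"
proof -
  have "walk_position \<tau> a \<rho>' u = walk_position \<tau> a \<rho> u \<and>
    (\<forall>x\<in>D. walk_rotors \<tau> a \<rho>' u x = walk_rotors \<tau> a \<rho> u x)" if "u \<le> t" for u
    using ex that by (intro walk_local assms(1)) (auto simp: exit_at_def)
  then show "exit_at \<tau> a D \<rho>' t" "\<And>x. x \<in> D \<Longrightarrow> walk_rotors \<tau> a \<rho>' t x = walk_rotors \<tau> a \<rho> t x"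
    using ex by (auto simp: exit_at_def)
qed

lemma rotors_unvisited:
  assumes "t \<le> t'" "\<And>s. t \<le> s \<Longrightarrow> s < t' \<Longrightarrow> walk_position \<tau> a \<rho> s \<noteq> x"
  shows "walk_rotors \<tau> a \<rho> t' x = walk_rotors \<tau> a \<rho> t x"
  using assms
proof (induction t' rule: dec_induct)
  case (step n)
  then show ?case by (metis fun_upd_other less_Suc_eq order_less_imp_le walk_rotors_Suc lessI)
qed simp

section \<open>Returns and exits as events of finitely many rotors\<close>

context rotor_system
begin

text \<open>Confinement to \<open>D\<close> until the return makes the event a function of the
  rotors in \<open>D\<close>, so it has a frequency among finite forests. Unconfined returns are
  recovered as a union over growing \<open>D\<close>.\<close>

definition revisit :: "'v set \<Rightarrow> 'v set \<Rightarrow> 'v \<Rightarrow> ('v \<Rightarrow> 'v) \<Rightarrow> bool" where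
  "revisit D' D x \<rho> \<longleftrightarrow> (\<exists>t s. t < s \<and> X \<rho> t \<notin> D' \<and> X \<rho> s = x \<and> (\<forall>u\<le>s. X \<rho> u \<in> D))"

lemma depends_on_revisit: "depends_on D (revisit D' D x)"
proof -
  have "revisit D' D x \<rho>'" if eq: "\<forall>x\<in>D. \<rho> x = \<rho>' x" and rv: "revisit D' D x \<rho>" for \<rho> \<rho>'
  proof -
    obtain t s where ts: "t < s" "X \<rho> t \<notin> D'" "X \<rho> s = x" "\<forall>u\<le>s. X \<rho> u \<in> D"
      using rv unfolding revisit_def by blast
    have "X \<rho>' u = X \<rho> u" if "u \<le> s" for u
      using walk_local[of D \<rho> \<rho>' u \<tau> a] eq ts that by auto
    then show ?thesis unfolding revisit_def using ts by (intro exI[of _ t] exI[of _ s]) auto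
  qed
  then show ?thesis unfolding depends_on_def by (metis (no_types, lifting))
qed

lemma revisit_mono: "D1 \<subseteq> D2 \<Longrightarrow> revisit D' D1 x \<rho> \<Longrightarrow> revisit D' D2 x \<rho>"
  unfolding revisit_def by blast

definition exit_event :: "'v set \<Rightarrow> (('v \<Rightarrow> 'v) \<Rightarrow> bool) \<Rightarrow> ('v \<Rightarrow> 'v) \<Rightarrow> bool" where
  "exit_event D Q \<rho> \<longleftrightarrow> (\<exists>t. exit_at \<tau> a D \<rho> t \<and> Q (Rot \<rho> t))"

lemma depends_on_exit_event:
  assumes "depends_on A Q" "A \<subseteq> D" shows "depends_on D (exit_event D Q)"
proof -
  have "exit_event D Q \<rho>'" if eq: "\<forall>x\<in>D. \<rho> x = \<rho>' x" and ev: "exit_event D Q \<rho>" for \<rho> \<rho>'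
  proof -
    obtain t where t: "exit_at \<tau> a D \<rho> t" "Q (Rot \<rho> t)" using ev unfolding exit_event_def by blast
    have "exit_at \<tau> a D \<rho>' t" "\<forall>x\<in>A. Rot \<rho>' t x = Rot \<rho> t x"
      using exit_at_local[of D \<rho> \<rho>' \<tau> a t] eq t assms(2) by auto
    then show ?thesis using t assms(1) unfolding exit_event_def depends_on_def by blast
  qed
  then show ?thesis unfolding depends_on_def by (metis (no_types, lifting))
qed

lemma exit_event_iff: "exit_at \<tau> a D \<rho> t \<Longrightarrow> exit_event D Q \<rho> \<longleftrightarrow> Q (Rot \<rho> t)"
  unfolding exit_event_def using exit_at_unique by metis

lemma exit_exists_gball: "\<rho> \<in> Fo (gball R) \<Longrightarrow> \<exists>t. exit_at \<tau> a (gball R) \<rho> t"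
proof -
  interpret finite_rotor_system E \<tau> a "gball R"
    by unfold_locales (simp_all add: finite_gball a_in_gball)
  show "\<rho> \<in> Fo (gball R) \<Longrightarrow> ?thesis" by (rule exit_exists)
qed

lemma freq_exit_event: "freq (gball R) (exit_event (gball R) Q) = freq (gball R) Q"
proof -
  interpret finite_rotor_system E \<tau> a "gball R"
    by unfold_locales (simp_all add: finite_gball a_in_gball)
  show ?thesis unfolding freq_def exit_event_def by (simp only: card_exit_event)
qed

lemma first_exit:
  assumes "X \<rho> t \<notin> D" shows "\<exists>t'\<le>t. exit_at \<tau> a D \<rho> t'"
proof -
  have "X \<rho> (LEAST t. X \<rho> t \<notin> D) \<notin> D" using assms by (rule LeastI)
  moreover have "(LEAST t. X \<rho> t \<notin> D) \<le> t" using assms by (rule Least_le)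
  ultimately show ?thesis unfolding exit_at_def using not_less_Least by blast
qed

text \<open>Between the exits from the small and the large ball, a rotor in \<open>A\<close> changes
  only when the walk comes back to its vertex, and such a visit is a \<open>revisit\<close>.\<close>

lemma exit_event_stable:
  assumes \<rho>: "\<rho> \<in> Fo (gball R)" and "r \<le> R" and A: "depends_on A Q" "A \<subseteq> gball r"
    and no: "\<And>x. x \<in> A \<Longrightarrow> \<not> revisit (gball r) (gball R) x \<rho>"
  shows "exit_event (gball r) Q \<rho> \<longleftrightarrow> exit_event (gball R) Q \<rho>"
proof -
  obtain t' where t': "exit_at \<tau> a (gball R) \<rho> t'" using exit_exists_gball[OF \<rho>] ..
  then have "X \<rho> t' \<notin> gball r" using gball_mono[OF assms(2)] by (auto simp: exit_at_def)
  then obtain t where t: "t \<le> t'" "exit_at \<tau> a (gball r) \<rho> t" using first_exit by blast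
  have "Rot \<rho> t' x = Rot \<rho> t x" if x: "x \<in> A" for x
  proof (rule rotors_unvisited[OF t(1)])
    fix s assume s: "t \<le> s" "s < t'"
    show "X \<rho> s \<noteq> x"
    proof
      assume "X \<rho> s = x"
      moreover have "X \<rho> t \<notin> gball r" using t(2) by (simp add: exit_at_def)
      ultimately have "t < s" using s(1) x A(2) by (metis le_neq_implies_less subsetD)
      moreover have "\<forall>u\<le>s. X \<rho> u \<in> gball R" using t' s(2) by (auto simp: exit_at_def)
      ultimately have "revisit (gball r) (gball R) x \<rho>"
        unfolding revisit_def using \<open>X \<rho> s = x\<close> \<open>X \<rho> t \<notin> gball r\<close> by blast
      then show False using no x by blast
    qed
  qed
  then have "Q (Rot \<rho> t') = Q (Rot \<rho> t)" using A(1) unfolding depends_on_def by blast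
  then show ?thesis using exit_event_iff[OF t'] exit_event_iff[OF t(2)] by simp
qed

text \<open>At the exit from the large ball the invariance is exact, so the only error comes from
  stopping at the small ball instead.\<close>

lemma freq_exit_event_diff:
  assumes "r \<le> R" "depends_on A Q" "A \<subseteq> gball r" "finite A"
  shows "\<bar>freq (gball R) (exit_event (gball r) Q) - freq (gball R) Q\<bar>
    \<le> (\<Sum>x\<in>A. freq (gball R) (revisit (gball r) (gball R) x))"
proof -
  have "\<bar>freq (gball R) (exit_event (gball r) Q) - freq (gball R) (exit_event (gball R) Q)\<bar>
      \<le> freq (gball R) (\<lambda>\<rho>. \<exists>x\<in>A. revisit (gball r) (gball R) x \<rho>)"
    by (rule freq_diff_le[OF finite_gball]) (use exit_event_stable assms in blast)
  also have "\<dots> \<le> (\<Sum>x\<in>A. freq (gball R) (revisit (gball r) (gball R) x))"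
    by (rule freq_union_le[OF finite_gball assms(4)])
  finally show ?thesis by (simp add: freq_exit_event)
qed

lemma path_exists: "\<exists>n w. w 0 = x \<and> w n = y \<and> (\<forall>i<n. (w i, w (Suc i)) \<in> E)"
proof -
  obtain n where "(x, y) \<in> E ^^ n" using connected[of x y] rtrancl_imp_relpow by blast
  then show ?thesis unfolding relpow_fun_conv by blast
qed

lemma freq_revisit_le:
  assumes D: "finite D" "a \<in> D" "w ` {..n} \<subseteq> D"
    and w: "\<And>i. i < n \<Longrightarrow> (w i, w (Suc i)) \<in> E" "w 0 = x"
    and \<kappa>: "\<kappa> = (\<Sum>y\<in>E `` {x}. 1 - hit_prob E x y)" "\<kappa> > 0"
  defines "K \<equiv> w ` {..n}"
  shows "freq D (revisit D' D x) \<le> card (E `` {x}) *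
    ((\<Prod>u\<in>K - {x}. card (E `` {u})) * freq D (\<lambda>\<psi>. \<exists>y\<in>D - D'. \<exists>u\<in>K. (y, u) \<in> (rotor_graph D \<psi>)\<^sup>*)
      + hit_prob E x (w n) / \<kappa>)"
proof -
  interpret finite_rotor_system E \<tau> a D by unfold_locales (use D in auto)
  have xD: "x \<in> D" using D(3) w(2) by auto
  let ?D = "D - {x}"
  define far where "far = card {\<psi> \<in> Fo D. \<exists>y\<in>D - D'. \<exists>u\<in>K. (y, u) \<in> (rotor_graph D \<psi>)\<^sup>*}"
  define C where "C = (\<Prod>u\<in>K - {x}. card (E `` {u}))"
  define N where "N = real (card (Fo D))"
  have N: "N > 0" using card_forest_rotors_pos[OF D(1)] by (simp add: N_def)
  have count: "real (connected_count ?D x v) \<le> hit_prob E x v * card (Fo ?D)" for v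
  proof (rule connected_count_le)
    show "(\<Sum>y\<in>E `` {v}. hit_prob E x y) \<le> card (E `` {v}) * hit_prob E x v" if "v \<noteq> x" for v
      using hit_prob_harmonic[OF that, of E] degree_pos[of v] by (simp add: field_simps)
  qed (use D hit_prob_bounds in auto)
  \<comment> \<open>Every neighbour \<open>y\<close> of \<open>x\<close> fails to lead to
    \<open>x\<close> in at least the fraction \<open>1 - hit_prob E x y\<close> of the forests with
    root \<open>x\<close>. Each such forest yields one on \<open>D\<close>, which bounds their
    number by \<open>N / \<kappa>\<close>.\<close>
  have "\<kappa> * card (Fo ?D) = (\<Sum>y\<in>E `` {x}. card (Fo ?D) - hit_prob E x y * card (Fo ?D))"
    by (simp add: \<kappa>(1) sum_distrib_right left_diff_distrib)
  also have "\<dots> \<le> (\<Sum>y\<in>E `` {x}. card (Fo ?D) - real (connected_count ?D x y))"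
    by (intro sum_mono diff_left_mono count)
  also have "\<dots> \<le> N" unfolding N_def by (rule card_forest_ge[OF D(1) xD])
  finally have "card (Fo ?D) \<le> N / \<kappa>" using \<kappa>(2) by (simp add: field_simps)
  then have "real (connected_count ?D x (w n)) \<le> hit_prob E x (w n) * (N / \<kappa>)"
    using count[of "w n"] hit_prob_bounds(1)[of E x "w n"] by (meson mult_left_mono order_trans)
  moreover have "card {\<rho> \<in> Fo D. revisit D' D x \<rho>} \<le> card (E `` {x}) * (C * far + connected_count ?D x (w n))"
    unfolding revisit_def C_def far_def K_def
    using card_revisit_le[OF xD, of D'] card_far_tree_le[OF D(1,3) w, of D']
    by (meson mult_le_mono2 order_trans)
  then have "real (card {\<rho> \<in> Fo D. revisit D' D x \<rho>})
      \<le> card (E `` {x}) * (C * far + real (connected_count ?D x (w n)))"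
    by (metis (mono_tags, lifting) of_nat_add of_nat_le_iff of_nat_mult)
  ultimately have "real (card {\<rho> \<in> Fo D. revisit D' D x \<rho>})
      \<le> card (E `` {x}) * (C * far + hit_prob E x (w n) * (N / \<kappa>))"
    by (smt (verit, best) mult_left_mono of_nat_0_le_iff)
  then have "card {\<rho> \<in> Fo D. revisit D' D x \<rho>} / N
      \<le> card (E `` {x}) * (C * far + hit_prob E x (w n) * (N / \<kappa>)) / N"
    using N by (intro divide_right_mono) auto
  also have "\<dots> = card (E `` {x}) * (C * (far / N) + hit_prob E x (w n) / \<kappa>)"
    using N by (simp add: field_simps)
  finally show ?thesis unfolding freq_def C_def far_def N_def .
qed

end

context one_ended_forest
begin

lemma avg_hit_prob_less_1: "(\<Sum>z\<in>E `` {x}. hit_prob E x z) / card (E `` {x}) < 1"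
proof -
  have "E `` {y} \<noteq> {}" for y using degree_pos[of y] by auto
  then show ?thesis
    using avg_hit_prob_le_return[OF locally_finite, of x] transient
    unfolding transient_graph_def by (meson le_less_trans)
qed

lemma escape_pos: "(\<Sum>y\<in>E `` {x}. 1 - hit_prob E x y) > 0"
  using avg_hit_prob_less_1[of x] degree_pos[of x] by (simp add: sum_subtractf field_simps)

text \<open>The radius \<open>r\<close> is chosen by means of the infinite forest, where far
  descendants are rare. Then \<open>R\<close> must be large enough for one fixed finitely determined
  event to have nearly its limiting frequency.\<close>

lemma late_revisit_rare:
  assumes "\<epsilon> > 0"
  shows "\<exists>r0. \<forall>r\<ge>r0. \<exists>R0. \<forall>R\<ge>R0. freq (gball R) (revisit (gball r) (gball R) x) < \<epsilon>"
proof -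
  define \<kappa> where "\<kappa> = (\<Sum>y\<in>E `` {x}. 1 - hit_prob E x y)"
  have \<kappa>: "\<kappa> > 0" using escape_pos by (simp add: \<kappa>_def)
  define d where "d = real (card (E `` {x}))"
  have d: "d > 0" using degree_pos[of x] by (simp add: d_def)
  have "E `` {y} \<noteq> {}" for y using degree_pos[of y] by auto
  \<comment> \<open>This threshold bounds \<open>d * hit_prob E x v / \<kappa>\<close> by half of
    \<epsilon>; the other half is reserved for far descendants of the path.\<close>
  then obtain v where v: "hit_prob E x v < \<epsilon> * \<kappa> / (2 * d)"
    using hit_prob_arbitrarily_small[where E = E and x = x and c = "\<epsilon> * \<kappa> / (2 * d)",
        OF locally_finite _ avg_hit_prob_less_1]
      assms \<kappa> d by auto
  obtain n w where w: "w 0 = x" "w n = v" "\<And>i. i < n \<Longrightarrow> (w i, w (Suc i)) \<in> E"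
    using path_exists[of x v] by blast
  define K where "K = w ` {..n}"
  have finK: "finite K" by (simp add: K_def)
  define C where "C = real (\<Prod>u\<in>K - {x}. card (E `` {u}))"
  have C: "C \<ge> 0" by (simp add: C_def prod_nonneg)
  have "(\<lambda>r. d * (C * prob {F \<in> space W. far_event K r F})) \<longlonglongrightarrow> d * (C * 0)"
    by (intro tendsto_intros far_event_LIMSEQ finK)
  then have "\<forall>\<^sub>F r in sequentially. d * (C * prob {F \<in> space W. far_event K r F}) < \<epsilon> / 2"
    using assms by (intro order_tendstoD(2)) auto
  then obtain r1 where r1: "\<And>r. r \<ge> r1 \<Longrightarrow> d * (C * prob {F \<in> space W. far_event K r F}) < \<epsilon> / 2"
    unfolding eventually_sequentially by blast
  obtain r2 where r2: "\<And>r. r \<ge> r2 \<Longrightarrow> K \<subseteq> gball r" using finite_subset_gball[OF finK] by blast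
  have "\<exists>R0. \<forall>R\<ge>R0. freq (gball R) (revisit (gball r) (gball R) x) < \<epsilon>" if r: "r \<ge> max r1 r2" for r
  proof -
    \<comment> \<open>One extra layer suffices: a path coming from outside enters
      \<open>gball r\<close> from a neighbour of it, so far descendants in any larger ball already
      show here.\<close>
    let ?S = "gball (Suc r)"
    define Q where "Q \<rho> \<longleftrightarrow> (\<exists>y\<in>?S - gball r. \<exists>u\<in>K. (y, u) \<in> (rotor_graph ?S \<rho>)\<^sup>*)" for \<rho>
    have Q: "depends_on ?S Q" unfolding Q_def by (rule depends_on_leads)
    have "prob {F \<in> space W. Q (rotor_of F)} \<le> prob {F \<in> space W. far_event K r F}"
    proof (rule finite_measure_mono_AE)
      show "{F \<in> space W. far_event K r F} \<in> events" by (rule predE[OF pred_far_event[OF finK]])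
      show "AE F in W. F \<in> {F \<in> space W. Q (rotor_of F)} \<longrightarrow> F \<in> {F \<in> space W. far_event K r F}"
        using AE_rotor_graph
      proof eventually_elim
        case (elim F)
        have "(y, u) \<in> F\<^sup>*" if "(y, u) \<in> (rotor_graph ?S (rotor_of F))\<^sup>*" for y u
          using leads_mono[OF subset_UNIV that] elim by metis
        then show ?case unfolding Q_def far_event_def by blast
      qed
    qed
    then have "d * (C * prob {F \<in> space W. Q (rotor_of F)}) \<le> d * (C * prob {F \<in> space W. far_event K r F})"
      using d C by (simp add: mult_left_mono)
    then have "d * (C * prob {F \<in> space W. Q (rotor_of F)}) < \<epsilon> / 2"
      using r1[of r] r by simp
    moreover have "(\<lambda>R. d * (C * freq (gball R) Q)) \<longlonglongrightarrow> d * (C * prob {F \<in> space W. Q (rotor_of F)})"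
      by (intro tendsto_intros transfer_LIMSEQ[OF finite_gball Q])
    ultimately have "\<forall>\<^sub>F R in sequentially. d * (C * freq (gball R) Q) < \<epsilon> / 2"
      by (intro order_tendstoD(2))
    then obtain R1 where R1: "\<And>R. R \<ge> R1 \<Longrightarrow> d * (C * freq (gball R) Q) < \<epsilon> / 2"
      unfolding eventually_sequentially by blast
    have "freq (gball R) (revisit (gball r) (gball R) x) < \<epsilon>" if R: "R \<ge> max R1 r2" for R
    proof -
      let ?D = "gball R"
      have "freq ?D (revisit (gball r) ?D x)
        \<le> d * (C * freq ?D (\<lambda>\<psi>. \<exists>y\<in>?D - gball r. \<exists>u\<in>K. (y, u) \<in> (rotor_graph ?D \<psi>)\<^sup>*) + hit_prob E x v / \<kappa>)"
        using freq_revisit_le[OF finite_gball a_in_gball, of w n R x \<kappa> "gball r"] w r2[of R] R \<kappa>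
        by (simp add: C_def d_def K_def \<kappa>_def)
      also have "\<dots> \<le> d * (C * freq ?D Q + hit_prob E x v / \<kappa>)"
      proof -
        have "freq ?D (\<lambda>\<psi>. \<exists>y\<in>?D - gball r. \<exists>u\<in>K. (y, u) \<in> (rotor_graph ?D \<psi>)\<^sup>*) \<le> freq ?D Q"
        proof (rule freq_mono[OF finite_gball])
          fix \<psi> assume \<psi>: "\<psi> \<in> Fo ?D"
            and "\<exists>y\<in>?D - gball r. \<exists>u\<in>K. (y, u) \<in> (rotor_graph ?D \<psi>)\<^sup>*"
          then obtain y u where yu: "y \<in> ?D - gball r" "u \<in> K" "(y, u) \<in> (rotor_graph ?D \<psi>)\<^sup>*" by blast
          have "z \<in> ?S" if "z \<in> ?D - gball r" "\<psi> z \<in> gball r" for z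
          proof (rule gball_Suc[OF that(2)])
            have "(z, \<psi> z) \<in> E" using Conf_edge[OF forest_rotors_PiE[OF \<psi>], of z] that(1) by blast
            then show "(\<psi> z, z) \<in> E" using sym_E by (rule symD[rotated])
          qed
          moreover have "u \<in> gball r" using r2[of r] r yu(2) by auto
          moreover have "gball r \<subseteq> ?S" by (simp add: gball_mono)
          ultimately have "\<exists>y'\<in>?S - gball r. (y', u) \<in> (rotor_graph ?S \<psi>)\<^sup>*"
            using leads_outside_truncate[OF yu(3), of "gball r" ?S] yu(1) by blast
          then show "Q \<psi>" unfolding Q_def using yu(2) by blast
        qed
        then show ?thesis using d C by (simp add: mult_left_mono)
      qed
      also have "\<dots> = d * (C * freq ?D Q) + d * hit_prob E x v / \<kappa>" by (simp add: algebra_simps)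
      also have "\<dots> < \<epsilon> / 2 + \<epsilon> / 2"
      proof (rule add_strict_mono)
        show "d * (C * freq ?D Q) < \<epsilon> / 2" using R1 R by simp
        show "d * hit_prob E x v / \<kappa> < \<epsilon> / 2" using v d \<kappa> by (simp add: field_simps)
      qed
      finally show ?thesis by simp
    qed
    then show ?thesis by blast
  qed
  then show ?thesis by blast
qed

subsection \<open>The limit\<close>

definition returns_after :: "nat \<Rightarrow> 'v \<Rightarrow> ('v \<Rightarrow> 'v) \<Rightarrow> bool" where
  "returns_after r x \<rho> \<longleftrightarrow> (\<exists>R. revisit (gball r) (gball R) x \<rho>)"

lemma returns_afterI:
  assumes "t < s" "X \<rho> t \<notin> gball r" "X \<rho> s = x" shows "returns_after r x \<rho>"
proof -
  have "finite (X \<rho> ` {..s})" by simp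
  then obtain R where "X \<rho> ` {..s} \<subseteq> gball R" using finite_subset_gball[of "X \<rho> ` {..s}"] by blast
  then have "revisit (gball r) (gball R) x \<rho>"
    unfolding revisit_def using assms by (intro exI[of _ t] exI[of _ s]) auto
  then show ?thesis unfolding returns_after_def by blast
qed

lemma event_revisit: "{F \<in> space W. revisit D' (gball R) x (rotor_of F)} \<in> events"
  by (rule event_rotor_of[OF pred_depends_on[OF countable_V finite_gball depends_on_revisit]])

lemma event_returns_after: "{F \<in> space W. returns_after r x (rotor_of F)} \<in> events"
proof -
  have "{F \<in> space W. returns_after r x (rotor_of F)} = (\<Union>R. {F \<in> space W. revisit (gball r) (gball R) x (rotor_of F)})"
    by (auto simp: returns_after_def)
  then show ?thesis using event_revisit by auto
qed

text \<open>For a fixed confinement \<open>gball R\<close> the probability is a limit of frequencies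
  over \<open>gball R'\<close>, where the event is dominated by the one confined to
  \<open>gball R'\<close>. The bound is therefore uniform in \<open>R\<close> and survives the
  increasing union.\<close>

lemma prob_returns_after:
  assumes "\<epsilon> > 0"
  shows "\<exists>r0. \<forall>r\<ge>r0. prob {F \<in> space W. returns_after r x (rotor_of F)} \<le> \<epsilon>"
proof -
  obtain r0 where r0: "\<And>r. r \<ge> r0 \<Longrightarrow> \<exists>R0. \<forall>R\<ge>R0. freq (gball R) (revisit (gball r) (gball R) x) < \<epsilon>"
    using late_revisit_rare[OF assms] by blast
  have "prob {F \<in> space W. returns_after r x (rotor_of F)} \<le> \<epsilon>" if r: "r \<ge> r0" for r
  proof -
    define A where "A R = {F \<in> space W. revisit (gball r) (gball R) x (rotor_of F)}" for R
    obtain R0 where R0: "\<And>R. R \<ge> R0 \<Longrightarrow> freq (gball R) (revisit (gball r) (gball R) x) < \<epsilon>"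
      using r0[OF r] by blast
    have "prob (A R) \<le> \<epsilon>" for R
    proof (rule LIMSEQ_le_const2)
      show "(\<lambda>R'. freq (gball R') (revisit (gball r) (gball R) x)) \<longlonglongrightarrow> prob (A R)"
        unfolding A_def by (rule transfer_LIMSEQ[OF finite_gball depends_on_revisit])
      show "\<exists>N. \<forall>R'\<ge>N. freq (gball R') (revisit (gball r) (gball R) x) \<le> \<epsilon>"
      proof (intro exI[of _ "max R R0"] allI impI)
        fix R' assume R': "max R R0 \<le> R'"
        have "freq (gball R') (revisit (gball r) (gball R) x) \<le> freq (gball R') (revisit (gball r) (gball R') x)"
          by (rule freq_mono[OF finite_gball]) (rule revisit_mono[OF gball_mono], use R' in auto)
        also have "\<dots> \<le> \<epsilon>" using R0[of R'] R' by simp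
        finally show "freq (gball R') (revisit (gball r) (gball R) x) \<le> \<epsilon>" .
      qed
    qed
    moreover have "incseq A"
      unfolding A_def incseq_def using revisit_mono[OF gball_mono] by blast
    then have "(\<lambda>R. prob (A R)) \<longlonglongrightarrow> prob (\<Union>R. A R)"
      by (rule finite_Lim_measure_incseq[rotated]) (use event_revisit in \<open>auto simp: A_def\<close>)
    ultimately have "prob (\<Union>R. A R) \<le> \<epsilon>" by (intro LIMSEQ_le_const2) auto
    moreover have "(\<Union>R. A R) = {F \<in> space W. returns_after r x (rotor_of F)}"
      by (auto simp: A_def returns_after_def)
    ultimately show ?thesis by simp
  qed
  then show ?thesis by blast
qed

text \<open>An exit from a ball sees only the rotors inside it, and there an acyclic wired forest
  restricts to a finite forest, for which the exit is known.\<close>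

lemma AE_exits: "AE F in W. \<forall>r. \<exists>t. exit_at \<tau> a (gball r) (rotor_of F) t"
  using AE_rotor_graph AE_acyclic
proof eventually_elim
  case (elim F)
  show ?case
  proof
    fix r
    have "restrict (rotor_of F) (gball r) \<in> Fo (gball r)"
      using restrict_forest[OF elim(2)] elim(1) finite_gball by blast
    then obtain t where "exit_at \<tau> a (gball r) (restrict (rotor_of F) (gball r)) t"
      using exit_exists_gball by blast
    then have "exit_at \<tau> a (gball r) (rotor_of F) t"
      by (rule exit_at_local(1)[rotated]) simp
    then show "\<exists>t. exit_at \<tau> a (gball r) (rotor_of F) t" ..
  qed
qed

text \<open>The walk leaves every ball. If after some exit it never comes back to \<open>x\<close>,
  all visits to \<open>x\<close> precede that time; a return after the exit from every ball has
  probability below every positive \<epsilon>.\<close>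

lemma AE_rotor_transient: "AE F in W. rotor_transient \<tau> a (rotor_of F)"
proof -
  have "AE F in W. \<exists>r. \<not> returns_after r x (rotor_of F)" for x
  proof -
    define A where "A = (\<Inter>r. {F \<in> space W. returns_after r x (rotor_of F)})"
    have "prob A \<le> \<epsilon>" if \<epsilon>: "\<epsilon> > 0" for \<epsilon>
    proof -
      obtain r where "prob {F \<in> space W. returns_after r x (rotor_of F)} \<le> \<epsilon>"
        using prob_returns_after[OF \<epsilon>, of x] by blast
      moreover have "prob A \<le> prob {F \<in> space W. returns_after r x (rotor_of F)}"
        using event_returns_after by (intro finite_measure_mono) (auto simp: A_def)
      ultimately show ?thesis by simp
    qed
    then have "prob A \<le> 0" by (rule field_le_epsilon) simp
    then have "prob A = 0" by (simp add: measure_le_0_iff)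
    moreover have "A \<in> events" unfolding A_def using event_returns_after by auto
    ultimately have "AE F in W. F \<notin> A" by (simp add: prob_eq_0)
    then show ?thesis using AE_space by eventually_elim (auto simp: A_def)
  qed
  then have "AE F in W. \<forall>x\<in>UNIV. \<exists>r. \<not> returns_after r x (rotor_of F)"
    by (subst AE_ball_countable[OF countable_V]) auto
  then show ?thesis
    using AE_exits
  proof eventually_elim
    case (elim F)
    show ?case
      unfolding rotor_transient_def
    proof
      fix x
      obtain r where r: "\<not> returns_after r x (rotor_of F)" using elim(1) by blast
      obtain t where "exit_at \<tau> a (gball r) (rotor_of F) t" using elim(2) by blast
      then have "X (rotor_of F) t \<notin> gball r" by (simp add: exit_at_def)
      then have "X (rotor_of F) s \<noteq> x" if "t < s" for s
        using r returns_afterI[OF that] by blast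
      then have "{s. X (rotor_of F) s = x} \<subseteq> {..t}"
        using not_le_imp_less by blast
      then show "finite {s. X (rotor_of F) s = x}" by (rule finite_subset) simp
    qed
  qed
qed

lemma final_rotors_eqI:
  assumes "\<And>s. s \<ge> t \<Longrightarrow> Rot \<rho> s x = y" shows "final_rotors \<tau> a \<rho> x = y"
  unfolding final_rotors_def
proof (rule the_equality)
  show ev: "\<forall>\<^sub>F s in sequentially. Rot \<rho> s x = y"
    using assms by (auto simp: eventually_sequentially)
  show "z = y" if "\<forall>\<^sub>F s in sequentially. Rot \<rho> s x = z" for z
  proof -
    have "\<forall>\<^sub>F s in sequentially. z = y" using ev that by eventually_elim simp
    then show ?thesis by simp
  qed
qed

lemma final_rotors_exit:
  assumes "exit_at \<tau> a (gball r) \<rho> t" "x \<in> gball r" "\<not> returns_after r x \<rho>"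
  shows "final_rotors \<tau> a \<rho> x = Rot \<rho> t x"
proof (rule final_rotors_eqI)
  fix s assume "t \<le> s"
  then show "Rot \<rho> s x = Rot \<rho> t x"
  proof (rule rotors_unvisited)
    fix u assume "t \<le> u"
    moreover have "X \<rho> t \<notin> gball r" using assms(1) by (simp add: exit_at_def)
    ultimately show "X \<rho> u \<noteq> x"
      using assms(2,3) returns_afterI by (metis le_neq_implies_less)
  qed
qed

section \<open>Measurability of the walk and of the final rotors\<close>

lemma pred_walk:
  "Measurable.pred rotor_space (\<lambda>\<rho>. X \<rho> t = y)" "Measurable.pred rotor_space (\<lambda>\<rho>. Rot \<rho> t x = z)"
proof (induction t arbitrary: x y z)
  case 0
  { case (1 y) then show ?case by simp }
  { case (2 x z) then show ?case by (simp add: pred_component_eq) }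
next
  case (Suc t)
  have X: "Measurable.pred rotor_space (\<lambda>\<rho>. X \<rho> (Suc t) = y)" for y
  proof -
    have "(\<lambda>\<rho>. X \<rho> (Suc t) = y) = (\<lambda>\<rho>. \<exists>u\<in>UNIV. \<exists>v\<in>UNIV. X \<rho> t = u \<and> Rot \<rho> t u = v \<and> \<tau> u v = y)"
      by (auto simp: walk_position_Suc)
    then show ?thesis
      by (simp only:) (intro pred_countable_Bex countable_V pred_intros_logic Suc, simp)
  qed
  { case (1 y) show ?case by (rule X) }
  { case (2 x z)
    have "(\<lambda>\<rho>. Rot \<rho> (Suc t) x = z) = (\<lambda>\<rho>. (X \<rho> t = x \<and> X \<rho> (Suc t) = z) \<or> (\<not> X \<rho> t = x \<and> Rot \<rho> t x = z))"
      by (auto simp: walk_rotors_Suc)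
    then show ?case
      by (simp only:) (intro pred_intros_logic Suc X) }
qed

lemma measurable_final_rotors: "final_rotors \<tau> a \<in> measurable rotor_space rotor_space"
proof -
  have "(\<lambda>\<rho>. final_rotors \<tau> a \<rho> x) \<in> measurable rotor_space (count_space UNIV)" for x
  proof (rule measurable_countable_values[OF countable_V])
    fix y
    define P where "P z \<rho> \<longleftrightarrow> (\<exists>N. \<forall>t\<in>{N..}. Rot \<rho> t x = z)" for z \<rho>
    have P: "Measurable.pred rotor_space (P z)" for z
      unfolding P_def[abs_def] by (intro pred_intros_countable pred_intros_countable_bounded pred_walk)
    have P_final: "final_rotors \<tau> a \<rho> x = z" if "P z \<rho>" for z \<rho>
      using that final_rotors_eqI unfolding P_def by blast
    \<comment> \<open>Without a limit the description has no solution, and \<open>THE\<close> yields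
      one value common to all such \<rho>. The exceptional set is thus a single measurable
      case.\<close>
    have none: "final_rotors \<tau> a \<rho> x = (THE y. False)" if "\<not> (\<exists>z\<in>UNIV. P z \<rho>)" for \<rho>
    proof -
      have "\<not> (\<forall>\<^sub>F s in sequentially. Rot \<rho> s x = z)" for z
        using that unfolding P_def eventually_sequentially by (metis UNIV_I atLeast_iff)
      then show ?thesis by (simp add: final_rotors_def)
    qed
    have "(\<lambda>\<rho>. final_rotors \<tau> a \<rho> x = y)
        = (\<lambda>\<rho>. P y \<rho> \<or> (\<not> (\<exists>z\<in>UNIV. P z \<rho>) \<and> (THE y. False) = y))"
      using P_final none by (metis UNIV_I)
    then show "Measurable.pred rotor_space (\<lambda>\<rho>. final_rotors \<tau> a \<rho> x = y)"
      by (simp only:) (intro pred_intros_logic pred_countable_Bex countable_V P measurable_const, simp)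
  qed
  then show ?thesis
    unfolding rotor_space_def by (intro measurable_PiM_single') (auto simp: PiE_def)
qed

text \<open>The exit event of one ball mediates. It is close to the final rotors because late
  returns are rare under \<open>W\<close>, and close to the initial ones because they are rare in
  finite forests, where exits preserve the law.\<close>

lemma prob_final_rotors:
  assumes A: "finite A" and Q: "depends_on A Q"
  shows "prob {F \<in> space W. Q (final_rotors \<tau> a (rotor_of F))} = prob {F \<in> space W. Q (rotor_of F)}"
proof -
  let ?fin = "{F \<in> space W. Q (final_rotors \<tau> a (rotor_of F))}"
  let ?ini = "{F \<in> space W. Q (rotor_of F)}"
  have pQ: "Measurable.pred rotor_space Q" by (rule pred_depends_on[OF countable_V A Q])
  have fin: "?fin \<in> events"
    by (rule event_rotor_of) (rule measurable_compose[OF measurable_final_rotors pQ])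
  have "\<bar>prob ?fin - prob ?ini\<bar> \<le> 2 * (card A * \<epsilon>)" if \<epsilon>: "\<epsilon> > 0" for \<epsilon> :: real
  proof -
    have "\<forall>x. \<exists>r0. \<forall>r\<ge>r0. prob {F \<in> space W. returns_after r x (rotor_of F)} \<le> \<epsilon>"
      using prob_returns_after[OF \<epsilon>] by blast
    then obtain f where f: "\<And>x r. r \<ge> f x \<Longrightarrow> prob {F \<in> space W. returns_after r x (rotor_of F)} \<le> \<epsilon>"
      by metis
    have "\<forall>x. \<exists>r0. \<forall>r\<ge>r0. \<exists>R0. \<forall>R\<ge>R0. freq (gball R) (revisit (gball r) (gball R) x) < \<epsilon>"
      using late_revisit_rare[OF \<epsilon>] by blast
    then obtain g where g: "\<And>x r. r \<ge> g x \<Longrightarrow> \<exists>R0. \<forall>R\<ge>R0. freq (gball R) (revisit (gball r) (gball R) x) < \<epsilon>"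
      by metis
    obtain r1 where r1: "\<And>r. r \<ge> r1 \<Longrightarrow> A \<subseteq> gball r" using finite_subset_gball[OF A] by blast
    \<comment> \<open>Sums replace maxima over \<open>A\<close>: they exceed every single threshold
      and need no case distinction for empty \<open>A\<close>.\<close>
    define r where "r = r1 + (\<Sum>x\<in>A. f x) + (\<Sum>x\<in>A. g x)"
    have "f x \<le> (\<Sum>x\<in>A. f x)" "g x \<le> (\<Sum>x\<in>A. g x)" if "x \<in> A" for x
      using A that by (auto intro: member_le_sum)
    then have r: "f x \<le> r" "g x \<le> r" if "x \<in> A" for x
      using that unfolding r_def by (meson le_add1 le_add2 order_trans trans_le_add1)+
    have Ar: "A \<subseteq> gball r" using r1 by (simp add: r_def)
    let ?mid = "{F \<in> space W. exit_event (gball r) Q (rotor_of F)}"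
    have dep: "depends_on (gball r) (exit_event (gball r) Q)" by (rule depends_on_exit_event[OF Q Ar])
    have mid: "?mid \<in> events"
      by (rule event_rotor_of[OF pred_depends_on[OF countable_V finite_gball dep]])
    have "\<bar>prob ?mid - prob ?ini\<bar> \<le> card A * \<epsilon>"
    proof (rule LIMSEQ_le_const2)
      show "(\<lambda>R. \<bar>freq (gball R) (exit_event (gball r) Q) - freq (gball R) Q\<bar>) \<longlonglongrightarrow> \<bar>prob ?mid - prob ?ini\<bar>"
        by (intro tendsto_intros transfer_LIMSEQ[OF finite_gball dep] transfer_LIMSEQ[OF A Q])
      have "\<forall>x\<in>A. \<forall>\<^sub>F R in sequentially. freq (gball R) (revisit (gball r) (gball R) x) < \<epsilon>"
        unfolding eventually_sequentially using g r(2) by blast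
      then have "\<forall>\<^sub>F R in sequentially. \<forall>x\<in>A. freq (gball R) (revisit (gball r) (gball R) x) < \<epsilon>"
        using A by (simp add: eventually_ball_finite)
      then have "\<forall>\<^sub>F R in sequentially. \<bar>freq (gball R) (exit_event (gball r) Q) - freq (gball R) Q\<bar> \<le> card A * \<epsilon>"
        using eventually_ge_at_top[of r]
      proof eventually_elim
        case (elim R)
        have "(\<Sum>x\<in>A. freq (gball R) (revisit (gball r) (gball R) x)) \<le> card A * \<epsilon>"
          by (rule sum_bounded_above) (use elim(1) in \<open>auto intro: less_imp_le\<close>)
        then show ?case using freq_exit_event_diff[OF elim(2) Q Ar A] by linarith
      qed
      then show "\<exists>N. \<forall>R\<ge>N. \<bar>freq (gball R) (exit_event (gball r) Q) - freq (gball R) Q\<bar> \<le> card A * \<epsilon>"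
        by (simp add: eventually_sequentially)
    qed
    moreover have "\<bar>prob ?fin - prob ?mid\<bar> \<le> card A * \<epsilon>"
    proof -
      define N where "N = (\<Union>x\<in>A. {F \<in> space W. returns_after r x (rotor_of F)})"
      have N: "N \<in> events" unfolding N_def using A event_returns_after by auto
      have "prob N \<le> (\<Sum>x\<in>A. prob {F \<in> space W. returns_after r x (rotor_of F)})"
        unfolding N_def using A event_returns_after by (intro finite_measure_subadditive_finite) auto
      also have "\<dots> \<le> card A * \<epsilon>"
        by (rule sum_bounded_above) (use f r(1) in auto)
      finally have N_le: "prob N \<le> card A * \<epsilon>" .
      have same: "AE F in W. F \<notin> N \<longrightarrow> (F \<in> ?fin \<longleftrightarrow> F \<in> ?mid)"
        using AE_exits AE_space
      proof eventually_elim
        case (elim F)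
        obtain t where t: "exit_at \<tau> a (gball r) (rotor_of F) t" using elim(1) by blast
        show ?case
        proof
          assume "F \<notin> N"
          then have "final_rotors \<tau> a (rotor_of F) x = Rot (rotor_of F) t x" if "x \<in> A" for x
            using final_rotors_exit[OF t] that Ar elim(2) by (auto simp: N_def)
          then have "Q (final_rotors \<tau> a (rotor_of F)) = Q (Rot (rotor_of F) t)"
            using Q unfolding depends_on_def by blast
          then show "F \<in> ?fin \<longleftrightarrow> F \<in> ?mid" using exit_event_iff[OF t] by simp
        qed
      qed
      have "prob ?fin \<le> prob (?mid \<union> N)" "prob ?mid \<le> prob (?fin \<union> N)"
        by (rule finite_measure_mono_AE; use same fin mid N in \<open>auto elim!: eventually_mono\<close>)+
      moreover have "prob (?mid \<union> N) \<le> prob ?mid + prob N" "prob (?fin \<union> N) \<le> prob ?fin + prob N"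
        using fin mid N by (simp_all add: measure_Un_le)
      ultimately show ?thesis using N_le by linarith
    qed
    ultimately show ?thesis by linarith
  qed
  note bound = this
  have "\<bar>prob ?fin - prob ?ini\<bar> \<le> 0"
  proof (rule field_le_epsilon)
    fix e :: real assume e: "e > 0"
    \<comment> \<open>The added 1 keeps the denominator positive when \<open>A\<close> is
      empty.\<close>
    let ?\<epsilon> = "e / (2 * (card A + 1))"
    have "\<bar>prob ?fin - prob ?ini\<bar> \<le> 2 * (card A * ?\<epsilon>)" by (rule bound) (use e in simp)
    also have "\<dots> \<le> e" using e by (simp add: field_simps)
    finally show "\<bar>prob ?fin - prob ?ini\<bar> \<le> 0 + e" by simp
  qed
  then show ?thesis by simp
qed

lemma distr_final_rotors:
  "distr W rotor_space (\<lambda>F. final_rotors \<tau> a (rotor_of F)) = distr W rotor_space rotor_of"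
proof -
  have mf: "(\<lambda>F. final_rotors \<tau> a (rotor_of F)) \<in> measurable W rotor_space"
    by (rule measurable_compose[OF measurable_rotor_of measurable_final_rotors])
  show ?thesis
  proof (rule measure_eqI_PiM_infinite)
    show "sets (distr W rotor_space (\<lambda>F. final_rotors \<tau> a (rotor_of F))) = sets (PiM UNIV (\<lambda>_. count_space UNIV))"
      "sets (distr W rotor_space rotor_of) = sets (PiM UNIV (\<lambda>_. count_space UNIV))"
      by (simp_all add: rotor_space_def)
    show "finite_measure (distr W rotor_space (\<lambda>F. final_rotors \<tau> a (rotor_of F)))"
      by (rule finite_measure_distr[OF mf])
    fix A :: "'v \<Rightarrow> 'v set" and J :: "'v set" assume J: "finite J"
    define Q where "Q \<rho> \<longleftrightarrow> (\<forall>x\<in>J. \<rho> x \<in> A x)" for \<rho> :: "'v \<Rightarrow> 'v"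
    have Q: "depends_on J Q" by (auto simp: depends_on_def Q_def)
    have cyl: "prod_emb UNIV (\<lambda>_. count_space UNIV) J (PiE J A) = {\<rho>. Q \<rho>}"
      by (auto simp: prod_emb_def Q_def PiE_def Pi_def)
    have meas: "{\<rho>. Q \<rho>} \<in> sets rotor_space"
      using pred_depends_on[OF countable_V J Q] by (simp add: pred_def)
    have "emeasure (distr W rotor_space (\<lambda>F. final_rotors \<tau> a (rotor_of F))) {\<rho>. Q \<rho>}
        = emeasure W {F \<in> space W. Q (final_rotors \<tau> a (rotor_of F))}"
      by (subst emeasure_distr[OF mf meas]) (auto intro!: arg_cong[where f = "emeasure W"])
    moreover have "emeasure (distr W rotor_space rotor_of) {\<rho>. Q \<rho>} = emeasure W {F \<in> space W. Q (rotor_of F)}"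
      by (subst emeasure_distr[OF measurable_rotor_of meas]) (auto intro!: arg_cong[where f = "emeasure W"])
    ultimately show "emeasure (distr W rotor_space (\<lambda>F. final_rotors \<tau> a (rotor_of F))) (prod_emb UNIV (\<lambda>_. count_space UNIV) J (PiE J A))
        = emeasure (distr W rotor_space rotor_of) (prod_emb UNIV (\<lambda>_. count_space UNIV) J (PiE J A))"
      unfolding cyl by (simp add: emeasure_eq_measure prob_final_rotors[OF J Q])
  qed
qed

end

theorem theorem1p2:
  fixes E :: "'v rel" and \<tau> :: "'v \<Rightarrow> 'v \<Rightarrow> 'v" and a :: 'v and W :: "'v rel measure"
  assumes "sym E" and "irrefl E"
    and connected: "\<And>x y. (x, y) \<in> E\<^sup>*"
    and locally_finite: "\<And>x. finite (E `` {x})"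
    and "transient_graph E"
    and "\<And>x. local_mechanism E x (\<tau> x)"
    and "is_WSF E W"
    and one_end: "AE F in W. \<forall>T\<in>forest_trees F. card (ends F T) = 1"
  shows "(AE F in W. rotor_transient \<tau> a (rotor_of F)) \<and>
    distr W rotor_space (\<lambda>F. final_rotors \<tau> a (rotor_of F)) = distr W rotor_space rotor_of"
proof -
  have PS: "prob_space W" using assms(7) by (simp add: is_WSF_def)
  \<comment> \<open>An end supplies an injective ray and hence infinitely many vertices. One forest
    with such trees exists because \<open>W\<close> has total mass 1.\<close>
  have inf: "infinite (UNIV :: 'v set)"
  proof -
    obtain F :: "'v rel" where F: "\<forall>T\<in>forest_trees F. card (ends F T) = 1"
      using eventually_happens'[OF prob_space.ae_filter_bot[OF PS] one_end] by blast
    define T where "T = (F \<union> F\<inverse>)\<^sup>* `` {a}"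
    have "T \<in> forest_trees F" by (simp add: T_def forest_trees_def quotientI)
    then have "ends F T \<noteq> {}" using F by fastforce
    then obtain p where "p \<in> rays F T" by (auto simp: ends_def quotient_def)
    then have "inj p" by (simp add: rays_def)
    then show ?thesis by (metis finite_subset range_inj_infinite subset_UNIV)
  qed
  have mech: "bij_betw (\<tau> x) (E `` {x}) (E `` {x})" for x
    using assms(6)[of x] by (simp add: local_mechanism_def)
  interpret one_ended_forest E \<tau> a W
  proof unfold_locales
    show "(x, \<tau> x y) \<in> E" if "(x, y) \<in> E" for x y
      using bij_betwE[OF mech[of x]] that by auto
    show "inj_on (\<tau> x) (E `` {x})" for x
      using mech[of x] by (rule bij_betw_imp_inj_on)
  qed (fact assms inf)+
  show ?thesis using AE_rotor_transient distr_final_rotors by blast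
qed

end
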